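(* Let $n\ge1$ and let $\lambda,\mu,\nu$ be partitions. The $\mathbb Z_n$ vertex $\mathsf V^n_{\lambda\mu\nu}=\mathsf V^n_{\lambda\mu\nu}(q_0,\dots,q_{n-1})$ is given by $$\mathsf V^n_{\lambda\mu\nu}=\mathsf V^n_{\emptyset\emptyset\emptyset}\cdot q^{-A_\lambda}\cdot\overline{q^{-A_{\mu'}}}\cdot H_\nu\cdot O_\nu\cdot\sum_{\eta}q_0^{-|\eta|}\cdot\overline{s_{\lambda'/\eta}(\mathfrak q_{\bullet-\nu})}\cdot s_{\mu/\eta}(\mathfrak q_{\bullet-\nu'}),$$ where the sum is over all partitions $\eta$, $s_{\alpha/\beta}$ is the skew Schur function ($s_{\alpha/\beta}=0$ if $\beta\not\subset\alpha$), the overline denotes the exchange of variables $q_k\leftrightarrow q_{-k}$ (indices in $\mathbb Z_n$), and $$H_\nu=\prod_{(i,j)\in\nu}\frac{1}{1-\prod_{s=1}^{n}q_s^{h^s_\nu(i,j)}},\qquad h^s_\nu(i,j)=\text{the number of boxes of color } s \text{ in the hook of }\nu\text{ at }(i,j),$$ $$O_\nu=\prod_{k=0}^{n-1}\mathsf V^n_{\emptyset\emptyset\emptyset}(q_k,q_{k+1},\dots,q_{n+k-1})^{-2|\nu|_k+|\nu|_{k+1}+|\nu|_{k-1}},$$ $$\mathsf V^n_{\emptyset\emptyset\emptyset}=M(1,q)^n\prod_{0<a\le b<n}M(q_a\cdots q_b,q)\,M(q_a^{-1}\cdots q_b^{-1},q),\qquad M(v,q)=\prod_{m=1}^\infty\frac{1}{(1-vq^m)^m},$$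 with $q=q_0q_1\cdots q_{n-1}$.
   Context: **The vertex.** A partition is identified with its diagram, a finite subset of $(\mathbb Z_{\ge0})^2$ closed under decreasing coordinates; its parts are $\lambda_j=\min\{i:(i,j)\notin\lambda\}$ for $j\ge0$, so $\lambda=(\lambda_0\ge\lambda_1\ge\cdots)$; $\lambda'=\{(i,j):(j,i)\in\lambda\}$ is the conjugate. A 3D partition $\pi$ asymptotic to $(\lambda,\mu,\nu)$ is a subset $\pi\subset(\mathbb Z_{\ge0})^3$ such that if any of $(i+1,j,k),(i,j+1,k),(i,j,k+1)$ is in $\pi$ then $(i,j,k)\in\pi$; and $(j,k)\in\lambda$ iff $(i,j,k)\in\pi$ for all $i\gg0$; $(k,i)\in\mu$ iff $(i,j,k)\in\pi$ for all $j\gg0$; $(i,j)\in\nu$ iff $(i,j,k)\in\pi$ for all $k\gg0$. The legs of $\pi$ are $\{(i,j,k):(j,k)\in\lambda\}$, $\{(i,j,k):(k,i)\in\mu\}$, $\{(i,j,k):(i,j)\in\nu\}$, and $\xi_\pi(i,j,k)=1-\#\{\text{legs containing }(i,j,k)\}$. Then $$\mathsf V^n_{\lambda\mu\nu}=\sum_\pi q_0^{|\pi|_0}\cdots q_{n-1}^{|\pi|_{n-1}},\qquad|\pi|_a=\sum_{(i,j,k)\in\pi,\ i-j\equiv a\bmod n}\xi_\pi(i,j,k),$$ the sum over all 3D partitions asymptotic to $(\lambda,\mu,\nu)$, as a formal Laurent series. **Notation.** Indices of $q_0,\dots,q_{n-1}$ are in $\mathbb Z_n$. The box $(i,j)$ has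 color $i-j\bmod n$, and $|\nu|_k$ is the number of boxes of color $k$ in $\nu$. The hook of $\nu$ at $(i,j)$ is the set of boxes of $\nu$ of the form $(i+a,j)$ or $(i,j+a)$ with $a\ge0$. $A_\lambda(k,n)=\sum_{(i,j)\in\lambda}\lfloor\frac{i+k}{n}\rfloor$ and $q^{-A_\lambda}=\prod_{k=0}^{n-1}q_k^{-A_\lambda(k,n)}$. Define $\mathfrak q_t$ for $t\in\mathbb Z$ by $\mathfrak q_0=1$ and $\mathfrak q_t=q_t\,\mathfrak q_{t-1}$ (so $\mathfrak q_1=q_1$, $\mathfrak q_2=q_1q_2$, $\mathfrak q_{-1}=q_0^{-1}$, $\mathfrak q_{-2}=q_0^{-1}q_{-1}^{-1}$, etc.), and $\mathfrak q_{\bullet-\nu}=\{\mathfrak q_{-\nu_0},\mathfrak q_{1-\nu_1},\mathfrak q_{2-\nu_2},\dots\}$. *)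

theory Defs
  imports "HOL-Analysis.Analysis" "HOL-Library.Poly_Mapping"
begin

text \<open>
  The exponent of a Laurent monomial is a finitely supported map from variable indices to
  integers.  A series involves only finitely many variables, and its exponents are bounded below:
  the type is the union over $n$ of the rings
  $\mathbb{Z}[[q_0,\dots,q_{n-1}]][q_0^{-1},\dots,q_{n-1}^{-1}]$.
\<close>

type_synonym expo = "nat \<Rightarrow>\<^sub>0 int"

definition bounded_expo :: "nat \<Rightarrow> int \<Rightarrow> expo \<Rightarrow> bool" where
  "bounded_expo n B e \<longleftrightarrow> Poly_Mapping.keys e \<subseteq> {..<n} \<and> (\<forall>i. B \<le> Poly_Mapping.lookup e i)"

definition laurent_supp :: "(expo \<Rightarrow> int) \<Rightarrow> bool" where
  "laurent_supp f \<longleftrightarrow> (\<exists>n B. \<forall>e. f e \<noteq> 0 \<longrightarrow> bounded_expo n B e)"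

typedef laurent = "{f :: expo \<Rightarrow> int. laurent_supp f}"
  morphisms lcoeff Abs_laurent
  by (rule exI[of _ "\<lambda>_. 0"]) (simp add: laurent_supp_def)

setup_lifting type_definition_laurent

lemma laurent_eqI: "(\<And>e. lcoeff f e = lcoeff g e) \<Longrightarrow> f = g"
  by (rule lcoeff_inject[THEN iffD1]) (rule ext)

lemma bounded_expo_mono:
  "bounded_expo n B e \<Longrightarrow> n \<le> n' \<Longrightarrow> B' \<le> B \<Longrightarrow> bounded_expo n' B' e"
  unfolding bounded_expo_def by (auto intro: order_trans)

lemma bounded_expo_add:
  assumes "bounded_expo n B a" "bounded_expo n C b"
  shows "bounded_expo n (B + C) (a + b)"
  using assms Poly_Mapping.keys_add[of a b] unfolding bounded_expo_def
  by (auto simp: lookup_add intro: add_mono)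

lemma laurent_supp2:
  assumes "laurent_supp f" "laurent_supp g"
  obtains n B where "\<And>e. f e \<noteq> 0 \<Longrightarrow> bounded_expo n B e" "\<And>e. g e \<noteq> 0 \<Longrightarrow> bounded_expo n B e"
proof -
  obtain n B where f: "\<And>e. f e \<noteq> 0 \<Longrightarrow> bounded_expo n B e"
    using assms(1) unfolding laurent_supp_def by blast
  obtain m C where g: "\<And>e. g e \<noteq> 0 \<Longrightarrow> bounded_expo m C e"
    using assms(2) unfolding laurent_supp_def by blast
  show thesis
    by (rule that[of "max n m" "min B C"]) (auto intro: bounded_expo_mono[OF f] bounded_expo_mono[OF g])
qed

lemma finite_expo_box:
  "finite {e :: expo. bounded_expo n B e \<and> (\<forall>i. Poly_Mapping.lookup e i \<le> U i)}" (is "finite ?A")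
proof -
  let ?M = "Max (U ` {..n})"
  have sub: "Poly_Mapping.lookup ` ?A \<subseteq> {f. \<forall>i. (i \<in> {..<n} \<longrightarrow> f i \<in> {B..?M}) \<and> (i \<notin> {..<n} \<longrightarrow> f i = 0)}"
  proof (clarsimp, intro conjI allI impI)
    fix e :: expo and i
    assume e: "bounded_expo n B e" "\<forall>i. Poly_Mapping.lookup e i \<le> U i"
    show "i < n \<Longrightarrow> B \<le> Poly_Mapping.lookup e i" using e by (simp add: bounded_expo_def)
    show "i < n \<Longrightarrow> Poly_Mapping.lookup e i \<le> ?M" using e
      by (intro order_trans[OF e(2)[rule_format] Max_ge]) auto
    show "\<not> i < n \<Longrightarrow> Poly_Mapping.lookup e i = 0" using e(1)
      by (metis bounded_expo_def in_keys_iff lessThan_iff subsetD)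
  qed
  have "finite (Poly_Mapping.lookup ` ?A)"
    by (rule finite_subset[OF sub]) (rule finite_set_of_finite_funs, auto)
  then show ?thesis
    by (rule finite_imageD) (auto intro: inj_onI)
qed

lemma finite_conv:
  assumes f: "\<And>e. f e \<noteq> 0 \<Longrightarrow> bounded_expo n B e" and g: "\<And>e. g e \<noteq> 0 \<Longrightarrow> bounded_expo m C e"
  shows "finite {a :: expo. f a * g (e - a) \<noteq> (0 :: int)}"
proof (rule finite_subset[OF _ finite_expo_box[of n B "\<lambda>i. Poly_Mapping.lookup e i - C"]], clarsimp)
  fix a assume "f a \<noteq> 0" "g (e - a) \<noteq> 0"
  then have 1: "bounded_expo n B a" and "bounded_expo m C (e - a)" using f g by auto
  then have "C \<le> Poly_Mapping.lookup e i - Poly_Mapping.lookup a i" for i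
    by (simp add: bounded_expo_def lookup_minus)
  then show "bounded_expo n B a \<and> (\<forall>i. Poly_Mapping.lookup a i \<le> Poly_Mapping.lookup e i - C)"
    using 1 by (auto simp: algebra_simps)
qed

lemma finite_coeff_conv: "finite {a. lcoeff f a * lcoeff g (e - a) \<noteq> 0}"
proof -
  have "laurent_supp (lcoeff f)" "laurent_supp (lcoeff g)" using lcoeff by auto
  then obtain n B where "\<And>e. lcoeff f e \<noteq> 0 \<Longrightarrow> bounded_expo n B e"
    "\<And>e. lcoeff g e \<noteq> 0 \<Longrightarrow> bounded_expo n B e" by (rule laurent_supp2) blast
  then show ?thesis by (rule finite_conv)
qed

instantiation laurent :: comm_ring_1
begin

lift_definition zero_laurent :: laurent is "\<lambda>_. 0"
  by (simp add: laurent_supp_def)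

lift_definition one_laurent :: laurent is "\<lambda>e. if e = 0 then 1 else 0"
  unfolding laurent_supp_def by (rule exI[of _ 0], rule exI[of _ 0]) (simp add: bounded_expo_def)

lift_definition plus_laurent :: "laurent \<Rightarrow> laurent \<Rightarrow> laurent" is "\<lambda>f g e. f e + g e"
  by (erule (1) laurent_supp2, unfold laurent_supp_def) (metis add.right_neutral)

lift_definition uminus_laurent :: "laurent \<Rightarrow> laurent" is "\<lambda>f e. - f e"
  by (simp add: laurent_supp_def)

lift_definition minus_laurent :: "laurent \<Rightarrow> laurent \<Rightarrow> laurent" is "\<lambda>f g e. f e - g e"
  by (erule (1) laurent_supp2, unfold laurent_supp_def) (metis diff_zero diff_0_right)

lift_definition times_laurent :: "laurent \<Rightarrow> laurent \<Rightarrow> laurent"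
  is "\<lambda>f g e. Sum_any (\<lambda>a. f a * g (e - a))"
proof -
  fix f g assume "laurent_supp f" "laurent_supp g"
  then obtain n B where f: "\<And>e. f e \<noteq> 0 \<Longrightarrow> bounded_expo n B e"
    and g: "\<And>e. g e \<noteq> 0 \<Longrightarrow> bounded_expo n B e" by (rule laurent_supp2) blast
  have "bounded_expo n (B + B) e" if ne: "Sum_any (\<lambda>a. f a * g (e - a)) \<noteq> 0" for e
  proof -
    obtain a where "f a * g (e - a) \<noteq> 0"
      using ne by (rule Sum_any.not_neutral_obtains_not_neutral)
    then have "bounded_expo n B a" "bounded_expo n B (e - a)" using f g by auto
    from bounded_expo_add[OF this] show ?thesis by simp
  qed
  then show "laurent_supp (\<lambda>e. Sum_any (\<lambda>a. f a * g (e - a)))"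
    unfolding laurent_supp_def by blast
qed

lemma coeff_times: "lcoeff (f * g) e = Sum_any (\<lambda>a. lcoeff f a * lcoeff g (e - a))"
  by transfer simp

instance
proof
  fix f g h :: laurent
  show "f * g * h = f * (g * h)"
  proof (rule laurent_eqI)
    fix e
    have sf: "laurent_supp (lcoeff f)" "laurent_supp (lcoeff g)" "laurent_supp (lcoeff h)"
      using lcoeff by auto
    obtain n1 B1 where 1: "\<And>e. lcoeff f e \<noteq> 0 \<Longrightarrow> bounded_expo n1 B1 e"
      "\<And>e. lcoeff g e \<noteq> 0 \<Longrightarrow> bounded_expo n1 B1 e"
      using sf(1,2) by (rule laurent_supp2) blast
    obtain n2 B2 where 2: "\<And>e. lcoeff h e \<noteq> 0 \<Longrightarrow> bounded_expo n2 B2 e"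
      using sf(3) unfolding laurent_supp_def by blast
    let ?F = "\<lambda>a b. lcoeff f b * lcoeff g (a - b) * lcoeff h (e - a)"
    let ?A = "{a. bounded_expo n1 (B1 + B1) a \<and> (\<forall>i. Poly_Mapping.lookup a i \<le> Poly_Mapping.lookup e i - B2)}"
    let ?B = "{b. bounded_expo n1 B1 b \<and> (\<forall>i. Poly_Mapping.lookup b i \<le> Poly_Mapping.lookup e i - B2 - B1)}"
    have box: "a \<in> ?A \<and> b \<in> ?B" if "?F a b \<noteq> 0" for a b
    proof -
      have b: "bounded_expo n1 B1 b" and ab: "bounded_expo n1 B1 (a - b)"
        and ea: "bounded_expo n2 B2 (e - a)" using that 1 2 by auto
      have a: "bounded_expo n1 (B1 + B1) a" using bounded_expo_add[OF b ab] by simp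
      have ai: "Poly_Mapping.lookup a i \<le> Poly_Mapping.lookup e i - B2" for i
      proof -
        have "B2 \<le> Poly_Mapping.lookup (e - a) i" using ea by (simp add: bounded_expo_def)
        then show ?thesis by (simp add: lookup_minus)
      qed
      have bi: "Poly_Mapping.lookup b i \<le> Poly_Mapping.lookup e i - B2 - B1" for i
      proof -
        have "B1 \<le> Poly_Mapping.lookup (a - b) i" using ab by (simp add: bounded_expo_def)
        then have "B1 \<le> Poly_Mapping.lookup a i - Poly_Mapping.lookup b i" by (simp add: lookup_minus)
        then show ?thesis using ai[of i] by linarith
      qed
      show ?thesis using a b ai bi by simp
    qed
    have "lcoeff (f * g * h) e = Sum_any (\<lambda>a. Sum_any (\<lambda>b. lcoeff f b * lcoeff g (a - b)) * lcoeff h (e - a))"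
      by (simp add: coeff_times)
    also have "\<dots> = Sum_any (\<lambda>a. Sum_any (?F a))"
      by (rule Sum_any.cong, rule Sum_any_left_distrib) (rule finite_coeff_conv)
    also have "\<dots> = Sum_any (\<lambda>b. Sum_any (\<lambda>a. ?F a b))"
    proof (rule Sum_any.swap)
      show "finite (?A \<times> ?B)" by (intro finite_cartesian_product finite_expo_box)
      show "{a. \<exists>b. ?F a b \<noteq> 0} \<times> {b. \<exists>a. ?F a b \<noteq> 0} \<subseteq> ?A \<times> ?B"
        using box by blast
    qed
    also have "\<dots> = Sum_any (\<lambda>b. Sum_any (\<lambda>c. lcoeff f b * (lcoeff g c * lcoeff h (e - b - c))))"
    proof (rule Sum_any.cong)
      fix b
      have "bij (\<lambda>c. b + c :: expo)"
        by (rule bij_betwI[where g = "\<lambda>c. c - b"]) auto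
      then show "Sum_any (\<lambda>a. ?F a b) = Sum_any (\<lambda>c. lcoeff f b * (lcoeff g c * lcoeff h (e - b - c)))"
        by (rule Sum_any.reindex_cong) (simp add: fun_eq_iff diff_diff_eq)
    qed
    also have "\<dots> = lcoeff (f * (g * h)) e"
      unfolding coeff_times
      by (rule Sum_any.cong, rule Sum_any_right_distrib[symmetric]) (rule finite_coeff_conv)
    finally show "lcoeff (f * g * h) e = lcoeff (f * (g * h)) e" .
  qed
  show "f * g = g * f"
  proof (rule laurent_eqI)
    fix e
    have "bij (\<lambda>c. e - c :: expo)"
      by (rule bij_betwI[where g = "\<lambda>c. e - c"]) auto
    then show "lcoeff (f * g) e = lcoeff (g * f) e"
      unfolding coeff_times by (rule Sum_any.reindex_cong) (simp add: fun_eq_iff)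
  qed
  show "1 * f = f"
  proof (rule laurent_eqI)
    fix e
    have "lcoeff (1 * f) e = Sum_any (\<lambda>a. if a = 0 then lcoeff f (e - a) else 0)"
      unfolding coeff_times by (rule Sum_any.cong) (simp add: one_laurent.rep_eq)
    then show "lcoeff (1 * f) e = lcoeff f e" by (simp only: Sum_any.delta diff_zero)
  qed
  show "(f + g) * h = f * h + g * h"
  proof (rule laurent_eqI)
    fix e
    show "lcoeff ((f + g) * h) e = lcoeff (f * h + g * h) e"
      by (simp add: coeff_times plus_laurent.rep_eq distrib_right
          Sum_any.distrib[OF finite_coeff_conv finite_coeff_conv])
  qed
  have "lcoeff 0 0 \<noteq> lcoeff 1 0" by (simp add: zero_laurent.rep_eq one_laurent.rep_eq)
  then show "(0 :: laurent) \<noteq> 1" by metis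
qed (transfer; simp add: algebra_simps)+

end

text \<open>Not every nonzero series is a unit; non-units have \<open>inverse\<close> 0.\<close>

instantiation laurent :: inverse
begin

definition inverse_laurent :: "laurent \<Rightarrow> laurent" where
  "inverse (f :: laurent) = (if f dvd 1 then THE g. f * g = 1 else 0)"

definition divide_laurent :: "laurent \<Rightarrow> laurent \<Rightarrow> laurent" where
  "divide (f :: laurent) g = f * inverse g"

instance ..

end

lemma laurent_inverse_unique:
  fixes f g :: laurent
  assumes "f * g = 1"
  shows "inverse f = g"
proof -
  have "h = g" if "f * h = 1" for h
    using that assms by (metis mult.commute mult.left_commute mult.right_neutral)
  then have "(THE h. f * h = 1) = g" using assms by blast
  moreover have "f dvd 1" using assms by (metis dvdI)
  ultimately show ?thesis by (simp add: inverse_laurent_def)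
qed

text \<open>Infinite sums and products are taken in the topology of coefficientwise convergence.\<close>

instantiation laurent :: topological_space
begin

definition open_laurent :: "laurent set \<Rightarrow> bool" where
  "open S \<longleftrightarrow> (\<exists>T. open T \<and> S = lcoeff -` T)"

instance
proof
  show "open (UNIV :: laurent set)" unfolding open_laurent_def by (rule exI[of _ UNIV]) simp
next
  fix S T :: "laurent set" assume "open S" "open T"
  then show "open (S \<inter> T)" unfolding open_laurent_def by (metis open_Int vimage_Int)
next
  fix K :: "laurent set set" assume "\<forall>S\<in>K. open S"
  then obtain t where "\<And>S. S \<in> K \<Longrightarrow> open (t S) \<and> S = lcoeff -` t S"
    unfolding open_laurent_def by metis
  then have "open (\<Union>S\<in>K. t S)" "\<Union>K = lcoeff -` (\<Union>S\<in>K. t S)" by auto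
  then show "open (\<Union>K)" unfolding open_laurent_def by blast
qed

end

instance laurent :: t2_space
proof
  fix f g :: laurent assume "f \<noteq> g"
  then obtain e where e: "lcoeff f e \<noteq> lcoeff g e" using laurent_eqI by blast
  have op: "open {h. lcoeff h e = c}" for c
  proof -
    have "open ((\<lambda>F :: expo \<Rightarrow> int. F e) -` {c})"
      by (intro open_vimage continuous_on_product_coordinates open_discrete)
    then show ?thesis unfolding open_laurent_def by (auto simp: vimage_def)
  qed
  show "\<exists>U V. open U \<and> open V \<and> f \<in> U \<and> g \<in> V \<and> U \<inter> V = {}"
  proof (intro exI conjI)
    show "{h. lcoeff h e = lcoeff f e} \<inter> {h. lcoeff h e = lcoeff g e} = {}"
      using e by force
  qed (rule op, rule op, simp_all)
qed

lemma tendsto_laurent_iff: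
  "(f \<longlongrightarrow> l) F \<longleftrightarrow> (\<forall>e. \<forall>\<^sub>F x in F. lcoeff (f x) e = lcoeff l e)"
proof -
  have "(f \<longlongrightarrow> l) F \<longleftrightarrow> ((\<lambda>x. lcoeff (f x)) \<longlongrightarrow> lcoeff l) F"
  proof
    assume l: "(f \<longlongrightarrow> l) F"
    show "((\<lambda>x. lcoeff (f x)) \<longlongrightarrow> lcoeff l) F"
    proof (rule topological_tendstoI)
      fix T :: "(expo \<Rightarrow> int) set" assume "open T" "lcoeff l \<in> T"
      then have "open (lcoeff -` T)" "l \<in> lcoeff -` T" by (auto simp: open_laurent_def)
      from topological_tendstoD[OF l this] show "\<forall>\<^sub>F x in F. lcoeff (f x) \<in> T" by simp
    qed
  next
    assume l: "((\<lambda>x. lcoeff (f x)) \<longlongrightarrow> lcoeff l) F"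
    show "(f \<longlongrightarrow> l) F"
    proof (rule topological_tendstoI)
      fix S :: "laurent set" assume "open S" "l \<in> S"
      then obtain T where T: "open T" "S = lcoeff -` T" "lcoeff l \<in> T"
        by (auto simp: open_laurent_def)
      from topological_tendstoD[OF l T(1,3)] show "\<forall>\<^sub>F x in F. f x \<in> S" by (simp add: T(2))
    qed
  qed
  also have "\<dots> \<longleftrightarrow> (\<forall>e. ((\<lambda>x. lcoeff (f x) e) \<longlongrightarrow> lcoeff l e) F)"
    using limitin_componentwise[of "\<lambda>_. euclidean" UNIV "\<lambda>x. lcoeff (f x)" "lcoeff l" F]
    by (simp add: euclidean_product_topology)
  also have "\<dots> \<longleftrightarrow> (\<forall>e. \<forall>\<^sub>F x in F. lcoeff (f x) e = lcoeff l e)"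
    by (simp add: tendsto_discrete)
  finally show ?thesis .
qed

lift_definition qvar :: "nat \<Rightarrow> laurent"
  is "\<lambda>i e. if e = Poly_Mapping.single i 1 then 1 else 0"
proof -
  fix i :: nat
  have "0 \<le> Poly_Mapping.lookup (Poly_Mapping.single i (1 :: int)) j" for j
    by (simp add: Poly_Mapping.lookup_single when_def)
  then have "bounded_expo (Suc i) 0 (Poly_Mapping.single i 1)"
    by (simp add: bounded_expo_def)
  then show "laurent_supp (\<lambda>e. if e = Poly_Mapping.single i 1 then 1 else 0)"
    unfolding laurent_supp_def by (intro exI[of _ "Suc i"] exI[of _ 0]) simp
qed

text \<open>
  Expressions in the variables are written as functions of \<open>x :: int \<Rightarrow> laurent\<close>, where \<open>x k\<close>
  is the value of the variable with index \<open>k\<close>.  The variables themselves are \<open>qv n\<close>,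
  with indices read modulo \<open>n\<close>.
\<close>

definition qv :: "nat \<Rightarrow> int \<Rightarrow> laurent" where
  "qv n k = qvar (nat (k mod int n))"

text \<open>The exchange of \<open>q_k\<close> and \<open>q_{-k}\<close>: an overlined expression is evaluated at \<open>bar x\<close>.\<close>

definition bar :: "(int \<Rightarrow> laurent) \<Rightarrow> int \<Rightarrow> laurent" where
  "bar x k = x (- k)"

type_synonym diagram = "(nat \<times> nat) set"

definition is_partition :: "diagram \<Rightarrow> bool" where
  "is_partition \<alpha> \<longleftrightarrow> finite \<alpha> \<and>
     (\<forall>i j i' j'. (i, j) \<in> \<alpha> \<longrightarrow> i' \<le> i \<longrightarrow> j' \<le> j \<longrightarrow> (i', j') \<in> \<alpha>)"

definition part :: "diagram \<Rightarrow> nat \<Rightarrow> nat" where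
  "part \<alpha> j = (LEAST i. (i, j) \<notin> \<alpha>)"

definition conjugate :: "diagram \<Rightarrow> diagram" where
  "conjugate \<alpha> = {(i, j). (j, i) \<in> \<alpha>}"

definition has_color :: "nat \<Rightarrow> int \<Rightarrow> nat \<times> nat \<Rightarrow> bool" where
  "has_color n k = (\<lambda>(i, j). (int i - int j) mod int n = k mod int n)"

definition color_count :: "nat \<Rightarrow> diagram \<Rightarrow> int \<Rightarrow> nat" where
  "color_count n \<nu> k = card {b \<in> \<nu>. has_color n k b}"

definition hook :: "diagram \<Rightarrow> nat \<times> nat \<Rightarrow> diagram" where
  "hook \<nu> = (\<lambda>(i, j). {b \<in> \<nu>. \<exists>a. b = (i + a, j) \<or> b = (i, j + a)})"

definition asymptotic_3d :: "diagram \<Rightarrow> diagram \<Rightarrow> diagram \<Rightarrow> (nat \<times> nat \<times> nat) set \<Rightarrow> bool" where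
  "asymptotic_3d lam \<mu> \<nu> \<pi> \<longleftrightarrow>
     (\<forall>i j k. (i + 1, j, k) \<in> \<pi> \<or> (i, j + 1, k) \<in> \<pi> \<or> (i, j, k + 1) \<in> \<pi> \<longrightarrow> (i, j, k) \<in> \<pi>) \<and>
     (\<forall>j k. (j, k) \<in> lam \<longleftrightarrow> (\<forall>\<^sub>F i in sequentially. (i, j, k) \<in> \<pi>)) \<and>
     (\<forall>k i. (k, i) \<in> \<mu> \<longleftrightarrow> (\<forall>\<^sub>F j in sequentially. (i, j, k) \<in> \<pi>)) \<and>
     (\<forall>i j. (i, j) \<in> \<nu> \<longleftrightarrow> (\<forall>\<^sub>F k in sequentially. (i, j, k) \<in> \<pi>))"

definition xi :: "diagram \<Rightarrow> diagram \<Rightarrow> diagram \<Rightarrow> nat \<times> nat \<times> nat \<Rightarrow> int" where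
  "xi lam \<mu> \<nu> = (\<lambda>(i, j, k).
     1 - (of_bool ((j, k) \<in> lam) + of_bool ((k, i) \<in> \<mu>) + of_bool ((i, j) \<in> \<nu>)))"

text \<open>
  Only finitely many boxes of an asymptotic 3D partition have \<open>xi \<noteq> 0\<close>; the sum is restricted to
  these because \<^const>\<open>sum\<close> is 0 over an infinite set.
\<close>

definition weight :: "nat \<Rightarrow> diagram \<Rightarrow> diagram \<Rightarrow> diagram \<Rightarrow> (nat \<times> nat \<times> nat) set \<Rightarrow> int \<Rightarrow> int" where
  "weight n lam \<mu> \<nu> \<pi> a =
     (\<Sum>(i, j, k) | (i, j, k) \<in> \<pi> \<and> has_color n a (i, j) \<and> xi lam \<mu> \<nu> (i, j, k) \<noteq> 0.
        xi lam \<mu> \<nu> (i, j, k))"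

definition vertex :: "nat \<Rightarrow> diagram \<Rightarrow> diagram \<Rightarrow> diagram \<Rightarrow> (int \<Rightarrow> laurent) \<Rightarrow> laurent" where
  "vertex n lam \<mu> \<nu> x =
     (\<Sum>\<^sub>\<infinity>\<pi> | asymptotic_3d lam \<mu> \<nu> \<pi>. \<Prod>a = 0..<int n. x a powi weight n lam \<mu> \<nu> \<pi> a)"

text \<open>
  The part \<open>part \<alpha> j\<close> is the number of boxes \<open>(i, j)\<close>, so \<open>j\<close> is the row index of a box
  and \<open>i\<close> its column index.
\<close>

definition semistandard :: "diagram \<Rightarrow> (nat \<times> nat \<Rightarrow> nat) \<Rightarrow> bool" where
  "semistandard D T \<longleftrightarrow> T \<in> extensional D \<and>
     (\<forall>i i' j. (i, j) \<in> D \<longrightarrow> (i', j) \<in> D \<longrightarrow> i < i' \<longrightarrow> T (i, j) \<le> T (i', j)) \<and>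
     (\<forall>i j j'. (i, j) \<in> D \<longrightarrow> (i, j') \<in> D \<longrightarrow> j < j' \<longrightarrow> T (i, j) < T (i, j'))"

definition skew_schur :: "diagram \<Rightarrow> diagram \<Rightarrow> (nat \<Rightarrow> laurent) \<Rightarrow> laurent" where
  "skew_schur \<alpha> \<beta> y =
     (if \<beta> \<subseteq> \<alpha> then \<Sum>\<^sub>\<infinity>T | semistandard (\<alpha> - \<beta>) T. \<Prod>b\<in>\<alpha> - \<beta>. y (T b) else 0)"

definition A_stat :: "diagram \<Rightarrow> nat \<Rightarrow> nat \<Rightarrow> nat" where
  "A_stat \<alpha> k n = (\<Sum>(i, j)\<in>\<alpha>. (i + k) div n)"

definition q_A :: "nat \<Rightarrow> diagram \<Rightarrow> (int \<Rightarrow> laurent) \<Rightarrow> laurent" where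
  "q_A n \<alpha> x = (\<Prod>k<n. x (int k) powi (- int (A_stat \<alpha> k n)))"

definition qfrak :: "(int \<Rightarrow> laurent) \<Rightarrow> int \<Rightarrow> laurent" where
  "qfrak x t = (if t \<ge> 0 then \<Prod>s = 1..t. x s else \<Prod>s = t + 1..0. inverse (x s))"

definition qfrak_seq :: "(int \<Rightarrow> laurent) \<Rightarrow> diagram \<Rightarrow> nat \<Rightarrow> laurent" where
  "qfrak_seq x \<nu> j = qfrak x (int j - int (part \<nu> j))"

definition H_factor :: "nat \<Rightarrow> diagram \<Rightarrow> (int \<Rightarrow> laurent) \<Rightarrow> laurent" where
  "H_factor n \<nu> x =
     (\<Prod>b\<in>\<nu>. 1 / (1 - (\<Prod>s = 1..int n. x s ^ color_count n (hook \<nu> b) s)))"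

definition O_factor :: "nat \<Rightarrow> diagram \<Rightarrow> (int \<Rightarrow> laurent) \<Rightarrow> laurent" where
  "O_factor n \<nu> x =
     (\<Prod>k = 0..<int n. vertex n {} {} {} (\<lambda>a. x (k + a)) powi
        (- 2 * int (color_count n \<nu> k) + int (color_count n \<nu> (k + 1)) + int (color_count n \<nu> (k - 1))))"

definition MacMahon :: "laurent \<Rightarrow> laurent \<Rightarrow> laurent" where
  "MacMahon v q = prodinf (\<lambda>m. 1 / (1 - v * q ^ Suc m) ^ Suc m)"

end

theory Submission
  imports Defs
begin

text \<open>
  Slice a three-dimensional partition along the diagonals \<open>i - j = t\<close> of the complement of \<open>\<nu>\<close>.
  Consecutive slices interlace, the direction of the interlacing being read off the boundary of
  \<open>\<nu>\<close>, and the slices tend to \<open>\<mu>\<close> and to the conjugate of \<open>\<lambda>\<close> at the two ends. By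
  summation by parts the weight of the partition becomes a product over the boundary edges, an edge
  \<open>t\<close> contributing a power of \<open>\<qq>_t\<close>. An adjacent up step and down step can be exchanged at the cost
  of a geometric series, by an explicit bijection. Moving all down steps to the front leaves paths
  that descend from \<open>\<mu>\<close> to some \<open>\<eta>\<close> and then ascend to the conjugate of \<open>\<lambda>\<close>, which are pairs of
  semistandard tableaux, and a product of \<open>1 / (1 - \<qq>_t / \<qq>_s)\<close> over the pairs of an up edge \<open>s\<close>
  before a down edge \<open>t\<close>. All this is done in finite windows of diagonals, where every sum is
  controlled by a bijection, and the window is then enlarged. Factor by factor the product over pairs is the
  one for the empty partition times the hook product and \<open>O_\<nu>\<close>.
\<close>

section \<open>Laurent monomials\<close>

text \<open>Four points shape the development. Coefficientwise limits of Laurent series do not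
  respect products, so all limits carry a lower bound on the exponents that is uniform in the
  window, and infinite products are graded by total degree, which is t - s for the factor of a pair
  (s, t). Unsorted path sums are infinite, and their summability is not known in advance; the
  bijections that sort a word carry it back from the sorted word, which has finitely many paths. The
  ascending half is read backwards as a descent, with reversed and negated labels, and a descent
  peels off the largest tableau entry first; the symmetry of skew Schur functions makes up for the
  order. Negated labels and overlined variables differ by one copy of q_0, whence the power of q_0
  in the sum over \<eta>. In the comparison with the empty partition, the first differences of the
  diagonal counts of \<nu> compare its edges with those of the empty partition, so the second
  differences in O_\<nu> telescope. What remains are the pairs of a down edge before an up edge, and
  these are the hooks.\<close>

definition mono_of :: "expo \<Rightarrow> laurent" where
  "mono_of a = Abs_laurent (\<lambda>e. of_bool (e = a))"

lemma lcoeff_mono_of: "lcoeff (mono_of a) e = of_bool (e = a)"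
proof -
  let ?n = "Suc (Max (insert 0 (Poly_Mapping.keys a)))"
  let ?B = "Min (insert 0 (Poly_Mapping.lookup a ` Poly_Mapping.keys a))"
  have "bounded_expo ?n ?B a"
    unfolding bounded_expo_def
  proof (intro conjI allI)
    show "Poly_Mapping.keys a \<subseteq> {..<?n}" by (auto simp: less_Suc_eq_le)
    show "?B \<le> Poly_Mapping.lookup a i" for i
      by (cases "i \<in> Poly_Mapping.keys a") (auto simp: in_keys_iff intro: Min_le)
  qed
  then have "laurent_supp (\<lambda>e. of_bool (e = a))"
    unfolding laurent_supp_def by (intro exI[of _ ?n] exI[of _ ?B]) simp
  then show ?thesis unfolding mono_of_def by (simp add: Abs_laurent_inverse)
qed

lemma lcoeff_0 [simp]: "lcoeff 0 e = 0"
  by transfer simp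

lemma lcoeff_1: "lcoeff 1 e = of_bool (e = 0)"
  by transfer simp

lemma lcoeff_add: "lcoeff (f + g) e = lcoeff f e + lcoeff g e"
  by transfer simp

lemma lcoeff_diff: "lcoeff (f - g) e = lcoeff f e - lcoeff g e"
  by transfer simp

lemma lcoeff_uminus: "lcoeff (- f) e = - lcoeff f e"
  by transfer simp

lemma lcoeff_sum: "lcoeff (sum f A) e = (\<Sum>a\<in>A. lcoeff (f a) e)"
  by (induction A rule: infinite_finite_induct) (auto simp: lcoeff_add)

lemma lcoeff_mono_of_mult: "lcoeff (mono_of a * f) e = lcoeff f (e - a)"
proof -
  have "lcoeff (mono_of a * f) e = Sum_any (\<lambda>x. if x = a then lcoeff f (e - x) else 0)"
    unfolding coeff_times by (rule Sum_any.cong) (simp add: lcoeff_mono_of)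
  then show ?thesis by (simp only: Sum_any.delta)
qed

lemma mono_of_0 [simp]: "mono_of 0 = 1"
  by (rule laurent_eqI) (simp add: lcoeff_mono_of lcoeff_1)

lemma mono_of_add: "mono_of (a + b) = mono_of a * mono_of b"
  by (rule laurent_eqI) (auto simp: lcoeff_mono_of_mult lcoeff_mono_of)

lemma mono_of_sum: "mono_of (sum f A) = (\<Prod>a\<in>A. mono_of (f a))"
  by (induction A rule: infinite_finite_induct) (auto simp: mono_of_add)

lemma inverse_mono_of: "inverse (mono_of a) = mono_of (- a)"
  by (rule laurent_inverse_unique) (simp flip: mono_of_add)

lemma mono_of_power: "mono_of a ^ k = mono_of (of_nat k * a)"
  by (induction k) (auto simp: mono_of_add algebra_simps)

lemma mono_of_powi: "mono_of a powi k = mono_of (of_int k * a)"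
  by (cases "k \<ge> 0") (simp_all add: power_int_def inverse_mono_of mono_of_power)

lemma qvar_eq_mono_of: "qvar i = mono_of (Poly_Mapping.single i 1)"
  by (rule laurent_eqI) (simp add: lcoeff_mono_of qvar.rep_eq)

text \<open>A series need not be a unit, so an integer exponent can be split only with an inverse at
  hand. The exponents of \<open>O_factor\<close>, differences of natural numbers, are expanded this
  way.\<close>

lemma laurent_power_mult_inverse:
  fixes f g :: laurent
  assumes fg: "f * g = 1"
  shows "f powi (int a - int b) = f ^ a * g ^ b"
proof -
  have one: "f ^ k * g ^ k = 1" for k using fg by (metis power_mult_distrib power_one)
  show ?thesis
  proof (cases "a \<ge> b")
    case True
    then have "f ^ a * g ^ b = f ^ (a - b) * (f ^ b * g ^ b)" by (metis le_add_diff_inverse2 mult.assoc power_add)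
    then show ?thesis using True one by (simp add: power_int_def nat_diff_distrib)
  next
    case False
    then have "f ^ a * g ^ b = (f ^ a * g ^ a) * g ^ (b - a)"
      by (metis le_add_diff_inverse mult.assoc nat_le_linear power_add)
    moreover have "inverse f = g" using fg by (rule laurent_inverse_unique)
    moreover have "nat (int b - int a) = b - a" by simp
    ultimately show ?thesis using False one by (simp add: power_int_def)
  qed
qed

section \<open>Degree and support bounds\<close>

text \<open>Total degree is additive, and positive on nonzero exponents without negative entries.
  This makes it the grading for the geometric series and the infinite products below.\<close>

definition deg :: "expo \<Rightarrow> int" where
  "deg e = Sum_any (Poly_Mapping.lookup e)"

lemma deg_0 [simp]: "deg 0 = 0"
  by (simp add: deg_def)

lemma deg_add: "deg (a + b) = deg a + deg b"
  by (simp add: deg_def lookup_add Sum_any.distrib)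

lemma deg_uminus: "deg (- a) = - deg a"
  using deg_add[of a "- a"] by simp

lemma deg_diff: "deg (a - b) = deg a - deg b"
  using deg_add[of a "- b"] by (simp add: deg_uminus)

lemma deg_sum: "deg (sum f A) = (\<Sum>a\<in>A. deg (f a))"
  by (induction A rule: infinite_finite_induct) (auto simp: deg_add)

lemma deg_of_nat_mult: "deg (of_nat k * e) = int k * deg e"
  by (induction k) (auto simp: deg_add algebra_simps)

lemma deg_single [simp]: "deg (Poly_Mapping.single i v) = v"
  by (simp add: deg_def lookup_single when_def)

lemma lookup_of_int_mult:
  "Poly_Mapping.lookup (of_int c * e) i = c * Poly_Mapping.lookup (e :: expo) i"
proof -
  have nat: "Poly_Mapping.lookup (of_nat k * e) i = int k * Poly_Mapping.lookup e i" for k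
    by (induction k) (auto simp: lookup_add algebra_simps)
  show ?thesis
    by (cases c rule: int_cases2) (use nat in \<open>auto simp: lookup_uminus\<close>)
qed

lemma deg_bounded:
  assumes "bounded_expo n 0 e"
  shows "deg e = (\<Sum>i<n. Poly_Mapping.lookup e i)"
  unfolding deg_def
  by (rule Sum_any.expand_superset) (use assms in \<open>auto simp: bounded_expo_def in_keys_iff\<close>)

lemma deg_nonneg: "bounded_expo n 0 e \<Longrightarrow> deg e \<ge> 0"
  using deg_bounded[of n e] by (auto simp: bounded_expo_def intro: sum_nonneg)

lemma deg_pos: 
  assumes "bounded_expo n 0 e" "e \<noteq> 0"
  shows "deg e > 0"
proof -
  obtain i where "Poly_Mapping.lookup e i \<noteq> 0" using assms(2) by (metis poly_mapping_eqI lookup_zero)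
  then have "i < n" "Poly_Mapping.lookup e i > 0"
    using assms(1) by (force simp: bounded_expo_def in_keys_iff order.order_iff_strict)+
  then show ?thesis
    unfolding deg_bounded[OF assms(1)] using assms(1)
    by (intro sum_pos2[of _ i]) (auto simp: bounded_expo_def)
qed

definition bnd :: "nat \<Rightarrow> int \<Rightarrow> laurent \<Rightarrow> bool" where
  "bnd n B f \<longleftrightarrow> (\<forall>e. lcoeff f e \<noteq> 0 \<longrightarrow> bounded_expo n B e)"

lemma bnd_mono: "bnd n B f \<Longrightarrow> C \<le> B \<Longrightarrow> bnd n C f"
  unfolding bnd_def by (meson bounded_expo_mono order_refl)

lemma bnd_mono_of: "bnd n B (mono_of a) \<longleftrightarrow> bounded_expo n B a"
  by (auto simp: bnd_def lcoeff_mono_of)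

lemma bounded_expo_0 [simp]: "bounded_expo n B 0 \<longleftrightarrow> B \<le> 0"
  by (auto simp: bounded_expo_def)

lemma bnd_0 [simp]: "bnd n B 0"
  by (simp add: bnd_def)

lemma bnd_1: "bnd n 0 1"
  by (simp add: bnd_def lcoeff_1)

lemma bnd_add: "bnd n B f \<Longrightarrow> bnd n B g \<Longrightarrow> bnd n B (f + g)"
  unfolding bnd_def lcoeff_add by (metis add.right_neutral)

lemma bnd_diff: "bnd n B f \<Longrightarrow> bnd n B g \<Longrightarrow> bnd n B (f - g)"
  unfolding bnd_def lcoeff_diff by (metis diff_zero)

lemma times_supp:
  assumes "lcoeff (f * g) e \<noteq> 0"
  obtains a where "lcoeff f a \<noteq> 0" "lcoeff g (e - a) \<noteq> 0"
proof -
  obtain a where "lcoeff f a * lcoeff g (e - a) \<noteq> 0"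
    using assms unfolding coeff_times by (rule Sum_any.not_neutral_obtains_not_neutral)
  then show thesis using that by auto
qed

lemma bnd_mult: 
  assumes "bnd n B f" "bnd n C g"
  shows "bnd n (B + C) (f * g)"
  unfolding bnd_def
proof (intro allI impI)
  fix e assume "lcoeff (f * g) e \<noteq> 0"
  then obtain a where "lcoeff f a \<noteq> 0" "lcoeff g (e - a) \<noteq> 0" by (rule times_supp)
  then show "bounded_expo n (B + C) e"
    using bounded_expo_add[of n B a C "e - a"] assms by (simp add: bnd_def)
qed

lemma bnd_mult_0: "bnd n 0 f \<Longrightarrow> bnd n 0 g \<Longrightarrow> bnd n 0 (f * g)"
  using bnd_mult[of n 0 f 0 g] by simp

lemma bnd_prod: "(\<And>a. a \<in> A \<Longrightarrow> bnd n 0 (f a)) \<Longrightarrow> bnd n 0 (prod f A)"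
  by (induction A rule: infinite_finite_induct) (auto intro: bnd_mult_0 bnd_1)

section \<open>Coefficientwise convergence with a uniform support bound\<close>

text \<open>The common bound B makes the notion multiplicative. Without it, \<open>q^N\<close> and
  \<open>q^(-N)\<close> would both tend to 0 while their product is 1.\<close>

definition bconv :: "nat \<Rightarrow> (nat \<Rightarrow> laurent) \<Rightarrow> laurent \<Rightarrow> bool" where
  "bconv n f l \<longleftrightarrow> (\<exists>B. \<forall>N. bnd n B (f N)) \<and>
     (\<forall>e. \<forall>\<^sub>F N in sequentially. lcoeff (f N) e = lcoeff l e)"

lemma bconvD: "bconv n f l \<Longrightarrow> \<forall>\<^sub>F N in sequentially. lcoeff (f N) e = lcoeff l e"
  by (simp add: bconv_def)

lemma bconv_tendsto: "bconv n f l \<Longrightarrow> f \<longlonglongrightarrow> l"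
  by (simp add: bconv_def tendsto_laurent_iff)

lemma bconv_unique: "bconv n f l \<Longrightarrow> bconv m f l' \<Longrightarrow> l = l'"
  by (metis bconv_tendsto LIMSEQ_unique)

lemma bconv_bnd_limit:
  assumes "bconv n f l" "\<And>N. bnd n B (f N)"
  shows "bnd n B l"
  unfolding bnd_def
proof (intro allI impI)
  fix e assume e: "lcoeff l e \<noteq> 0"
  obtain N where "lcoeff (f N) e = lcoeff l e"
    using bconvD[OF assms(1), of e] by (auto simp: eventually_sequentially)
  then show "bounded_expo n B e" using e assms(2)[of N] by (simp add: bnd_def)
qed

lemma bconv_const: "bnd n B f \<Longrightarrow> bconv n (\<lambda>_. f) f"
  by (auto simp: bconv_def)

lemma bconv_add: 
  assumes "bconv n f l" "bconv n g m"
  shows "bconv n (\<lambda>N. f N + g N) (l + m)"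
  unfolding bconv_def
proof (intro conjI allI)
  obtain B C where "\<And>N. bnd n B (f N)" "\<And>N. bnd n C (g N)" using assms by (auto simp: bconv_def)
  then have "bnd n (min B C) (f N + g N)" for N
    by (meson bnd_add bnd_mono min.cobounded1 min.cobounded2)
  then show "\<exists>B. \<forall>N. bnd n B (f N + g N)" by blast
  show "\<forall>\<^sub>F N in sequentially. lcoeff (f N + g N) e = lcoeff (l + m) e" for e
    using bconvD[OF assms(1), of e] bconvD[OF assms(2), of e]
    by eventually_elim (simp add: lcoeff_add)
qed

lemma bconv_mult: 
  assumes "bconv n f l" "bconv n g m"
  shows "bconv n (\<lambda>N. f N * g N) (l * m)"
  unfolding bconv_def
proof (intro conjI allI)
  obtain B C where B: "\<And>N. bnd n B (f N)" and C: "\<And>N. bnd n C (g N)"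
    using assms by (auto simp: bconv_def)
  then show "\<exists>B. \<forall>N. bnd n B (f N * g N)" by (blast intro: bnd_mult)
  have l: "bnd n B l" and m: "bnd n C m"
    using bconv_bnd_limit assms B C by blast+
  fix e
  \<comment> \<open>The bounds B and C confine the contributing exponents to one finite box, the
    same for all N and for the limit.\<close>
  define S where "S = {a. bounded_expo n B a \<and> (\<forall>i. Poly_Mapping.lookup a i \<le> Poly_Mapping.lookup e i - C)}"
  have fin: "finite S" unfolding S_def by (rule finite_expo_box)
  have eq: "lcoeff (u * v) e = (\<Sum>a\<in>S. lcoeff u a * lcoeff v (e - a))"
    if u: "bnd n B u" and v: "bnd n C v" for u v
    unfolding coeff_times
  proof (rule Sum_any.expand_superset[OF fin], clarsimp)
    fix a assume "lcoeff u a \<noteq> 0" "lcoeff v (e - a) \<noteq> 0"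
    then have 1: "bounded_expo n B a" and "bounded_expo n C (e - a)" using u v by (auto simp: bnd_def)
    then have "C \<le> Poly_Mapping.lookup e i - Poly_Mapping.lookup a i" for i
      by (simp add: bounded_expo_def lookup_minus)
    then show "a \<in> S"
      using 1 by (auto simp: S_def algebra_simps)
  qed
  have "\<forall>\<^sub>F N in sequentially. \<forall>a\<in>S. lcoeff (f N) a = lcoeff l a \<and> lcoeff (g N) (e - a) = lcoeff m (e - a)"
    by (intro eventually_ball_finite fin ballI eventually_conj bconvD[OF assms(1)] bconvD[OF assms(2)])
  then show "\<forall>\<^sub>F N in sequentially. lcoeff (f N * g N) e = lcoeff (l * m) e"
    by eventually_elim (simp add: eq B C l m)
qed

lemma bconv_1: "bconv n (\<lambda>_. 1) 1"
  by (rule bconv_const[OF bnd_1])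

lemma bconv_power: "bconv n f l \<Longrightarrow> bconv n (\<lambda>N. f N ^ k) (l ^ k)"
  by (induction k) (auto intro: bconv_mult bconv_1)

lemma bconv_prod: "(\<And>i. i \<in> I \<Longrightarrow> bconv n (f i) (l i)) \<Longrightarrow> bconv n (\<lambda>N. \<Prod>i\<in>I. f i N) (\<Prod>i\<in>I. l i)"
  by (induction I rule: infinite_finite_induct) (auto intro: bconv_mult bconv_1)

lemma bconv_sum: "(\<And>i. i \<in> I \<Longrightarrow> bconv n (f i) (l i)) \<Longrightarrow> bconv n (\<lambda>N. \<Sum>i\<in>I. f i N) (\<Sum>i\<in>I. l i)"
  by (induction I rule: infinite_finite_induct) (auto intro: bconv_add bconv_const bnd_0)

lemma bconv_subseq:
  assumes "bconv n f l" "filterlim r sequentially sequentially"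
  shows "bconv n (\<lambda>N. f (r N)) l"
  unfolding bconv_def
proof (intro conjI allI)
  show "\<exists>B. \<forall>N. bnd n B (f (r N))" using assms(1) by (auto simp: bconv_def)
  show "\<forall>\<^sub>F N in sequentially. lcoeff (f (r N)) e = lcoeff l e" for e
    using bconvD[OF assms(1), of e] assms(2) by (rule eventually_compose_filterlim)
qed

section \<open>Generating functions of weighted sets\<close>

definition admissible :: "nat \<Rightarrow> 'a set \<Rightarrow> ('a \<Rightarrow> expo) \<Rightarrow> bool" where
  "admissible n A w \<longleftrightarrow> (\<exists>B. \<forall>a\<in>A. bounded_expo n B (w a)) \<and> (\<forall>e. finite {a\<in>A. w a = e})"

definition gf :: "'a set \<Rightarrow> ('a \<Rightarrow> expo) \<Rightarrow> laurent" where
  "gf A w = (\<Sum>\<^sub>\<infinity>a\<in>A. mono_of (w a))"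

text \<open>A finite partial sum has its final coefficient at e as soon as it contains the fibre
  over e, which is finite.\<close>

lemma lcoeff_gf:
  assumes "admissible n A w"
  shows "lcoeff (gf A w) e = int (card {a\<in>A. w a = e})"
proof -
  obtain B where B: "\<And>a. a \<in> A \<Longrightarrow> bounded_expo n B (w a)"
    and fin: "\<And>e. finite {a\<in>A. w a = e}" using assms by (auto simp: admissible_def)
  define l where "l = Abs_laurent (\<lambda>e. int (card {a\<in>A. w a = e}))"
  have "laurent_supp (\<lambda>e. int (card {a\<in>A. w a = e}))"
    unfolding laurent_supp_def
  proof (intro exI[of _ n] exI[of _ B] allI impI)
    fix e assume "int (card {a\<in>A. w a = e}) \<noteq> 0"
    then obtain a where "a \<in> A" "w a = e" by (auto simp: card_eq_0_iff)
    then show "bounded_expo n B e" using B by blast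
  qed
  then have l: "lcoeff l e = int (card {a\<in>A. w a = e})" for e
    unfolding l_def by (simp add: Abs_laurent_inverse)
  have "((\<lambda>a. mono_of (w a)) has_sum l) A"
    unfolding has_sum_def tendsto_laurent_iff
  proof
    fix e
    show "\<forall>\<^sub>F F in finite_subsets_at_top A. lcoeff (\<Sum>a\<in>F. mono_of (w a)) e = lcoeff l e"
      unfolding eventually_finite_subsets_at_top
    proof (intro exI[of _ "{a\<in>A. w a = e}"] conjI allI impI)
      fix F assume F: "finite F \<and> {a\<in>A. w a = e} \<subseteq> F \<and> F \<subseteq> A"
      have "lcoeff (\<Sum>a\<in>F. mono_of (w a)) e = (\<Sum>a\<in>F. of_bool (e = w a))"
        by (simp add: lcoeff_sum lcoeff_mono_of)
      also have "\<dots> = int (card (F \<inter> {a. e = w a}))" using F by (simp add: sum_of_bool_eq)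
      also have "F \<inter> {a. e = w a} = {a\<in>A. w a = e}" using F by auto
      finally show "lcoeff (\<Sum>a\<in>F. mono_of (w a)) e = lcoeff l e" by (simp add: l)
    qed (use fin in auto)
  qed
  then have "gf A w = l" unfolding gf_def by (rule infsumI)
  then show ?thesis by (simp add: l)
qed

lemma bnd_gf:
  assumes "admissible n A w"
  shows "bnd n B (gf A w) \<longleftrightarrow> (\<forall>a\<in>A. bounded_expo n B (w a))"
proof -
  have "finite {a\<in>A. w a = e}" for e using assms by (simp add: admissible_def)
  then show ?thesis
    by (auto simp: bnd_def lcoeff_gf[OF assms] card_eq_0_iff)
qed

lemma admissible_finite: "finite A \<Longrightarrow> (\<And>a. a \<in> A \<Longrightarrow> bounded_expo n B (w a)) \<Longrightarrow> admissible n A w"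
  by (auto simp: admissible_def)

lemma gf_finite: "finite A \<Longrightarrow> gf A w = (\<Sum>a\<in>A. mono_of (w a))"
  by (simp add: gf_def)

lemma gf_bij_betw:
  assumes "bij_betw f A B" "\<And>a. a \<in> A \<Longrightarrow> w a = w' (f a)"
  shows "gf A w = gf B w'"
proof -
  have "gf A w = (\<Sum>\<^sub>\<infinity>a\<in>A. mono_of (w' (f a)))" unfolding gf_def using assms(2) by (auto intro: infsum_cong)
  also have "\<dots> = gf B w'" unfolding gf_def by (rule infsum_reindex_bij_betw[OF assms(1)])
  finally show ?thesis .
qed

lemma admissible_bij_betw:
  assumes "bij_betw f A B" "\<And>a. a \<in> A \<Longrightarrow> w a = w' (f a)" "admissible n B w'"
  shows "admissible n A w"
proof -
  obtain C where C: "\<And>b. b \<in> B \<Longrightarrow> bounded_expo n C (w' b)"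
    and fin: "\<And>e. finite {b\<in>B. w' b = e}" using assms(3) by (auto simp: admissible_def)
  have inj: "inj_on f A" and im: "f ` A = B" using assms(1) by (auto simp: bij_betw_def)
  have "finite {a\<in>A. w a = e}" for e
  proof (rule finite_imageD)
    have "f ` {a\<in>A. w a = e} \<subseteq> {b\<in>B. w' b = e}" using im assms(2) by auto
    then show "finite (f ` {a\<in>A. w a = e})" using fin finite_subset by blast
    show "inj_on f {a\<in>A. w a = e}" using inj by (rule inj_on_subset) auto
  qed
  moreover have "\<forall>a\<in>A. bounded_expo n C (w a)" using C im assms(2) by auto
  ultimately show ?thesis by (auto simp: admissible_def)
qed

text \<open>The fibre over e is a disjoint union over the exponents x of the first component. The
  bounds on the two factors confine x to a finite box, so the count of the fibre is a coefficient of
  the product.\<close>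

lemma
  assumes A: "admissible n A u" and B: "admissible n B v"
  shows admissible_Times: "admissible n (A \<times> B) (\<lambda>(a, b). u a + v b)" (is ?adm)
    and gf_Times: "gf (A \<times> B) (\<lambda>(a, b). u a + v b) = gf A u * gf B v"
proof -
  obtain C D where C: "\<And>a. a \<in> A \<Longrightarrow> bounded_expo n C (u a)" and D: "\<And>b. b \<in> B \<Longrightarrow> bounded_expo n D (v b)"
    and fin: "\<And>e. finite {a\<in>A. u a = e}" "\<And>e. finite {b\<in>B. v b = e}"
    using A B unfolding admissible_def by metis
  define S where "S e = {a. bounded_expo n C a \<and> (\<forall>i. Poly_Mapping.lookup a i \<le> Poly_Mapping.lookup e i - D)}"
    for e :: expo
  have finS: "finite (S e)" for e unfolding S_def by (rule finite_expo_box)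
  have mem: "u a \<in> S e" if "a \<in> A" "b \<in> B" "u a + v b = e" for a b e
    using C[OF that(1)] D[OF that(2)] that(3) by (auto simp: S_def bounded_expo_def lookup_add)
  have eq: "{p \<in> A \<times> B. (case p of (a, b) \<Rightarrow> u a + v b) = e} =
      (\<Union>x\<in>S e. {a\<in>A. u a = x} \<times> {b\<in>B. v b = e - x})" (is "?L e = ?R e") for e
  proof (intro set_eqI iffI)
    fix p assume "p \<in> ?L e"
    then obtain a b where ab: "p = (a, b)" "a \<in> A" "b \<in> B" "u a + v b = e" by auto
    then have "u a \<in> S e" "v b = e - u a" using mem by (blast, metis add_diff_cancel_left')
    then show "p \<in> ?R e" using ab by blast
  next
    fix p assume "p \<in> ?R e"
    then obtain a b where "p = (a, b)" "a \<in> A" "b \<in> B" "v b = e - u a" by auto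
    then show "p \<in> ?L e" by simp
  qed
  have finL: "finite (?L e)" for e unfolding eq using finS fin by auto
  moreover have "\<forall>p\<in>A \<times> B. bounded_expo n (C + D) (case p of (a, b) \<Rightarrow> u a + v b)"
    using C D by (auto intro: bounded_expo_add)
  ultimately show adm: ?adm by (auto simp: admissible_def)
  show "gf (A \<times> B) (\<lambda>(a, b). u a + v b) = gf A u * gf B v"
  proof (rule laurent_eqI)
    fix e
    have "int (card (?R e)) = (\<Sum>x\<in>S e. int (card ({a\<in>A. u a = x} \<times> {b\<in>B. v b = e - x})))"
      by (subst card_UN_disjoint) (use finS fin in auto)
    also have "\<dots> = (\<Sum>x\<in>S e. lcoeff (gf A u) x * lcoeff (gf B v) (e - x))"
      by (simp add: card_cartesian_product lcoeff_gf[OF A] lcoeff_gf[OF B])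
    also have "\<dots> = lcoeff (gf A u * gf B v) e"
      unfolding coeff_times
    proof (rule Sum_any.expand_superset[OF finS, symmetric], clarsimp)
      fix x assume "lcoeff (gf A u) x \<noteq> 0" "lcoeff (gf B v) (e - x) \<noteq> 0"
      then obtain a b where "a \<in> A" "u a = x" "b \<in> B" "v b = e - x"
        by (auto simp: lcoeff_gf[OF A] lcoeff_gf[OF B] card_eq_0_iff)
      then show "x \<in> S e" using mem by fastforce
    qed
    finally show "lcoeff (gf (A \<times> B) (\<lambda>(a, b). u a + v b)) e = lcoeff (gf A u * gf B v) e"
      unfolding lcoeff_gf[OF adm] eq .
  qed
qed

text \<open>Admissibility of the union is derived, not assumed: the coefficients count growing
  finite fibres, so a count that is eventually constant forces the fibre itself to be eventually
  constant.\<close>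

lemma gf_incseq:
  assumes A: "\<And>N. admissible n (A N) w" and "incseq A" and conv: "bconv n (\<lambda>N. gf (A N) w) l"
  shows "gf (\<Union>N. A N) w = l"
proof -
  obtain B where B: "\<And>N. bnd n B (gf (A N) w)" using conv by (auto simp: bconv_def)
  have fin: "finite {a\<in>A N. w a = e}" for N e using A by (simp add: admissible_def)
  have ex: "\<exists>N. {a\<in>(\<Union>N. A N). w a = e} = {a\<in>A N. w a = e} \<and> int (card {a\<in>A N. w a = e}) = lcoeff l e" for e
  proof -
    obtain N where N: "\<And>M. M \<ge> N \<Longrightarrow> int (card {a\<in>A M. w a = e}) = lcoeff l e"
      using bconvD[OF conv, of e] by (auto simp: eventually_sequentially lcoeff_gf[OF A])
    have sub: "a \<in> A N" if a: "a \<in> A M" "w a = e" for a M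
    proof -
      let ?K = "max M N"
      have "A N \<subseteq> A ?K" "A M \<subseteq> A ?K"
        using incseqD[OF \<open>incseq A\<close>] by simp_all
      then have 1: "{a\<in>A N. w a = e} \<subseteq> {a\<in>A ?K. w a = e}" and 2: "a \<in> A ?K" using a by blast+
      have "int (card {a\<in>A N. w a = e}) = int (card {a\<in>A ?K. w a = e})"
        using N[of N] N[of ?K] by (simp del: of_nat_eq_iff)
      then have "{a\<in>A N. w a = e} = {a\<in>A ?K. w a = e}"
        by (intro card_subset_eq[OF fin 1]) simp
      then show ?thesis using a 2 by blast
    qed
    have "{a\<in>(\<Union>N. A N). w a = e} = {a\<in>A N. w a = e}" by (auto dest: sub)
    then show ?thesis using N[of N] by blast
  qed
  have "bounded_expo n B (w a)" if "a \<in> A N" for a N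
    using B[of N] that by (simp add: bnd_gf[OF A])
  moreover have "finite {a\<in>(\<Union>N. A N). w a = e}" for e
  proof -
    obtain N where "{a\<in>(\<Union>N. A N). w a = e} = {a\<in>A N. w a = e}" using ex by blast
    then show ?thesis using fin by simp
  qed
  ultimately have adm: "admissible n (\<Union>N. A N) w" by (auto simp: admissible_def)
  show "gf (\<Union>N. A N) w = l"
  proof (rule laurent_eqI)
    fix e
    obtain N where "{a\<in>(\<Union>N. A N). w a = e} = {a\<in>A N. w a = e}" "int (card {a\<in>A N. w a = e}) = lcoeff l e"
      using ex by blast
    then show "lcoeff (gf (\<Union>N. A N) w) e = lcoeff l e" by (simp only: lcoeff_gf[OF adm])
  qed
qed

section \<open>Geometric series\<close>

definition geo :: "expo \<Rightarrow> laurent" where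
  "geo e = 1 / (1 - mono_of e)"

text \<open>Since \<open>deg e\<close> is positive, the multiples of e are distinct. Multiplication
  by \<open>1 - mono_of e\<close> subtracts the shifted series and leaves the multiple 0 alone, so
  the series of multiples is the inverse.\<close>

lemma
  assumes e: "bounded_expo n 0 e" "e \<noteq> 0"
  shows admissible_geo: "admissible n UNIV (\<lambda>c. of_nat c * e)"
    and geo_mult: "(1 - mono_of e) * geo e = 1"
    and gf_geo: "gf UNIV (\<lambda>c. of_nat c * e) = geo e"
proof -
  have lookup: "Poly_Mapping.lookup (of_nat c * e) i = int c * Poly_Mapping.lookup e i" for c i
    using lookup_of_int_mult[of "int c" e i] by simp
  have pos: "deg e > 0" using e by (rule deg_pos)
  have inj: "c = d" if "of_nat c * e = of_nat d * e" for c d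
  proof -
    have "int c * deg e = int d * deg e" using that by (metis deg_of_nat_mult)
    then show ?thesis using pos by simp
  qed
  have "bounded_expo n 0 (of_nat c * e)" for c
    using e(1) unfolding bounded_expo_def by (auto simp: in_keys_iff lookup)
  moreover have "finite {c. of_nat c * e = x}" for x
  proof (cases "\<exists>c. of_nat c * e = x")
    case True
    then obtain c where "of_nat c * e = x" by blast
    then have "{c. of_nat c * e = x} \<subseteq> {c}" using inj by auto
    then show ?thesis by (rule finite_subset) simp
  qed auto
  ultimately show adm: "admissible n UNIV (\<lambda>c. of_nat c * e)" by (auto simp: admissible_def)
  have "(1 - mono_of e) * gf UNIV (\<lambda>c. of_nat c * e) = 1"
  proof (rule laurent_eqI)
    fix x
    have "lcoeff ((1 - mono_of e) * gf UNIV (\<lambda>c. of_nat c * e)) x =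
        int (card {c. of_nat c * e = x}) - int (card {c. of_nat c * e = x - e})"
      by (simp add: left_diff_distrib lcoeff_diff lcoeff_mono_of_mult lcoeff_gf[OF adm])
    moreover have "{c. of_nat c * e = x} = Suc ` {c. of_nat c * e = x - e} \<union> {c. c = 0 \<and> x = 0}"
    proof (intro set_eqI iffI)
      fix c assume "c \<in> {c. of_nat c * e = x}"
      then show "c \<in> Suc ` {c. of_nat c * e = x - e} \<union> {c. c = 0 \<and> x = 0}"
        by (cases c) (auto simp: algebra_simps)
    qed (auto simp: algebra_simps)
    moreover have "card (Suc ` {c. of_nat c * e = x - e} \<union> {c. c = 0 \<and> x = 0}) =
        card {c. of_nat c * e = x - e} + of_bool (x = 0)"
    proof -
      have "finite {c. of_nat c * e = x - e}" using adm by (simp add: admissible_def)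
      then show ?thesis by (subst card_Un_disjoint) (auto simp: card_image)
    qed
    ultimately show "lcoeff ((1 - mono_of e) * gf UNIV (\<lambda>c. of_nat c * e)) x = lcoeff 1 x"
      by (simp add: lcoeff_1)
  qed
  moreover from this have "geo e = gf UNIV (\<lambda>c. of_nat c * e)"
    by (simp add: geo_def divide_laurent_def laurent_inverse_unique)
  ultimately show "(1 - mono_of e) * geo e = 1" "gf UNIV (\<lambda>c. of_nat c * e) = geo e" by auto
qed

lemma bnd_geo:
  assumes "bounded_expo n 0 e" "e \<noteq> 0"
  shows "bnd n 0 (geo e)"
proof -
  have "bounded_expo n 0 (of_nat c * e)" for c
  proof -
    have "Poly_Mapping.lookup (of_nat c * e) i = int c * Poly_Mapping.lookup e i" for i
      using lookup_of_int_mult[of "int c" e i] by simp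
    then show ?thesis using assms(1) unfolding bounded_expo_def by (auto simp: in_keys_iff)
  qed
  then show ?thesis unfolding gf_geo[OF assms, symmetric] bnd_gf[OF admissible_geo[OF assms]] by simp
qed

section \<open>Infinite products\<close>

text \<open>Congruence to 1 in degrees below d. Such a factor leaves the coefficients of degree
  below d of a series with nonnegative exponents unchanged.\<close>

definition near1 :: "nat \<Rightarrow> int \<Rightarrow> laurent \<Rightarrow> bool" where
  "near1 n d f \<longleftrightarrow> bnd n 0 f \<and> (\<forall>e. lcoeff (f - 1) e \<noteq> 0 \<longrightarrow> d \<le> deg e)"

lemma near1_bnd: "near1 n d f \<Longrightarrow> bnd n 0 f"
  by (simp add: near1_def)

lemma lcoeff_mult_near1:
  assumes "near1 n d f" "bnd n 0 g" "deg e < d"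
  shows "lcoeff (g * f) e = lcoeff g e"
proof -
  have "lcoeff (g * (f - 1)) e = 0"
  proof (rule ccontr)
    assume "lcoeff (g * (f - 1)) e \<noteq> 0"
    then obtain a where a: "lcoeff g a \<noteq> 0" "lcoeff (f - 1) (e - a) \<noteq> 0" by (rule times_supp)
    have "deg a \<ge> 0" using a(1) assms(2) by (auto simp: bnd_def intro: deg_nonneg)
    moreover have "deg (e - a) \<ge> d" using a(2) assms(1) by (auto simp: near1_def)
    ultimately show False using assms(3) by (simp add: deg_diff)
  qed
  moreover have "g * f = g * (f - 1) + g" by (simp add: algebra_simps)
  ultimately show ?thesis by (simp add: lcoeff_add)
qed

lemma near1_1: "near1 n d 1"
  by (simp add: near1_def bnd_1)

lemma near1_mult:
  assumes "near1 n d f" "near1 n d g"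
  shows "near1 n d (f * g)"
  unfolding near1_def
proof (intro conjI allI impI)
  show "bnd n 0 (f * g)" using assms by (intro bnd_mult_0 near1_bnd)
  fix e assume ne: "lcoeff (f * g - 1) e \<noteq> 0"
  show "d \<le> deg e"
  proof (rule ccontr)
    assume "\<not> d \<le> deg e"
    then have "lcoeff (f * g) e = lcoeff f e"
      using assms by (intro lcoeff_mult_near1) (auto simp: near1_def)
    then have "lcoeff (f - 1) e \<noteq> 0" using ne by (simp add: lcoeff_diff)
    then show False using assms \<open>\<not> d \<le> deg e\<close> by (simp add: near1_def)
  qed
qed

lemma near1_prod: "(\<And>i. i \<in> I \<Longrightarrow> near1 n d (f i)) \<Longrightarrow> near1 n d (prod f I)"
  by (induction I rule: infinite_finite_induct) (auto intro: near1_mult near1_1)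

lemma near1_mono: "near1 n d f \<Longrightarrow> d' \<le> d \<Longrightarrow> near1 n d' f"
  by (force simp: near1_def)

lemma near1_one_minus:
  assumes "bounded_expo n 0 e"
  shows "near1 n (deg e) (1 - mono_of e)"
  unfolding near1_def using assms by (auto simp: bnd_1 bnd_mono_of bnd_diff lcoeff_uminus lcoeff_mono_of)

lemma near1_geo:
  assumes e: "bounded_expo n 0 e" "e \<noteq> 0"
  shows "near1 n (deg e) (geo e)"
  unfolding near1_def
proof (intro conjI allI impI)
  show b: "bnd n 0 (geo e)" using e by (rule bnd_geo)
  fix x assume ne: "lcoeff (geo e - 1) x \<noteq> 0"
  have "geo e - 1 = mono_of e * geo e" using geo_mult[OF e] by (simp add: algebra_simps)
  then have "lcoeff (geo e) (x - e) \<noteq> 0" using ne by (simp add: lcoeff_mono_of_mult)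
  then have "deg (x - e) \<ge> 0" using b by (auto simp: bnd_def intro: deg_nonneg)
  then show "deg e \<le> deg x" by (simp add: deg_diff)
qed

definition exhausts :: "(nat \<Rightarrow> 'a set) \<Rightarrow> 'a set \<Rightarrow> bool" where
  "exhausts S A \<longleftrightarrow> (\<forall>N. finite (S N) \<and> S N \<subseteq> A) \<and> (\<forall>i\<in>A. \<forall>\<^sub>F N in sequentially. i \<in> S N)"

text \<open>The coefficient at e is settled by the finitely many factors of weight at most
  \<open>deg e\<close>. Hence one limit serves all exhaustions, and the same product may later be
  evaluated through windows of different shapes.\<close>

lemma infinite_product_exists:
  assumes near: "\<And>i. i \<in> A \<Longrightarrow> near1 n (w i) (g i)" and fin: "\<And>d. finite {i\<in>A. w i \<le> d}"
  obtains l where "\<And>S. exhausts S A \<Longrightarrow> bconv n (\<lambda>N. \<Prod>i\<in>S N. g i) l"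
proof -
  define T where "T e = {i\<in>A. w i \<le> deg e}" for e
  have finT: "finite (T e)" and subT: "T e \<subseteq> A" for e using fin by (auto simp: T_def)
  have bnd: "bnd n 0 (\<Prod>i\<in>F. g i)" if "F \<subseteq> A" for F
    using that near by (intro bnd_prod near1_bnd) auto
  define c where "c e = lcoeff (\<Prod>i\<in>T e. g i) e" for e
  have "laurent_supp c"
    unfolding laurent_supp_def c_def
    by (rule exI[of _ n], rule exI[of _ 0]) (use bnd[OF subT] in \<open>auto simp: bnd_def\<close>)
  then have l: "lcoeff (Abs_laurent c) e = c e" for e by (simp add: Abs_laurent_inverse)
  have stable: "lcoeff (\<Prod>i\<in>F. g i) e = c e" if F: "finite F" "T e \<subseteq> F" "F \<subseteq> A" for F e
  proof -
    have "prod g F = prod g (T e) * prod g (F - T e)"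
      using F by (metis finT prod.subset_diff mult.commute)
    moreover have "near1 n (deg e + 1) (prod g (F - T e))"
      using F by (intro near1_prod near1_mono[OF near]) (auto simp: T_def)
    ultimately show ?thesis unfolding c_def using bnd[OF subT] by (simp add: lcoeff_mult_near1)
  qed
  show thesis
  proof (rule that[of "Abs_laurent c"])
    fix S :: "nat \<Rightarrow> 'a set" assume S: "exhausts S A"
    show "bconv n (\<lambda>N. \<Prod>i\<in>S N. g i) (Abs_laurent c)"
      unfolding bconv_def
    proof (intro conjI allI)
      show "\<exists>B. \<forall>N. bnd n B (\<Prod>i\<in>S N. g i)" using S bnd unfolding exhausts_def by blast
      fix e
      have "\<forall>\<^sub>F N in sequentially. \<forall>i\<in>T e. i \<in> S N"
        using S subT[of e] unfolding exhausts_def by (intro eventually_ball_finite finT) blast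
      then show "\<forall>\<^sub>F N in sequentially. lcoeff (\<Prod>i\<in>S N. g i) e = lcoeff (Abs_laurent c) e"
      proof eventually_elim
        case (elim N)
        then show ?case using S by (simp add: l stable exhausts_def subset_iff)
      qed
    qed
  qed
qed

text \<open>Serves to see that a limit is nonzero, as \<open>has_prod\<close> demands.\<close>

lemma lcoeff_infinite_product_0:
  assumes "bconv n f l" "\<And>N. near1 n 1 (f N)"
  shows "lcoeff l 0 = 1"
proof -
  obtain N where "lcoeff (f N) 0 = lcoeff l 0"
    using bconvD[OF assms(1), of 0] by (auto simp: eventually_sequentially)
  moreover have "lcoeff (f N - 1) 0 = 0" using assms(2)[of N] by (force simp: near1_def)
  ultimately show ?thesis by (simp add: lcoeff_diff lcoeff_1)
qed

section \<open>Interlacing sequences and the exchange of adjacent steps\<close>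

definition fin_supp :: "(nat \<Rightarrow> nat) \<Rightarrow> bool" where
  "fin_supp a \<longleftrightarrow> (\<exists>K. \<forall>m\<ge>K. a m = 0)"

definition psize :: "(nat \<Rightarrow> nat) \<Rightarrow> nat" where
  "psize a = (\<Sum>m | a m \<noteq> 0. a m)"

text \<open>The chain \<open>a (Suc m) \<le> b m \<le> a m\<close> forces both sequences to decrease
  weakly, and says that a arises from b by adding a horizontal strip.\<close>

definition interlaced :: "(nat \<Rightarrow> nat) \<Rightarrow> (nat \<Rightarrow> nat) \<Rightarrow> bool" where
  "interlaced a b \<longleftrightarrow> (\<forall>m. b m \<le> a m \<and> a (Suc m) \<le> b m)"

lemma psize_eq:
  assumes "\<And>m. m \<ge> K \<Longrightarrow> a m = 0"
  shows "psize a = (\<Sum>m<K. a m)"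
proof -
  have "{m. a m \<noteq> 0} \<subseteq> {..<K}" using assms by (metis (mono_tags) lessThan_iff linorder_not_le mem_Collect_eq subsetI)
  then show ?thesis unfolding psize_def by (intro sum.mono_neutral_left) auto
qed

lemma fin_supp_le: "fin_supp a \<Longrightarrow> (\<And>m. b m \<le> a m) \<Longrightarrow> fin_supp b"
  unfolding fin_supp_def by (metis le_zero_eq)

lemma interlaced_fin_supp: "interlaced a b \<Longrightarrow> fin_supp a \<longleftrightarrow> fin_supp b"
proof
  assume ab: "interlaced a b"
  show "fin_supp b" if "fin_supp a" using ab that by (auto simp: interlaced_def intro: fin_supp_le)
  assume "fin_supp b"
  then obtain K where "\<And>m. m \<ge> K \<Longrightarrow> b m = 0" by (auto simp: fin_supp_def)
  then have "a m = 0" if "m \<ge> Suc K" for m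
    using ab that by (cases m) (auto simp: interlaced_def, metis le_zero_eq)
  then show "fin_supp a" by (auto simp: fin_supp_def)
qed

text \<open>
  In terms of the intervals of allowed values, the entry
  \<open>k (Suc m)\<close> of a common upper neighbour and the entry \<open>t m\<close> of a common lower neighbour range
  over the same interval; reflecting this interval makes the sizes match.
\<close>

definition exchange_down :: "(nat \<Rightarrow> nat) \<Rightarrow> (nat \<Rightarrow> nat) \<Rightarrow> (nat \<Rightarrow> nat) \<Rightarrow> nat \<times> (nat \<Rightarrow> nat)" where
  "exchange_down a b k =
     (k 0 - max (a 0) (b 0), \<lambda>m. max (a (Suc m)) (b (Suc m)) + min (a m) (b m) - k (Suc m))"

definition exchange_up :: "(nat \<Rightarrow> nat) \<Rightarrow> (nat \<Rightarrow> nat) \<Rightarrow> nat \<Rightarrow> (nat \<Rightarrow> nat) \<Rightarrow> nat \<Rightarrow> nat" where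
  "exchange_up a b c t m = (case m of 0 \<Rightarrow> max (a 0) (b 0) + c
     | Suc m \<Rightarrow> max (a (Suc m)) (b (Suc m)) + min (a m) (b m) - t m)"

text \<open>Each entry of k has an interval of its own, independent of the other entries. Only
  \<open>k 0\<close> is unbounded above; its excess becomes the free exponent of a geometric series,
  since lower neighbours have no such entry.\<close>

lemma upper_neighbour_iff:
  "interlaced k a \<and> interlaced k b \<longleftrightarrow> max (a 0) (b 0) \<le> k 0 \<and>
     (\<forall>m. max (a (Suc m)) (b (Suc m)) \<le> k (Suc m) \<and> k (Suc m) \<le> min (a m) (b m))"
  (is "?L \<longleftrightarrow> ?R")
proof
  assume R: ?R
  then have "a m \<le> k m \<and> b m \<le> k m" for m by (cases m) auto
  then show ?L using R by (auto simp: interlaced_def)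
qed (auto simp: interlaced_def)

lemma lower_neighbour_iff:
  "interlaced a t \<and> interlaced b t \<longleftrightarrow>
     (\<forall>m. max (a (Suc m)) (b (Suc m)) \<le> t m \<and> t m \<le> min (a m) (b m))"
  by (auto simp: interlaced_def)

lemma exchange_down_neighbour:
  assumes "interlaced k a" "interlaced k b"
  shows "interlaced a (snd (exchange_down a b k))" "interlaced b (snd (exchange_down a b k))"
proof -
  have R: "max (a (Suc m)) (b (Suc m)) \<le> k (Suc m)" "k (Suc m) \<le> min (a m) (b m)" for m
    using assms upper_neighbour_iff[of k a b] by blast+
  have "max (a (Suc m)) (b (Suc m)) \<le> snd (exchange_down a b k) m \<and> snd (exchange_down a b k) m \<le> min (a m) (b m)" for m
    using R[of m] unfolding exchange_down_def snd_conv by linarith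
  then show "interlaced a (snd (exchange_down a b k))" "interlaced b (snd (exchange_down a b k))"
    using lower_neighbour_iff[of a _ b] by blast+
qed

lemma exchange_up_neighbour:
  assumes "interlaced a t" "interlaced b t"
  shows "interlaced (exchange_up a b c t) a" "interlaced (exchange_up a b c t) b"
proof -
  have R: "max (a (Suc m)) (b (Suc m)) \<le> t m" "t m \<le> min (a m) (b m)" for m
    using assms lower_neighbour_iff[of a t b] by blast+
  have "max (a (Suc m)) (b (Suc m)) \<le> exchange_up a b c t (Suc m) \<and> exchange_up a b c t (Suc m) \<le> min (a m) (b m)" for m
    using R[of m] unfolding exchange_up_def nat.case by linarith
  moreover have "max (a 0) (b 0) \<le> exchange_up a b c t 0" by (simp add: exchange_up_def)
  ultimately show "interlaced (exchange_up a b c t) a" "interlaced (exchange_up a b c t) b"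
    using upper_neighbour_iff[of _ a b] by blast+
qed

lemma exchange_up_down:
  assumes "interlaced k a" "interlaced k b"
  shows "exchange_up a b (fst (exchange_down a b k)) (snd (exchange_down a b k)) = k"
proof
  fix m
  have R: "max (a 0) (b 0) \<le> k 0" "\<And>m. k (Suc m) \<le> min (a m) (b m)"
    using assms upper_neighbour_iff[of k a b] by blast+
  show "exchange_up a b (fst (exchange_down a b k)) (snd (exchange_down a b k)) m = k m"
  proof (cases m)
    case (Suc l)
    have "k (Suc l) \<le> max (a (Suc l)) (b (Suc l)) + min (a l) (b l)" using R(2)[of l] by linarith
    then show ?thesis by (simp add: Suc exchange_up_def exchange_down_def)
  qed (use R(1) in \<open>simp add: exchange_up_def exchange_down_def\<close>)
qed

lemma exchange_down_up:
  assumes "interlaced a t" "interlaced b t"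
  shows "exchange_down a b (exchange_up a b c t) = (c, t)"
proof -
  have "t m \<le> min (a m) (b m)" for m
    using assms lower_neighbour_iff[of a t b] by blast
  then have "max (a (Suc m)) (b (Suc m)) + min (a m) (b m) -
      (max (a (Suc m)) (b (Suc m)) + min (a m) (b m) - t m) = t m" for m
    by (simp add: trans_le_add2)
  then show ?thesis by (simp add: exchange_down_def exchange_up_def)
qed

text \<open>Entry m of the lower neighbour is paired with entry \<open>Suc m\<close> of k: by
  reflection their sum is the sum of the two ends of the interval. The maxima and minima of a and b
  then recombine to a + b, and the excess of \<open>k 0\<close> is left over.\<close>

lemma psize_exchange:
  assumes k: "interlaced k a" "interlaced k b" and a: "fin_supp a" and b: "fin_supp b"
  shows "psize k + psize (snd (exchange_down a b k)) = psize a + psize b + fst (exchange_down a b k)"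
proof -
  let ?M = "\<lambda>m. max (a m) (b m)" and ?t = "snd (exchange_down a b k)"
  obtain K L where "\<And>m. m \<ge> K \<Longrightarrow> a m = 0" "\<And>m. m \<ge> L \<Longrightarrow> b m = 0" 
    using a b unfolding fin_supp_def by metis
  then have K: "a m = 0 \<and> b m = 0" if "m \<ge> max K L" for m using that by simp
  define N where "N = max K L"
  have a0: "\<And>m. m \<ge> N \<Longrightarrow> a m = 0" and b0: "\<And>m. m \<ge> N \<Longrightarrow> b m = 0" using K by (auto simp: N_def)
  have R: "?M 0 \<le> k 0" "\<And>m. ?M (Suc m) \<le> k (Suc m)" "\<And>m. k (Suc m) \<le> min (a m) (b m)"
    using k upper_neighbour_iff[of k a b] by blast+
  have k0: "k m = 0" if "m \<ge> Suc N" for m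
  proof (cases m)
    case (Suc l)
    then show ?thesis using R(3)[of l] a0[of l] that by simp
  qed (use that in simp)
  have t0: "?t m = 0" if "m \<ge> N" for m
    using exchange_down_neighbour(1)[OF k] a0[OF that] by (metis interlaced_def le_zero_eq)
  have t: "?t m + k (Suc m) = ?M (Suc m) + min (a m) (b m)" for m
    using R(3)[of m] unfolding exchange_down_def snd_conv by linarith
  have "psize k + psize ?t = (\<Sum>m<Suc N. k m) + (\<Sum>m<N. ?t m)"
    using psize_eq[of "Suc N" k] psize_eq[of N ?t] k0 t0 by simp
  also have "\<dots> = k 0 + (\<Sum>m<N. ?t m + k (Suc m))"
    by (simp add: sum.lessThan_Suc_shift sum.distrib del: sum.lessThan_Suc)
  also have "\<dots> = k 0 + (\<Sum>m<N. ?M (Suc m)) + (\<Sum>m<N. min (a m) (b m))"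
    unfolding t by (simp add: sum.distrib)
  also have "k 0 + (\<Sum>m<N. ?M (Suc m)) = fst (exchange_down a b k) + (\<Sum>m<Suc N. ?M m)"
    using R(1) by (simp add: sum.lessThan_Suc_shift exchange_down_def del: sum.lessThan_Suc)
  also have "(\<Sum>m<Suc N. ?M m) = (\<Sum>m<N. ?M m)" using a0[of N] b0[of N] by simp
  also have "fst (exchange_down a b k) + (\<Sum>m<N. ?M m) + (\<Sum>m<N. min (a m) (b m)) =
      fst (exchange_down a b k) + (\<Sum>m<N. a m + b m)"
    by (simp flip: sum.distrib) (rule sum.cong, auto)
  also have "\<dots> = psize a + psize b + fst (exchange_down a b k)"
    using psize_eq[of N a] psize_eq[of N b] a0 b0 by (simp add: sum.distrib)
  finally show ?thesis .
qed

text \<open>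
  In a step \<open>(d, e)\<close> the flag \<open>d\<close> says whether the step goes down. The weight of a step of either
  kind is the decrease of the size times the label \<open>e\<close>.
\<close>

definition step :: "bool \<Rightarrow> (nat \<Rightarrow> nat) \<Rightarrow> (nat \<Rightarrow> nat) \<Rightarrow> bool" where
  "step d a b \<longleftrightarrow> (if d then interlaced a b else interlaced b a)"

fun paths :: "(bool \<times> expo) list \<Rightarrow> (nat \<Rightarrow> nat) \<Rightarrow> (nat \<Rightarrow> nat) \<Rightarrow> (nat \<Rightarrow> nat) list set" where
  "paths [] a b = (if a = b then {[]} else {})"
| "paths ((d, e) # w) a b = {k # p | k p. step d a k \<and> p \<in> paths w k b}"

definition step_wt :: "expo \<Rightarrow> (nat \<Rightarrow> nat) \<Rightarrow> (nat \<Rightarrow> nat) \<Rightarrow> expo" where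
  "step_wt e a b = of_int (int (psize a) - int (psize b)) * e"

fun path_wt :: "(bool \<times> expo) list \<Rightarrow> (nat \<Rightarrow> nat) \<Rightarrow> (nat \<Rightarrow> nat) list \<Rightarrow> expo" where
  "path_wt ((d, e) # w) a (k # p) = step_wt e a k + path_wt w k p"
| "path_wt _ a _ = 0"

lemma step_fin_supp: "step d a b \<Longrightarrow> fin_supp a \<longleftrightarrow> fin_supp b"
  by (auto simp: step_def interlaced_fin_supp split: if_splits)

text \<open>Bijective form of the statement that the generating function of w is G times that of w'.
  Bijections make sense before any summability is known. All end points occur so that a reduction
  applies inside a longer word, and the factor is indexed by \<open>nat\<close> so that its index
  set can be quantified.\<close>

definition reduces :: "nat \<Rightarrow> (bool \<times> expo) list \<Rightarrow> laurent \<Rightarrow> (bool \<times> expo) list \<Rightarrow> bool" where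
  "reduces n w G w' \<longleftrightarrow> (\<exists>(C :: nat set) cw. admissible n C cw \<and> gf C cw = G \<and>
     (\<forall>a b. fin_supp a \<longrightarrow> (\<exists>f. bij_betw f (paths w a b) (C \<times> paths w' a b) \<and>
        (\<forall>p\<in>paths w a b. path_wt w a p = cw (fst (f p)) + path_wt w' a (snd (f p))))))"

lemma reducesE:
  assumes "reduces n w G w'"
  obtains C :: "nat set" and cw f where "admissible n C cw" "gf C cw = G"
    "\<And>a b. fin_supp a \<Longrightarrow> bij_betw (f a b) (paths w a b) (C \<times> paths w' a b)"
    "\<And>a b p. fin_supp a \<Longrightarrow> p \<in> paths w a b \<Longrightarrow>
       path_wt w a p = cw (fst (f a b p)) + path_wt w' a (snd (f a b p))"
proof -
  obtain C :: "nat set" and cw where C: "admissible n C cw" "gf C cw = G"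
    and ex: "\<forall>a b. fin_supp a \<longrightarrow> (\<exists>f. bij_betw f (paths w a b) (C \<times> paths w' a b) \<and>
        (\<forall>p\<in>paths w a b. path_wt w a p = cw (fst (f p)) + path_wt w' a (snd (f p))))"
    using assms unfolding reduces_def by blast
  obtain f where "\<forall>a b. fin_supp a \<longrightarrow> bij_betw (f a b) (paths w a b) (C \<times> paths w' a b) \<and>
        (\<forall>p\<in>paths w a b. path_wt w a p = cw (fst (f a b p)) + path_wt w' a (snd (f a b p)))"
    using ex by metis
  then show thesis using that[OF C, of f] by blast
qed

lemma reduces_refl: "reduces n w 1 w"
  unfolding reduces_def
proof (intro exI[of _ "{0}"] exI[of _ "\<lambda>_. 0"] conjI allI impI)
  show "admissible n {0} (\<lambda>_. 0)" by (rule admissible_finite[of _ _ 0]) auto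
  show "gf {0} (\<lambda>_. 0) = 1" by (simp add: gf_finite)
  show "\<exists>f. bij_betw f (paths w a b) ({0} \<times> paths w a b) \<and>
      (\<forall>p\<in>paths w a b. path_wt w a p = 0 + path_wt w a (snd (f p)))" for a b
    by (rule exI[of _ "Pair 0"]) (auto simp: bij_betw_def inj_on_def)
qed

lemma reduces_trans:
  assumes "reduces n w G w'" "reduces n w' G' w''"
  shows "reduces n w (G * G') w''"
proof -
  obtain C :: "nat set" and cw f where 1: "admissible n C cw" "gf C cw = G"
    "\<And>a b. fin_supp a \<Longrightarrow> bij_betw (f a b) (paths w a b) (C \<times> paths w' a b)"
    "\<And>a b p. fin_supp a \<Longrightarrow> p \<in> paths w a b \<Longrightarrow>
       path_wt w a p = cw (fst (f a b p)) + path_wt w' a (snd (f a b p))"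
    using assms(1) by (rule reducesE) blast
  obtain C' :: "nat set" and cw' f' where 2: "admissible n C' cw'" "gf C' cw' = G'"
    "\<And>a b. fin_supp a \<Longrightarrow> bij_betw (f' a b) (paths w' a b) (C' \<times> paths w'' a b)"
    "\<And>a b p. fin_supp a \<Longrightarrow> p \<in> paths w' a b \<Longrightarrow>
       path_wt w' a p = cw' (fst (f' a b p)) + path_wt w'' a (snd (f' a b p))"
    using assms(2) by (rule reducesE) blast
  \<comment> \<open>The pairing function turns the product of the two index sets into a set of
    numbers again.\<close>
  let ?D = "prod_encode ` (C \<times> C')" and ?dw = "\<lambda>x. (\<lambda>(c, c'). cw c + cw' c') (prod_decode x)"
  have bij: "bij_betw prod_decode ?D (C \<times> C')"
    by (rule bij_betw_byWitness[where f' = prod_encode]) auto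
  have "admissible n ?D ?dw"
    by (rule admissible_bij_betw[OF bij _ admissible_Times[OF 1(1) 2(1)]]) simp
  moreover have "gf ?D ?dw = G * G'"
    unfolding gf_bij_betw[OF bij refl] using gf_Times[OF 1(1) 2(1)] 1(2) 2(2) by simp
  moreover have "\<exists>g. bij_betw g (paths w a b) (?D \<times> paths w'' a b) \<and>
      (\<forall>p\<in>paths w a b. path_wt w a p = ?dw (fst (g p)) + path_wt w'' a (snd (g p)))"
    if a: "fin_supp a" for a b
  proof (intro exI conjI ballI)
    let ?g1 = "\<lambda>(c, p'). (c, f' a b p')" and ?g2 = "\<lambda>(c, c', p''). (prod_encode (c, c'), p'')"
    let ?g = "?g2 \<circ> (?g1 \<circ> f a b)"
    have "bij_betw ?g1 (C \<times> paths w' a b) (C \<times> (C' \<times> paths w'' a b))"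
      using bij_betw_map_prod[OF bij_betw_id[of C] 2(3)[OF a, of b]]
      by (simp add: map_prod_def id_def)
    then have "bij_betw (?g1 \<circ> f a b) (paths w a b) (C \<times> (C' \<times> paths w'' a b))"
      by (rule bij_betw_trans[OF 1(3)[OF a]])
    moreover have "bij_betw ?g2 (C \<times> (C' \<times> paths w'' a b)) (?D \<times> paths w'' a b)"
      by (rule bij_betw_byWitness[where f' = "\<lambda>(x, p). (fst (prod_decode x), snd (prod_decode x), p)"]) auto
    ultimately show "bij_betw ?g (paths w a b) (?D \<times> paths w'' a b)"
      by (rule bij_betw_trans)
    fix p assume p: "p \<in> paths w a b"
    obtain c p' where fp: "f a b p = (c, p')" by fastforce
    obtain c' p'' where fp': "f' a b p' = (c', p'')" by fastforce
    have "p' \<in> paths w' a b" using bij_betwE[OF 1(3)[OF a, of b]] p fp by fastforce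
    then show "path_wt w a p = ?dw (fst (?g p)) + path_wt w'' a (snd (?g p))"
      using 1(4)[OF a p] 2(4)[OF a, of p' b] fp fp' by (simp add: add.assoc)
  qed
  ultimately show ?thesis unfolding reduces_def by blast
qed

lemma reduces_Cons:
  assumes "reduces n w G w'"
  shows "reduces n (x # w) G (x # w')"
proof -
  obtain C :: "nat set" and cw f where 1: "admissible n C cw" "gf C cw = G"
    "\<And>a b. fin_supp a \<Longrightarrow> bij_betw (f a b) (paths w a b) (C \<times> paths w' a b)"
    "\<And>a b p. fin_supp a \<Longrightarrow> p \<in> paths w a b \<Longrightarrow>
       path_wt w a p = cw (fst (f a b p)) + path_wt w' a (snd (f a b p))"
    using assms by (rule reducesE) blast
  obtain d e where x: "x = (d, e)" by fastforce
  have "\<exists>g. bij_betw g (paths (x # w) a b) (C \<times> paths (x # w') a b) \<and>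
      (\<forall>p\<in>paths (x # w) a b. path_wt (x # w) a p = cw (fst (g p)) + path_wt (x # w') a (snd (g p)))"
    if a: "fin_supp a" for a b
  proof (intro exI conjI ballI)
    \<comment> \<open>The bijection for the tail depends on the first sequence \<open>hd p\<close>,
      which both maps keep.\<close>
    let ?g = "\<lambda>p. (fst (f (hd p) b (tl p)), hd p # snd (f (hd p) b (tl p)))"
    let ?h = "\<lambda>(c, p). hd p # inv_into (paths w (hd p) b) (f (hd p) b) (c, tl p)"
    have fs: "fin_supp k" if "step d a k" for k using step_fin_supp[OF that] a by simp
    have im: "f k b p \<in> C \<times> paths w' k b" if "step d a k" "p \<in> paths w k b" for k p
      using bij_betwE[OF 1(3)[OF fs[OF that(1)]]] that(2) by blast
    have im': "inv_into (paths w k b) (f k b) (c, p) \<in> paths w k b"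
      "f k b (inv_into (paths w k b) (f k b) (c, p)) = (c, p)"
      if "step d a k" "p \<in> paths w' k b" "c \<in> C" for k p c
    proof -
      have "(c, p) \<in> f k b ` paths w k b"
        using bij_betw_imp_surj_on[OF 1(3)[OF fs[OF that(1)]], of b] that by auto
      then show "inv_into (paths w k b) (f k b) (c, p) \<in> paths w k b"
        "f k b (inv_into (paths w k b) (f k b) (c, p)) = (c, p)"
        by (rule inv_into_into, rule f_inv_into_f)
    qed
    show "bij_betw ?g (paths (x # w) a b) (C \<times> paths (x # w') a b)"
    proof (rule bij_betw_byWitness[where f' = ?h])
      show "\<forall>p\<in>paths (x # w) a b. ?h (?g p) = p"
        using bij_betw_imp_inj_on[OF 1(3)[OF fs]] by (auto simp: x inv_into_f_f)
      show "\<forall>p\<in>C \<times> paths (x # w') a b. ?g (?h p) = p"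
        using im'(2) by (auto simp: x)
      show "?g ` paths (x # w) a b \<subseteq> C \<times> paths (x # w') a b"
        using im by (auto simp: x) (metis SigmaE fst_conv, metis SigmaE snd_conv)
      show "?h ` (C \<times> paths (x # w') a b) \<subseteq> paths (x # w) a b"
        using im'(1) by (auto simp: x)
    qed
    fix p assume "p \<in> paths (x # w) a b"
    then obtain k p' where "p = k # p'" "step d a k" "p' \<in> paths w k b" by (auto simp: x)
    then show "path_wt (x # w) a p = cw (fst (?g p)) + path_wt (x # w') a (snd (?g p))"
      using 1(4)[OF fs, of k p' b] by (simp add: x add.left_commute)
  qed
  then show ?thesis unfolding reduces_def using 1(1,2) by blast
qed

lemma step_wt_exchange:
  assumes "interlaced k a" "interlaced k b" "fin_supp a"
  shows "step_wt e a k + step_wt f k b = of_nat (fst (exchange_down a b k)) * (f - e) +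
     (step_wt f a (snd (exchange_down a b k)) + step_wt e (snd (exchange_down a b k)) b)"
proof -
  let ?c = "fst (exchange_down a b k)" and ?t = "snd (exchange_down a b k)"
  have "fin_supp b" using assms interlaced_fin_supp by blast
  then have "psize k + psize ?t = psize a + psize b + ?c" by (intro psize_exchange assms)
  then have eq: "int (psize k) = int (psize a) + int (psize b) + int ?c - int (psize ?t)" by linarith
  show ?thesis unfolding step_wt_def eq by (simp add: algebra_simps)
qed

text \<open>This is the commutation relation of the two half vertex operators: the excess of the
  common upper neighbour becomes a free number c, and each unit of it costs f - e.\<close>

lemma reduces_exchange:
  assumes "bounded_expo n 0 (f - e)" "f \<noteq> e"
  shows "reduces n ((False, e) # (True, f) # w) (geo (f - e)) ((True, f) # (False, e) # w)"
    (is "reduces n ?w _ ?w'")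
  unfolding reduces_def
proof (intro exI[of _ UNIV] exI[of _ "\<lambda>c. of_nat c * (f - e)"] conjI allI impI)
  show "admissible n UNIV (\<lambda>c. of_nat c * (f - e))" using assms by (intro admissible_geo) auto
  show "gf UNIV (\<lambda>c. of_nat c * (f - e)) = geo (f - e)" using assms by (intro gf_geo) auto
  fix a b assume a: "fin_supp a"
  let ?g = "\<lambda>p. case p of k # l # p \<Rightarrow>
    (fst (exchange_down a l k), snd (exchange_down a l k) # l # p)"
  let ?h = "\<lambda>(c, p). case p of t # l # p \<Rightarrow> exchange_up a l c t # l # p"
  show "\<exists>g. bij_betw g (paths ?w a b) (UNIV \<times> paths ?w' a b) \<and>
      (\<forall>p\<in>paths ?w a b. path_wt ?w a p = of_nat (fst (g p)) * (f - e) + path_wt ?w' a (snd (g p)))"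
  proof (intro exI conjI ballI)
    show "bij_betw ?g (paths ?w a b) (UNIV \<times> paths ?w' a b)"
    proof (rule bij_betw_byWitness[where f' = ?h])
      show "\<forall>p\<in>paths ?w a b. ?h (?g p) = p"
        by (auto simp: step_def exchange_up_down)
      show "\<forall>p\<in>UNIV \<times> paths ?w' a b. ?g (?h p) = p"
        by (auto simp: step_def exchange_down_up)
      show "?g ` paths ?w a b \<subseteq> UNIV \<times> paths ?w' a b"
        by (auto simp: step_def exchange_down_neighbour)
      show "?h ` (UNIV \<times> paths ?w' a b) \<subseteq> paths ?w a b"
        by (auto simp: step_def exchange_up_neighbour)
    qed
    fix p assume "p \<in> paths ?w a b"
    then obtain k l p' where p: "p = k # l # p'" "interlaced k a" "interlaced k l"
      by (auto simp: step_def)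
    show "path_wt ?w a p = of_nat (fst (?g p)) * (f - e) + path_wt ?w' a (snd (?g p))"
      using step_wt_exchange[OF p(2,3) a, of e f] by (simp add: p(1) flip: add.assoc)
  qed
qed

section \<open>Sorting a word of steps\<close>

fun word_ok :: "nat \<Rightarrow> (bool \<times> expo) list \<Rightarrow> bool" where
  "word_ok n [] \<longleftrightarrow> True"
| "word_ok n ((d, e) # w) \<longleftrightarrow> word_ok n w \<and>
     (\<not> d \<longrightarrow> (\<forall>f. (True, f) \<in> set w \<longrightarrow> bounded_expo n 0 (f - e) \<and> f \<noteq> e))"

fun word_prod :: "(bool \<times> expo) list \<Rightarrow> laurent" where
  "word_prod [] = 1"
| "word_prod ((d, e) # w) = (if d then 1 else \<Prod>(d, f)\<leftarrow>filter fst w. geo (f - e)) * word_prod w"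

text \<open>Insertion sort: the tail is sorted, then a leading up step is carried past the down
  steps at its front, each exchange producing one factor.\<close>

lemma reduces_sort: 
  "word_ok n w \<Longrightarrow> reduces n w (word_prod w) (filter fst w @ filter (\<lambda>x. \<not> fst x) w)"
proof (induction w)
  case Nil
  then show ?case using reduces_refl by simp
next
  case (Cons x w)
  obtain d e where x: "x = (d, e)" by fastforce
  have IH: "reduces n (x # w) (word_prod w) (x # filter fst w @ filter (\<lambda>x. \<not> fst x) w)"
    using Cons by (intro reduces_Cons) (auto simp: x)
  show ?case
  proof (cases d)
    case True
    then show ?thesis using IH by (simp add: x)
  next
    case False
    have move: "reduces n ((False, e) # ds @ us) (\<Prod>(d, f)\<leftarrow>ds. geo (f - e)) (ds @ (False, e) # us)"
      if "\<forall>(d, f)\<in>set ds. d \<and> bounded_expo n 0 (f - e) \<and> f \<noteq> e" for ds us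
      using that
    proof (induction ds)
      case Nil
      then show ?case using reduces_refl by simp
    next
      case (Cons y ds)
      obtain f where y: "y = (True, f)" using Cons.prems by auto
      have "reduces n ((False, e) # y # ds @ us) (geo (f - e) * (\<Prod>(d, f)\<leftarrow>ds. geo (f - e)))
          (y # ds @ (False, e) # us)"
        unfolding y by (rule reduces_trans[OF reduces_exchange reduces_Cons]) (use Cons y in auto)
      then show ?case by (simp add: y)
    qed
    have "\<forall>(d, f)\<in>set (filter fst w). d \<and> bounded_expo n 0 (f - e) \<and> f \<noteq> e"
      using Cons.prems False by (auto simp: x)
    from move[OF this] have "reduces n (x # filter fst w @ filter (\<lambda>x. \<not> fst x) w)
        (\<Prod>(d, f)\<leftarrow>filter fst w. geo (f - e)) (filter fst w @ x # filter (\<lambda>x. \<not> fst x) w)"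
      using False by (simp add: x)
    from reduces_trans[OF IH this] show ?thesis
      using False by (simp add: x mult.commute)
  qed
qed

text \<open>Summability is part of the conclusion: the bijection carries it back from the sorted
  word, where it will hold because only finitely many paths remain.\<close>

lemma
  assumes "word_ok n w" "fin_supp a"
    and adm: "admissible n (paths (filter fst w @ filter (\<lambda>x. \<not> fst x) w) a b)
      (path_wt (filter fst w @ filter (\<lambda>x. \<not> fst x) w) a)"
  shows admissible_paths: "admissible n (paths w a b) (path_wt w a)"
    and gf_paths: "gf (paths w a b) (path_wt w a) =
      word_prod w * gf (paths (filter fst w @ filter (\<lambda>x. \<not> fst x) w) a b)
        (path_wt (filter fst w @ filter (\<lambda>x. \<not> fst x) w) a)"
proof -
  let ?w' = "filter fst w @ filter (\<lambda>x. \<not> fst x) w"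
  obtain C :: "nat set" and cw f where C: "admissible n C cw" "gf C cw = word_prod w"
    and f: "\<And>a b. fin_supp a \<Longrightarrow> bij_betw (f a b) (paths w a b) (C \<times> paths ?w' a b)"
    "\<And>a b p. fin_supp a \<Longrightarrow> p \<in> paths w a b \<Longrightarrow>
       path_wt w a p = cw (fst (f a b p)) + path_wt ?w' a (snd (f a b p))"
    using reduces_sort[OF assms(1)] by (rule reducesE) blast
  have wt: "path_wt w a p = (\<lambda>(c, p). cw c + path_wt ?w' a p) (f a b p)" if "p \<in> paths w a b" for p
    using f(2)[OF assms(2) that] by (simp add: case_prod_beta)
  show "admissible n (paths w a b) (path_wt w a)"
    by (rule admissible_bij_betw[OF f(1)[OF assms(2)] wt admissible_Times[OF C(1) adm]])
  show "gf (paths w a b) (path_wt w a) = word_prod w * gf (paths ?w' a b) (path_wt ?w' a)"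
  proof -
    have "gf (paths w a b) (path_wt w a) = gf (C \<times> paths ?w' a b) (\<lambda>(c, p). cw c + path_wt ?w' a p)"
      by (rule gf_bij_betw[OF f(1)[OF assms(2)]]) (rule wt)
    then show ?thesis using gf_Times[OF C(1) adm] C(2) by simp
  qed
qed

section \<open>Path sums and their symmetry\<close>

lemma finite_below: 
  assumes "fin_supp c"
  shows "finite {k :: nat \<Rightarrow> nat. \<forall>m. k m \<le> c m}"
proof -
  obtain K where K: "\<And>m. m \<ge> K \<Longrightarrow> c m = 0" using assms by (auto simp: fin_supp_def)
  let ?M = "Max (c ` {..K})"
  have "{k. \<forall>m. k m \<le> c m} \<subseteq> {f. \<forall>i. (i \<in> {..<K} \<longrightarrow> f i \<in> {..?M}) \<and> (i \<notin> {..<K} \<longrightarrow> f i = 0)}"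
  proof (clarsimp, intro conjI impI)
    fix k i assume k: "\<forall>m. k m \<le> c m"
    show "k i \<le> ?M" if "i < K" using that by (intro order_trans[OF k[rule_format] Max_ge]) auto
    show "k i = 0" if "\<not> i < K" using k K[of i] that by (metis le_zero_eq not_less)
  qed
  then show ?thesis by (rule finite_subset) (rule finite_set_of_finite_funs, auto)
qed

lemma finite_interlaced: "fin_supp a \<Longrightarrow> finite {k. interlaced a k}"
  by (rule finite_subset[OF _ finite_below]) (auto simp: interlaced_def)

text \<open>An entry of a product of transfer matrices. An up step has infinitely many targets, so
  the rows and columns are restricted to a set K, finite in all uses, to keep every sum
  finite.\<close>

fun msum :: "(nat \<Rightarrow> nat) set \<Rightarrow> (bool \<times> expo) list \<Rightarrow> (nat \<Rightarrow> nat) \<Rightarrow> (nat \<Rightarrow> nat) \<Rightarrow> laurent" where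
  "msum K [] a b = of_bool (a = b)"
| "msum K ((d, e) # w) a b = (\<Sum>k | k \<in> K \<and> step d a k. mono_of (step_wt e a k) * msum K w k b)"

lemma msum_append:
  assumes K: "finite K" and "b \<in> K"
  shows "a \<in> K \<Longrightarrow> msum K (w @ w') a b = (\<Sum>k\<in>K. msum K w a k * msum K w' k b)"
proof (induction w arbitrary: a)
  case Nil
  then have "(\<Sum>k\<in>K. of_bool (a = k) * msum K w' k b) = (\<Sum>k\<in>K. if k = a then msum K w' k b else 0)"
    by (intro sum.cong) auto
  then show ?case using Nil K by simp
next
  case (Cons x w)
  obtain d e where x: "x = (d, e)" by fastforce
  let ?S = "{k. k \<in> K \<and> step d a k}"
  have "msum K ((x # w) @ w') a b = (\<Sum>k\<in>?S. mono_of (step_wt e a k) * (\<Sum>l\<in>K. msum K w k l * msum K w' l b))"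
    using Cons.IH by (simp add: x)
  also have "\<dots> = (\<Sum>l\<in>K. \<Sum>k\<in>?S. mono_of (step_wt e a k) * msum K w k l * msum K w' l b)"
    by (subst sum.swap) (simp add: sum_distrib_left mult.assoc)
  also have "\<dots> = (\<Sum>l\<in>K. msum K (x # w) a l * msum K w' l b)"
    by (simp add: x sum_distrib_right)
  finally show ?case .
qed

lemma msum_single:
  assumes "finite K" "b \<in> K"
  shows "msum K [(d, e)] a b = of_bool (step d a b) * mono_of (step_wt e a b)"
proof -
  have "msum K [(d, e)] a b = (\<Sum>k | k \<in> K \<and> step d a k. if k = b then mono_of (step_wt e a b) else 0)"
    by (auto intro: sum.cong)
  also have "\<dots> = (if b \<in> {k. k \<in> K \<and> step d a k} then mono_of (step_wt e a b) else 0)"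
    using assms(1) by (intro sum.delta) simp
  finally show ?thesis using assms(2) by simp
qed

lemma step_wt_flip: "step_wt (- e) a b = step_wt e b a"
  by (simp add: step_wt_def algebra_simps)

text \<open>Transposing the matrix product reverses the word and turns up steps into down steps. The
  decrease of the size changes sign, and so do the labels.\<close>

lemma msum_transpose:
  assumes K: "finite K"
  shows "a \<in> K \<Longrightarrow> b \<in> K \<Longrightarrow> msum K w a b = msum K (map (\<lambda>(d, e). (\<not> d, - e)) (rev w)) b a"
proof (induction w arbitrary: a)
  case Nil
  then show ?case by auto
next
  case (Cons x w)
  obtain d e where x: "x = (d, e)" by fastforce
  let ?T = "\<lambda>w. map (\<lambda>(d, e). (\<not> d, - e)) (rev w)"
  have "msum K (?T (x # w)) b a = (\<Sum>k\<in>K. msum K (?T w) b k * msum K [(\<not> d, - e)] k a)"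
    using msum_append[OF K \<open>a \<in> K\<close> \<open>b \<in> K\<close>, of "?T w" "[(\<not> d, - e)]"] by (simp add: x)
  also have "\<dots> = (\<Sum>k\<in>K. msum K w k b * (of_bool (step d a k) * mono_of (step_wt e a k)))"
  proof (rule sum.cong)
    fix k assume "k \<in> K"
    then show "msum K (?T w) b k * msum K [(\<not> d, - e)] k a =
        msum K w k b * (of_bool (step d a k) * mono_of (step_wt e a k))"
      using Cons.IH[of k] Cons.prems unfolding msum_single[OF K \<open>a \<in> K\<close>] step_wt_flip
      by (simp add: step_def)
  qed simp
  also have "\<dots> = (\<Sum>k\<in>K. if step d a k then mono_of (step_wt e a k) * msum K w k b else 0)"
    by (rule sum.cong) auto
  also have "\<dots> = msum K (x # w) a b"
    using K by (simp add: x sum.inter_filter)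
  finally show ?case by simp
qed

lemma sum_paths:
  assumes K: "finite K"
  shows "finite {p \<in> paths w a b. set p \<subseteq> K} \<and>
    (\<Sum>p | p \<in> paths w a b \<and> set p \<subseteq> K. mono_of (path_wt w a p)) = msum K w a b"
proof (induction w arbitrary: a)
  case Nil
  have "{p \<in> paths [] a b. set p \<subseteq> K} = (if a = b then {[]} else {})" by auto
  then show ?case by simp
next
  case (Cons x w)
  obtain d e where x: "x = (d, e)" by fastforce
  let ?P = "\<lambda>k. {p \<in> paths w k b. set p \<subseteq> K}" and ?S = "{k. k \<in> K \<and> step d a k}"
  have eq: "{p \<in> paths (x # w) a b. set p \<subseteq> K} = (\<Union>k\<in>?S. (#) k ` ?P k)"
    by (auto simp: x)
  have fin: "finite ?S" "\<And>k. finite (?P k)" using K Cons by auto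
  have "(\<Sum>p | p \<in> paths (x # w) a b \<and> set p \<subseteq> K. mono_of (path_wt (x # w) a p)) =
      (\<Sum>k\<in>?S. \<Sum>p\<in>(#) k ` ?P k. mono_of (path_wt (x # w) a p))"
    unfolding eq using fin by (subst sum.UNION_disjoint) auto
  also have "\<dots> = (\<Sum>k\<in>?S. mono_of (step_wt e a k) * (\<Sum>p\<in>?P k. mono_of (path_wt w k p)))"
  proof (rule sum.cong)
    fix k
    have "(\<Sum>p\<in>(#) k ` ?P k. mono_of (path_wt (x # w) a p)) = (\<Sum>p\<in>?P k. mono_of (path_wt (x # w) a (k # p)))"
      by (subst sum.reindex) auto
    also have "\<dots> = mono_of (step_wt e a k) * (\<Sum>p\<in>?P k. mono_of (path_wt w k p))"
      by (simp add: x mono_of_add sum_distrib_left)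
    finally show "(\<Sum>p\<in>(#) k ` ?P k. mono_of (path_wt (x # w) a p)) =
        mono_of (step_wt e a k) * (\<Sum>p\<in>?P k. mono_of (path_wt w k p))" .
  qed simp
  also have "\<dots> = msum K (x # w) a b" using Cons by (simp add: x)
  finally show ?case using fin eq by simp
qed

fun dsum :: "expo list \<Rightarrow> (nat \<Rightarrow> nat) \<Rightarrow> (nat \<Rightarrow> nat) \<Rightarrow> laurent" where
  "dsum [] a b = of_bool (a = b)"
| "dsum (e # es) a b = (\<Sum>k | interlaced a k. mono_of (step_wt e a k) * dsum es k b)"

lemma msum_down:
  assumes K: "\<And>a b. a \<in> K \<Longrightarrow> interlaced a b \<Longrightarrow> b \<in> K"
  shows "a \<in> K \<Longrightarrow> msum K (map (Pair True) es) a b = dsum es a b"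
proof (induction es arbitrary: a)
  case (Cons e es)
  have "{k. k \<in> K \<and> interlaced a k} = {k. interlaced a k}" using K Cons.prems by blast
  then show ?case using Cons K by (simp add: step_def)
qed simp

lemma paths_up_le: "p \<in> paths (map (Pair False) es) a b \<Longrightarrow> k \<in> insert a (set p) \<Longrightarrow> k m \<le> b m"
proof (induction es arbitrary: a p k)
  case (Cons e es)
  then obtain l p' where p: "p = l # p'" "interlaced l a" "p' \<in> paths (map (Pair False) es) l b"
    by (auto simp: step_def)
  have "l m \<le> b m" "k m \<le> b m \<or> k = a" using Cons.IH[OF p(3)] Cons.prems(2) p(1) by auto
  moreover have "a m \<le> l m" using p(2) by (simp add: interlaced_def)
  ultimately show ?case by auto
qed (auto split: if_splits)

text \<open>A descent stays below its start and an ascent below its end, so the paths of a sorted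
  word live in a finite set of sequences.\<close>

lemma paths_down_up_le:
  "p \<in> paths (map (Pair True) ds @ map (Pair False) us) a b \<Longrightarrow> k \<in> set p \<Longrightarrow> k m \<le> max (a m) (b m)"
proof (induction ds arbitrary: a p)
  case Nil
  then have "k m \<le> b m" using paths_up_le[of p us a b k] by simp
  then show ?case by simp
next
  case (Cons e es)
  then obtain l p' where p: "p = l # p'" "interlaced a l"
    "p' \<in> paths (map (Pair True) es @ map (Pair False) us) l b"
    by (auto simp: step_def)
  have la: "l m \<le> a m" using p(2) by (simp add: interlaced_def)
  show ?case
  proof (cases "k = l")
    case False
    then have "k m \<le> max (l m) (b m)" using Cons.IH[OF p(3)] Cons.prems p(1) by auto
    then show ?thesis using la by linarith
  qed (use la in simp)
qed

text \<open>The path is cut at its lowest sequence k. Transposition turns the ascent from k to b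
  into a descent from b to k, and both halves become sums of the same kind.\<close>

lemma sum_down_up_paths:
  fixes ds us :: "expo list"
  assumes a: "fin_supp a" and b: "fin_supp b"
  defines "w \<equiv> map (Pair True) ds @ map (Pair False) us"
  shows "finite (paths w a b)"
    and "(\<Sum>p\<in>paths w a b. mono_of (path_wt w a p)) =
      (\<Sum>k | \<forall>m. k m \<le> max (a m) (b m). dsum ds a k * dsum (rev (map uminus us)) b k)"
proof -
  define K where "K = {k. \<forall>m. k m \<le> max (a m) (b m)}"
  have "fin_supp (\<lambda>m. max (a m) (b m))"
    using a b unfolding fin_supp_def by (metis max.idem max.bounded_iff nat_le_linear)
  then have K: "finite K" unfolding K_def by (rule finite_below)
  have mem: "a \<in> K" "b \<in> K" by (auto simp: K_def)
  have Kdown: "l \<in> K" if "k \<in> K" "interlaced k l" for k l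
    using that order_trans unfolding K_def interlaced_def by blast
  have eq: "{p \<in> paths w a b. set p \<subseteq> K} = paths w a b"
    unfolding w_def K_def using paths_down_up_le by auto
  show "finite (paths w a b)" using sum_paths[OF K, of w a b] eq by simp
  have "(\<Sum>p\<in>paths w a b. mono_of (path_wt w a p)) = msum K w a b"
    using sum_paths[OF K, of w a b] eq by simp
  also have "\<dots> = (\<Sum>k\<in>K. msum K (map (Pair True) ds) a k * msum K (map (Pair False) us) k b)"
    unfolding w_def by (rule msum_append) (use K mem in auto)
  also have "\<dots> = (\<Sum>k\<in>K. dsum ds a k * dsum (rev (map uminus us)) b k)"
  proof (rule sum.cong)
    fix k assume "k \<in> K"
    have "msum K (map (Pair False) us) k b = msum K (map (Pair True) (rev (map uminus us))) b k"
      using msum_transpose[OF K \<open>k \<in> K\<close> mem(2), of "map (Pair False) us"] by (simp add: rev_map comp_def)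
    then show "msum K (map (Pair True) ds) a k * msum K (map (Pair False) us) k b =
        dsum ds a k * dsum (rev (map uminus us)) b k"
      using msum_down[OF Kdown mem(1), where es = ds and b = k]
        msum_down[OF Kdown mem(2), where es = "rev (map uminus us)" and b = k]
      by simp
  qed simp
  finally show "(\<Sum>p\<in>paths w a b. mono_of (path_wt w a p)) =
      (\<Sum>k | \<forall>m. k m \<le> max (a m) (b m). dsum ds a k * dsum (rev (map uminus us)) b k)"
    by (simp add: K_def)
qed

section \<open>The Bender-Knuth involution and the symmetry in the variables\<close>

definition bender_knuth :: "(nat \<Rightarrow> nat) \<Rightarrow> (nat \<Rightarrow> nat) \<Rightarrow> (nat \<Rightarrow> nat) \<Rightarrow> nat \<Rightarrow> nat" where
  "bender_knuth a b k m =
     max (b m) (a (Suc m)) + (case m of 0 \<Rightarrow> a 0 | Suc l \<Rightarrow> min (a m) (b l)) - k m"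

text \<open>The entries of a sequence between a and b range over independent intervals. The
  involution reflects each of them.\<close>

lemma between_iff:
  "interlaced a k \<and> interlaced k b \<longleftrightarrow>
     (\<forall>m. max (b m) (a (Suc m)) \<le> k m \<and> k m \<le> (case m of 0 \<Rightarrow> a 0 | Suc l \<Rightarrow> min (a m) (b l)))"
  (is "?L \<longleftrightarrow> ?R")
proof
  assume R: ?R
  have "k m \<le> a m" for m using R[rule_format, of m] by (cases m) auto
  moreover have "k (Suc m) \<le> b m" for m using R[rule_format, of "Suc m"] by auto
  ultimately show ?L using R by (auto simp: interlaced_def)
qed (auto simp: interlaced_def split: nat.split)

lemma bender_knuth_between:
  assumes "interlaced a k" "interlaced k b"
  shows "interlaced a (bender_knuth a b k)" "interlaced (bender_knuth a b k) b"
    "bender_knuth a b (bender_knuth a b k) = k"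
proof -
  have R: "max (b m) (a (Suc m)) \<le> k m" "k m \<le> (case m of 0 \<Rightarrow> a 0 | Suc l \<Rightarrow> min (a m) (b l))" for m
    using assms between_iff[of a k b] by blast+
  have "max (b m) (a (Suc m)) \<le> bender_knuth a b k m \<and>
      bender_knuth a b k m \<le> (case m of 0 \<Rightarrow> a 0 | Suc l \<Rightarrow> min (a m) (b l))" for m
    using R[of m] unfolding bender_knuth_def by linarith
  then show "interlaced a (bender_knuth a b k)" "interlaced (bender_knuth a b k) b"
    using between_iff[of a _ b] by blast+
  show "bender_knuth a b (bender_knuth a b k) = k"
  proof
    fix m show "bender_knuth a b (bender_knuth a b k) m = k m"
      using R[of m] unfolding bender_knuth_def by linarith
  qed
qed

text \<open>An entry and its reflection add up to the ends of the interval, and the minimum at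
  \<open>Suc m\<close> combines with the maximum at m. It follows that the involution exchanges the
  sizes of the strips from a to k and from k to b.\<close>

lemma psize_bender_knuth:
  assumes k: "interlaced a k" "interlaced k b" and a: "fin_supp a"
  shows "psize k + psize (bender_knuth a b k) = psize a + psize b"
proof -
  let ?t = "bender_knuth a b k" and ?u = "\<lambda>m. case m of 0 \<Rightarrow> a 0 | Suc l \<Rightarrow> min (a m) (b l)"
  obtain N where a0: "\<And>m. m \<ge> N \<Longrightarrow> a m = 0" using a unfolding fin_supp_def by metis
  have k0: "\<And>m. m \<ge> N \<Longrightarrow> k m = 0" and b0: "\<And>m. m \<ge> N \<Longrightarrow> b m = 0" and t0: "\<And>m. m \<ge> N \<Longrightarrow> ?t m = 0"
    using k a0 bender_knuth_between(1)[OF k] by (metis interlaced_def le_zero_eq)+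
  have sum: "?t m + k m = max (b m) (a (Suc m)) + ?u m" for m
  proof -
    have "k m \<le> ?u m" using k between_iff[of a k b] by blast
    then show ?thesis unfolding bender_knuth_def by linarith
  qed
  have "psize k + psize ?t = (\<Sum>m<Suc N. ?t m + k m)"
    using psize_eq[of "Suc N" k] psize_eq[of "Suc N" ?t] k0 t0 by (simp add: sum.distrib)
  also have "\<dots> = (\<Sum>m<N. max (b m) (a (Suc m))) + (\<Sum>m<Suc N. ?u m)"
    unfolding sum using b0[of N] a0[of "Suc N"] by (simp add: sum.distrib)
  also have "\<dots> = a 0 + (\<Sum>m<N. max (b m) (a (Suc m)) + min (a (Suc m)) (b m))"
    by (simp add: sum.lessThan_Suc_shift sum.distrib del: sum.lessThan_Suc)
  also have "\<dots> = a 0 + (\<Sum>m<N. b m + a (Suc m))"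
  proof -
    have "max (b m) (a (Suc m)) + min (a (Suc m)) (b m) = b m + a (Suc m)" for m by linarith
    then show ?thesis by simp
  qed
  also have "\<dots> = (\<Sum>m<N. b m) + (\<Sum>m<Suc N. a m)"
    by (simp add: sum.lessThan_Suc_shift sum.distrib del: sum.lessThan_Suc)
  also have "\<dots> = psize a + psize b"
    using psize_eq[of "Suc N" a] psize_eq[of N b] a0 b0 by simp
  finally show ?thesis .
qed

text \<open>Symmetry of a skew Schur polynomial in two adjacent variables. Interchanging the sums
  fixes the outer sequences a and l, so that the involution acts on the middle one alone.\<close>

lemma dsum_swap:
  assumes a: "fin_supp a"
  shows "dsum (e # f # es) a b = dsum (f # e # es) a b"
proof -
  let ?L = "{l. \<forall>m. l m \<le> a m}" and ?M = "\<lambda>l. {k. interlaced a k \<and> interlaced k l}"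
  have fin: "finite {k. interlaced a k}" "finite ?L"
    using a finite_interlaced finite_below by blast+
  have expand: "dsum (e # f # es) a b =
      (\<Sum>l\<in>?L. (\<Sum>k\<in>?M l. mono_of (step_wt e a k + step_wt f k l)) * dsum es l b)" for e f
  proof -
    have "dsum (e # f # es) a b = (\<Sum>k | interlaced a k. \<Sum>l | l \<in> ?L \<and> interlaced k l.
        mono_of (step_wt e a k + step_wt f k l) * dsum es l b)"
    proof (simp add: sum_distrib_left mono_of_add mult.assoc, rule sum.cong)
      fix k assume "k \<in> {k. interlaced a k}"
      then have "{l. interlaced k l} = {l. (\<forall>m. l m \<le> a m) \<and> interlaced k l}"
        by (auto simp: interlaced_def intro: order_trans)
      then show "(\<Sum>l | interlaced k l. mono_of (step_wt e a k) * (mono_of (step_wt f k l) * dsum es l b)) =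
        (\<Sum>l | (\<forall>m. l m \<le> a m) \<and> interlaced k l. mono_of (step_wt e a k) * (mono_of (step_wt f k l) * dsum es l b))"
        by simp
    qed simp
    also have "\<dots> = (\<Sum>l\<in>?L. \<Sum>k | k \<in> {k. interlaced a k} \<and> interlaced k l.
        mono_of (step_wt e a k + step_wt f k l) * dsum es l b)"
      by (rule sum.swap_restrict[OF fin])
    finally show ?thesis by (simp add: sum_distrib_right)
  qed
  have "(\<Sum>k\<in>?M l. mono_of (step_wt e a k + step_wt f k l)) =
      (\<Sum>k\<in>?M l. mono_of (step_wt f a k + step_wt e k l))" for l
  proof (rule sum.reindex_bij_witness[of _ "bender_knuth a l" "bender_knuth a l"])
    fix k assume "k \<in> ?M l"
    then have k: "interlaced a k" "interlaced k l" by auto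
    have "int (psize k) = int (psize a) + int (psize l) - int (psize (bender_knuth a l k))"
      using psize_bender_knuth[OF k a] by linarith
    then show "mono_of (step_wt f a (bender_knuth a l k) + step_wt e (bender_knuth a l k) l) =
        mono_of (step_wt e a k + step_wt f k l)"
      unfolding step_wt_def by (simp only:) (simp add: algebra_simps)
  qed (auto simp: bender_knuth_between)
  then show ?thesis unfolding expand by simp
qed

text \<open>A descent removes the boxes with the largest tableau entry first, whereas the boundary
  edges supply the labels by increasing index; adjacent swaps reconcile the two orders.\<close>

lemma dsum_rev:
  assumes "fin_supp a"
  shows "dsum (rev es) a b = dsum es a b"
proof -
  have move: "dsum (es @ [e]) a b = dsum (e # es) a b" if "fin_supp a" for es e a
    using that
  proof (induction es arbitrary: a)
    case (Cons f es)
    then have "dsum ((f # es) @ [e]) a b = dsum (f # e # es) a b"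
      using interlaced_fin_supp by (auto intro!: sum.cong)
    then show ?case using dsum_swap[OF Cons.prems] by metis
  qed simp
  show ?thesis using assms
  proof (induction es arbitrary: a)
    case (Cons e es)
    have "dsum (rev (e # es)) a b = dsum (e # rev es) a b" using move Cons.prems by simp
    also have "\<dots> = dsum (e # es) a b"
      using Cons interlaced_fin_supp by (auto intro!: sum.cong)
    finally show ?case .
  qed simp
qed

section \<open>Partitions as sequences and as diagrams\<close>

definition shape :: "(nat \<Rightarrow> nat) \<Rightarrow> diagram" where
  "shape a = {(i, j). i < a j}"

lemma mem_shape [simp]: "(i, j) \<in> shape a \<longleftrightarrow> i < a j"
  by (simp add: shape_def)

lemma shape_subset_iff: "shape a \<subseteq> shape b \<longleftrightarrow> (\<forall>j. a j \<le> b j)"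
proof
  assume "shape a \<subseteq> shape b"
  then have "i < a j \<Longrightarrow> i < b j" for i j by (auto simp: shape_def)
  then have "a j \<le> b j" for j by (cases "b j < a j") (blast, simp)
  then show "\<forall>j. a j \<le> b j" by blast
qed (auto simp: shape_def intro: less_le_trans)

lemma mem_partition_iff:
  assumes "is_partition \<alpha>"
  shows "(i, j) \<in> \<alpha> \<longleftrightarrow> i < part \<alpha> j"
proof -
  have fin: "finite ((\<lambda>i. (i, j)) -` \<alpha>)"
    using assms by (intro finite_vimageI) (auto simp: is_partition_def inj_on_def)
  then obtain m where "m \<notin> (\<lambda>i. (i, j)) -` \<alpha>" using ex_new_if_finite infinite_UNIV_nat by blast
  then have L: "(part \<alpha> j, j) \<notin> \<alpha>" unfolding part_def by (intro LeastI[where P = "\<lambda>i. (i, j) \<notin> \<alpha>" and k = m]) simp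
  show ?thesis
  proof
    assume "(i, j) \<in> \<alpha>"
    then show "i < part \<alpha> j" using L assms unfolding is_partition_def by (metis le_refl not_less)
  next
    assume "i < part \<alpha> j"
    then show "(i, j) \<in> \<alpha>" using not_less_Least[of i "\<lambda>i. (i, j) \<notin> \<alpha>"] unfolding part_def by blast
  qed
qed

lemma shape_part: "is_partition \<alpha> \<Longrightarrow> shape (part \<alpha>) = \<alpha>"
  by (auto simp: mem_partition_iff)

lemma part_shape [simp]: "part (shape a) = a"
proof
  fix j show "part (shape a) j = a j" unfolding part_def by (rule Least_equality) auto
qed

lemma decseq_part: "is_partition \<alpha> \<Longrightarrow> decseq (part \<alpha>)"
proof (rule decseq_SucI)
  fix j assume a: "is_partition \<alpha>"
  have "(i, j) \<in> \<alpha>" if "(i, Suc j) \<in> \<alpha>" for i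
    using a that unfolding is_partition_def by (meson le_refl Suc_n_not_le_n nat_le_linear)
  then show "part \<alpha> (Suc j) \<le> part \<alpha> j" using mem_partition_iff[OF a] by (metis less_irrefl not_le)
qed

lemma fin_supp_part: 
  assumes "is_partition \<alpha>"
  shows "fin_supp (part \<alpha>)"
proof -
  have "finite (snd ` \<alpha>)" using assms by (simp add: is_partition_def)
  then obtain K where K: "\<And>j. j \<in> snd ` \<alpha> \<Longrightarrow> j < K" by (auto simp: finite_nat_iff_bounded)
  have "part \<alpha> j = 0" if "j \<ge> K" for j
  proof (rule ccontr)
    assume "part \<alpha> j \<noteq> 0"
    then have "(0, j) \<in> \<alpha>" using mem_partition_iff[OF assms] by simp
    then show False using K[of j] that by force
  qed
  then show ?thesis by (auto simp: fin_supp_def)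
qed

lemma finite_shape: "fin_supp a \<Longrightarrow> finite (shape a)"
  and card_shape: "fin_supp a \<Longrightarrow> card (shape a) = psize a"
proof -
  assume "fin_supp a"
  then obtain K where K: "\<And>m. m \<ge> K \<Longrightarrow> a m = 0" by (auto simp: fin_supp_def)
  have eq: "shape a = (\<Union>j<K. (\<lambda>i. (i, j)) ` {..<a j})"
  proof (intro set_eqI iffI)
    fix b assume "b \<in> shape a"
    then obtain i j where b: "b = (i, j)" "i < a j" by (auto simp: shape_def)
    then have "j < K" using K[of j] by (cases "j < K") auto
    then show "b \<in> (\<Union>j<K. (\<lambda>i. (i, j)) ` {..<a j})" using b by auto
  qed auto
  show "finite (shape a)" unfolding eq by auto
  have "card (shape a) = (\<Sum>j<K. card ((\<lambda>i. (i, j)) ` {..<a j}))"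
    unfolding eq by (rule card_UN_disjoint) auto
  also have "\<dots> = psize a" using psize_eq[OF K] by (simp add: card_image inj_on_def)
  finally show "card (shape a) = psize a" .
qed

lemma is_partition_shape: "decseq a \<Longrightarrow> fin_supp a \<Longrightarrow> is_partition (shape a)"
  unfolding is_partition_def using finite_shape by (auto simp: decseq_def) (meson le_less_trans less_le_trans)

lemma card_partition: "is_partition \<alpha> \<Longrightarrow> card \<alpha> = psize (part \<alpha>)"
  using card_shape[OF fin_supp_part] shape_part by metis

lemma is_partition_conjugate: "is_partition \<alpha> \<Longrightarrow> is_partition (conjugate \<alpha>)"
proof -
  assume a: "is_partition \<alpha>"
  have "conjugate \<alpha> = prod.swap ` \<alpha>" by (auto simp: conjugate_def)
  then show ?thesis using a by (auto simp: is_partition_def)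
qed

lemma mem_conjugate [simp]: "(i, j) \<in> conjugate \<alpha> \<longleftrightarrow> (j, i) \<in> \<alpha>"
  by (simp add: conjugate_def)

lemma part_conjugate_iff: "is_partition \<alpha> \<Longrightarrow> j < part (conjugate \<alpha>) i \<longleftrightarrow> i < part \<alpha> j"
  using mem_partition_iff[of \<alpha> i j] mem_partition_iff[OF is_partition_conjugate, of \<alpha> j i] by simp

lemma subset_partition_iff:
  "is_partition \<alpha> \<Longrightarrow> is_partition \<beta> \<Longrightarrow> \<alpha> \<subseteq> \<beta> \<longleftrightarrow> (\<forall>j. part \<alpha> j \<le> part \<beta> j)"
  using shape_subset_iff[of "part \<alpha>" "part \<beta>"] by (simp add: shape_part)

section \<open>Semistandard tableaux as paths\<close>

definition tableaux :: "nat \<Rightarrow> diagram \<Rightarrow> (nat \<times> nat \<Rightarrow> nat) set" where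
  "tableaux m D = {T. semistandard D T \<and> (\<forall>b\<in>D. T b < m)}"

lemma finite_tableaux:
  assumes "finite D"
  shows "finite (tableaux m D)"
proof (rule finite_subset)
  show "tableaux m D \<subseteq> PiE D (\<lambda>_. {..<m})"
    by (auto simp: tableaux_def semistandard_def PiE_def)
  show "finite (PiE D (\<lambda>_. {..<m}))" using assms by (intro finite_PiE) auto
qed

definition add_strip :: "nat \<Rightarrow> (nat \<Rightarrow> nat) \<Rightarrow> (nat \<Rightarrow> nat) \<Rightarrow> (nat \<Rightarrow> nat) \<Rightarrow>
    (nat \<times> nat \<Rightarrow> nat) \<Rightarrow> nat \<times> nat \<Rightarrow> nat" where
  "add_strip m a h k T = restrict (\<lambda>b. if b \<in> shape k then T b else m) (shape a - shape h)"

definition small_part :: "nat \<Rightarrow> (nat \<Rightarrow> nat) \<Rightarrow> (nat \<Rightarrow> nat) \<Rightarrow> (nat \<times> nat \<Rightarrow> nat) \<Rightarrow> nat \<Rightarrow> nat" where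
  "small_part m a h T = part (shape h \<union> {b \<in> shape a - shape h. T b < m})"

text \<open>The boxes with the new largest entry m fill the strip between k and a. Interlacing says
  that no two of them share a first coordinate, which is what strict increase in j requires.\<close>

lemma add_strip_tableau:
  assumes ak: "interlaced a k" and hk: "\<forall>j. h j \<le> k j" and T: "T \<in> tableaux m (shape k - shape h)"
  shows "add_strip m a h k T \<in> tableaux (Suc m) (shape a - shape h)"
    and "small_part m a h (add_strip m a h k T) = k"
    and "restrict (add_strip m a h k T) (shape k - shape h) = T"
proof -
  let ?T = "add_strip m a h k T"
  have ka: "k j \<le> a j" "a (Suc j) \<le> k j" for j using ak by (auto simp: interlaced_def)
  have dec: "decseq k" using ka by (intro decseq_SucI) (meson order_trans)
  have Tlt: "T (i, j) < m" if "i < k j" "\<not> i < h j" for i j using T that by (auto simp: tableaux_def)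
  have Trow: "T (i, j) \<le> T (i', j)" if "i < i'" "i' < k j" "\<not> i < h j" for i i' j
    using T that by (auto simp: tableaux_def semistandard_def)
  have Tcol: "T (i, j) < T (i, j')" if "j < j'" "i < k j" "i < k j'" "\<not> i < h j" "\<not> i < h j'" for i j j'
    using T that by (auto simp: tableaux_def semistandard_def)
  have val: "?T (i, j) = (if i < k j then T (i, j) else m)" if "i < a j" "\<not> i < h j" for i j
    using that by (simp add: add_strip_def)
  show "?T \<in> tableaux (Suc m) (shape a - shape h)"
    unfolding tableaux_def semistandard_def
  proof (intro CollectI conjI allI impI ballI)
    show "?T \<in> extensional (shape a - shape h)" by (simp add: add_strip_def)
    show "?T b < Suc m" if "b \<in> shape a - shape h" for b
      using that Tlt by (cases b) (auto simp: val less_SucI)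
    show "?T (i, j) \<le> ?T (i', j)" if "(i, j) \<in> shape a - shape h" "(i', j) \<in> shape a - shape h" "i < i'" for i i' j
      using that Tlt[of i j] Trow[of i i' j] by (auto simp: val intro: less_imp_le)
    show "?T (i, j) < ?T (i, j')" if "(i, j) \<in> shape a - shape h" "(i, j') \<in> shape a - shape h" "j < j'" for i j j'
    proof -
      have "Suc j \<le> j'" using that(3) by simp
      \<comment> \<open>A box of a in a later row than j lies beyond a box of k in row j, by
        \<open>a (Suc l) \<le> k l\<close> and monotonicity of k. The entry in row j is therefore an
        old one, below m.\<close>
      have "i < k j"
      proof (cases "j' = Suc j")
        case True
        then show ?thesis using that(2) ka(2)[of j] by simp
      next
        case False
        then obtain l where l: "j' = Suc l" "j \<le> l" using \<open>Suc j \<le> j'\<close> by (cases j') auto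
        then show ?thesis using that(2) ka(2)[of l] decseqD[OF dec l(2)] by simp
      qed
      then show ?thesis using that Tcol[of j j' i] Tlt[of i j] by (auto simp: val)
    qed
  qed
  have "shape h \<union> {b \<in> shape a - shape h. ?T b < m} = shape k"
  proof (intro set_eqI)
    fix b :: "nat \<times> nat" obtain i j where b: "b = (i, j)" by fastforce
    show "b \<in> shape h \<union> {b \<in> shape a - shape h. ?T b < m} \<longleftrightarrow> b \<in> shape k"
      using ka(1)[of j] hk[rule_format, of j] Tlt[of i j] by (auto simp: b val split: if_splits)
  qed
  then show "small_part m a h ?T = k" by (simp add: small_part_def)
  show "restrict ?T (shape k - shape h) = T"
  proof
    fix b :: "nat \<times> nat" obtain i j where b: "b = (i, j)" by fastforce
    have "T \<in> extensional (shape k - shape h)" using T by (auto simp: tableaux_def semistandard_def)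
    then show "restrict ?T (shape k - shape h) b = T b"
      using ka(1)[of j] by (auto simp: b val restrict_def extensional_def)
  qed
qed

lemma small_part_tableau:
  assumes a: "decseq a" and h: "decseq h" "\<forall>j. h j \<le> a j"
    and T: "T \<in> tableaux (Suc m) (shape a - shape h)"
  defines "k \<equiv> small_part m a h T"
  shows "interlaced a k" "\<forall>j. h j \<le> k j" "restrict T (shape k - shape h) \<in> tableaux m (shape k - shape h)"
    and "add_strip m a h k (restrict T (shape k - shape h)) = T"
proof -
  let ?S = "shape h \<union> {b \<in> shape a - shape h. T b < m}"
  have Tlt: "T (i, j) < Suc m" if "i < a j" "\<not> i < h j" for i j using T that by (auto simp: tableaux_def)
  have Trow: "T (i, j) \<le> T (i', j)" if "i < i'" "i' < a j" "\<not> i < h j" for i i' j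
    using T that by (auto simp: tableaux_def semistandard_def)
  have Tcol: "T (i, j) < T (i, j')" if "j < j'" "i < a j" "i < a j'" "\<not> i < h j" "\<not> i < h j'" for i j j'
    using T that by (auto simp: tableaux_def semistandard_def)
  have down: "(i', j) \<in> ?S" if "(i, j) \<in> ?S" "i' \<le> i" for i i' j
  proof (cases "i' < h j \<or> i' = i")
    case False
    then show ?thesis using that Trow[of i' i j] by auto
  qed (use that in auto)
  \<comment> \<open>Rows increase weakly, so the boxes with entries below m, together with h, form
    an initial segment of each row, and \<open>part\<close> recovers its length.\<close>
  have S: "shape k = ?S"
  proof -
    have iff: "(i, j) \<in> ?S \<longleftrightarrow> i < part ?S j" for i j
    proof -
      have "(a j, j) \<notin> ?S" using h(2)[rule_format, of j] by auto
      then have L: "(part ?S j, j) \<notin> ?S" unfolding part_def by (rule LeastI)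
      show ?thesis using down[of i j "part ?S j"] L not_less_Least[of i "\<lambda>i. (i, j) \<notin> ?S"]
        unfolding part_def[symmetric] by (meson not_le)
    qed
    show ?thesis
    proof (intro set_eqI)
      fix b :: "nat \<times> nat" obtain i j where b: "b = (i, j)" by fastforce
      show "b \<in> shape k \<longleftrightarrow> b \<in> ?S" by (simp only: b mem_shape k_def small_part_def iff)
    qed
  qed
  then have mem: "i < k j \<longleftrightarrow> i < h j \<or> (i < a j \<and> T (i, j) < m)" for i j
  proof -
    have "i < k j \<longleftrightarrow> (i, j) \<in> ?S" unfolding S[symmetric] by simp
    then show ?thesis by auto
  qed
  show hk: "\<forall>j. h j \<le> k j" using mem by (meson not_le less_irrefl)
  have ka: "k j \<le> a j" for j using mem[of _ j] h(2)[rule_format, of j] by (meson less_le_trans not_le less_irrefl)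
  \<comment> \<open>Otherwise the box \<open>(k j, j)\<close> would hold an entry of at least m, and
    the box after it in row \<open>Suc j\<close> a larger one, although all entries are at most
    m.\<close>
  moreover have "a (Suc j) \<le> k j" for j
  proof (rule ccontr)
    assume "\<not> a (Suc j) \<le> k j"
    then have lt: "k j < a (Suc j)" by simp
    have "\<not> k j < k j" by simp
    then have n: "\<not> k j < h j" "k j < a j \<Longrightarrow> m \<le> T (k j, j)" using mem[of "k j" j] by auto
    have aj: "k j < a j" using lt decseq_SucD[OF a, of j] by linarith
    have n': "\<not> k j < h (Suc j)" using n(1) decseq_SucD[OF h(1), of j] by linarith
    have "T (k j, j) < T (k j, Suc j)" using Tcol[of j "Suc j" "k j"] lt aj n(1) n' by simp
    moreover have "T (k j, Suc j) \<le> m" using Tlt[OF lt n'] by simp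
    ultimately show False using n(2)[OF aj] by simp
  qed
  ultimately show "interlaced a k" by (simp add: interlaced_def)
  show "restrict T (shape k - shape h) \<in> tableaux m (shape k - shape h)"
    unfolding tableaux_def semistandard_def
    using Trow Tcol mem less_le_trans[OF _ ka] by auto
  show "add_strip m a h k (restrict T (shape k - shape h)) = T"
  proof
    fix b :: "nat \<times> nat" obtain i j where b: "b = (i, j)" by fastforce
    have "T \<in> extensional (shape a - shape h)" using T by (auto simp: tableaux_def semistandard_def)
    then show "add_strip m a h k (restrict T (shape k - shape h)) b = T b"
      using mem[of i j] Tlt[of i j] by (auto simp: b add_strip_def extensional_def restrict_def)
  qed
qed

text \<open>Induction on the number of variables: the first step of the descent splits off the strip
  of boxes with the largest entry. Therefore the labels appear in decreasing order.\<close>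

lemma dsum_eq_sum_tableaux:
  assumes "decseq h"
  shows "decseq a \<Longrightarrow> fin_supp a \<Longrightarrow> dsum (rev (map y [0..<m])) a h =
    (if \<forall>j. h j \<le> a j then \<Sum>T\<in>tableaux m (shape a - shape h). \<Prod>b\<in>shape a - shape h. mono_of (y (T b)) else 0)"
proof (induction m arbitrary: a)
  case 0
  show ?case
  proof (cases "\<forall>j. h j \<le> a j")
    case True
    show ?thesis
    proof (cases "a = h")
      case True
      \<comment> \<open>Extensionality leaves exactly one tableau on the empty diagram.\<close>
      have "tableaux 0 {} = {\<lambda>_. undefined}" by (auto simp: tableaux_def semistandard_def)
      then show ?thesis using True by simp
    next
      case False
      then obtain j where "a j \<noteq> h j" by (auto simp: fun_eq_iff)
      then have "h j < a j" using True[rule_format, of j] by simp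
      then have "(h j, j) \<in> shape a - shape h" by simp
      then have "tableaux 0 (shape a - shape h) = {}" by (auto simp: tableaux_def)
      then show ?thesis using False by simp
    qed
  qed auto
next
  case (Suc m)
  have fs: "finite (shape a)" using Suc.prems finite_shape by blast
  have *: "decseq k \<and> fin_supp k \<and> finite (shape k) \<and> psize k \<le> psize a \<and> shape k \<subseteq> shape a" if "interlaced a k" for k
  proof -
    have "decseq k" using that unfolding interlaced_def by (intro decseq_SucI) (meson order_trans)
    moreover have "fin_supp k" using that Suc.prems interlaced_fin_supp by blast
    moreover have "shape k \<subseteq> shape a" using that by (auto simp: interlaced_def shape_subset_iff)
    ultimately show ?thesis using card_mono[OF fs, of "shape k"] Suc.prems finite_shape by (simp add: card_shape)
  qed
  let ?K = "{k. interlaced a k \<and> (\<forall>j. h j \<le> k j)}" and ?D = "\<lambda>a. shape a - shape h"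
  have finK: "finite {k. interlaced a k}" using Suc.prems finite_interlaced by blast
  have "dsum (rev (map y [0..<Suc m])) a h =
      (\<Sum>k | interlaced a k. mono_of (step_wt (y m) a k) * dsum (rev (map y [0..<m])) k h)" by simp
  also have "\<dots> = (\<Sum>k | interlaced a k. if \<forall>j. h j \<le> k j then mono_of (step_wt (y m) a k) *
      (\<Sum>T\<in>tableaux m (?D k). \<Prod>b\<in>?D k. mono_of (y (T b))) else 0)"
    using Suc.IH * by (intro sum.cong) auto
  also have "\<dots> = (\<Sum>k\<in>?K. mono_of (step_wt (y m) a k) * (\<Sum>T\<in>tableaux m (?D k). \<Prod>b\<in>?D k. mono_of (y (T b))))"
    using sum.inter_filter[OF finK, of "\<lambda>k. mono_of (step_wt (y m) a k) *
      (\<Sum>T\<in>tableaux m (?D k). \<Prod>b\<in>?D k. mono_of (y (T b)))" "\<lambda>k. \<forall>j. h j \<le> k j"] by simp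
  finally have eq: "dsum (rev (map y [0..<Suc m])) a h =
    (\<Sum>k\<in>?K. mono_of (step_wt (y m) a k) * (\<Sum>T\<in>tableaux m (?D k). \<Prod>b\<in>?D k. mono_of (y (T b))))" .
  show ?case
  proof (cases "\<forall>j. h j \<le> a j")
    case False
    then have "?K = {}" by (auto simp: interlaced_def) (meson order_trans)
    then show ?thesis unfolding eq using False by (simp only: sum.empty if_False)
  next
    case True
    have "dsum (rev (map y [0..<Suc m])) a h =
        (\<Sum>(k, T)\<in>Sigma ?K (\<lambda>k. tableaux m (?D k)). mono_of (step_wt (y m) a k) * (\<Prod>b\<in>?D k. mono_of (y (T b))))"
      unfolding eq sum_distrib_left
      by (rule sum.Sigma) (use finK * finite_tableaux in auto)
    also have "\<dots> = (\<Sum>T\<in>tableaux (Suc m) (?D a). \<Prod>b\<in>?D a. mono_of (y (T b)))"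
    proof (rule sum.reindex_bij_witness[where j = "\<lambda>p. add_strip m a h (fst p) (snd p)"
          and i = "\<lambda>T. (small_part m a h T, restrict T (?D (small_part m a h T)))"])
      fix T assume "T \<in> tableaux (Suc m) (?D a)"
      note small = small_part_tableau[OF Suc.prems(1) assms True this]
      show "add_strip m a h (fst (small_part m a h T, restrict T (?D (small_part m a h T))))
          (snd (small_part m a h T, restrict T (?D (small_part m a h T)))) = T"
        using small(4) by simp
      show "(small_part m a h T, restrict T (?D (small_part m a h T))) \<in> Sigma ?K (\<lambda>k. tableaux m (?D k))"
        using small(1-3) by simp
    next
      fix p assume "p \<in> Sigma ?K (\<lambda>k. tableaux m (?D k))"
      then obtain k T where p: "p = (k, T)" and k: "interlaced a k" "\<forall>j. h j \<le> k j"
        and T: "T \<in> tableaux m (?D k)" by blast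
      note strip = add_strip_tableau[OF k T]
      show "(small_part m a h (add_strip m a h (fst p) (snd p)),
          restrict (add_strip m a h (fst p) (snd p)) (?D (small_part m a h (add_strip m a h (fst p) (snd p))))) = p"
        using strip(2,3) by (simp add: p)
      show "add_strip m a h (fst p) (snd p) \<in> tableaux (Suc m) (?D a)" using strip(1) by (simp add: p)
      have sub: "shape h \<subseteq> shape k" "shape k \<subseteq> shape a" using k * by (auto simp: shape_subset_iff)
      have D: "?D a = ?D k \<union> (shape a - shape k)" "?D k \<inter> (shape a - shape k) = {}"
        using sub by auto
      have "(\<Prod>b\<in>?D a. mono_of (y (add_strip m a h k T b))) =
          (\<Prod>b\<in>?D k. mono_of (y (add_strip m a h k T b))) * (\<Prod>b\<in>shape a - shape k. mono_of (y (add_strip m a h k T b)))"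
        unfolding D(1) using fs sub by (intro prod.union_disjoint) (auto intro: finite_subset)
      also have "(\<Prod>b\<in>?D k. mono_of (y (add_strip m a h k T b))) = (\<Prod>b\<in>?D k. mono_of (y (T b)))"
        using sub by (intro prod.cong) (auto simp: add_strip_def)
      also have "(\<Prod>b\<in>shape a - shape k. mono_of (y (add_strip m a h k T b))) = (\<Prod>b\<in>shape a - shape k. mono_of (y m))"
        using sub by (intro prod.cong) (auto simp: add_strip_def)
      also have "\<dots> = mono_of (step_wt (y m) a k)"
        using card_Diff_subset[of "shape k" "shape a"] sub *[OF k(1)] Suc.prems
        by (simp add: step_wt_def mono_of_power card_shape of_nat_diff)
      finally show "(\<Prod>b\<in>?D a. mono_of (y (add_strip m a h (fst p) (snd p) b))) =
          (case p of (k, T) \<Rightarrow> mono_of (step_wt (y m) a k) * (\<Prod>b\<in>?D k. mono_of (y (T b))))"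
        by (simp add: p mult.commute)
    qed
    finally show ?thesis using True by simp
  qed
qed

section \<open>Skew Schur functions in infinitely many variables as limits\<close>

lemma admissible_subset: "admissible n A w \<Longrightarrow> B \<subseteq> A \<Longrightarrow> admissible n B w"
proof -
  assume A: "admissible n A w" and "B \<subseteq> A"
  then have "{b \<in> B. w b = e} \<subseteq> {a \<in> A. w a = e}" for e by blast
  then have "finite {b \<in> B. w b = e}" for e
    using A unfolding admissible_def by (metis (no_types, lifting) finite_subset)
  then show ?thesis using A \<open>B \<subseteq> A\<close> unfolding admissible_def by blast
qed

text \<open>Complements \<open>gf_incseq\<close>: here summability over the union is known and
  convergence of the partial sums is deduced, there it is the reverse.\<close>

lemma bconv_gf_incseq:
  assumes adm: "admissible n (\<Union>N. A N) w" and "incseq A"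
  shows "bconv n (\<lambda>N. gf (A N) w) (gf (\<Union>N. A N) w)"
  unfolding bconv_def
proof (intro conjI allI)
  have admN: "admissible n (A N) w" for N by (rule admissible_subset[OF adm]) auto
  obtain B where "\<forall>a\<in>\<Union>N. A N. bounded_expo n B (w a)" using adm unfolding admissible_def by blast
  then have "bnd n B (gf (A N) w)" for N unfolding bnd_gf[OF admN] by blast
  then show "\<exists>B. \<forall>N. bnd n B (gf (A N) w)" by blast
  fix e
  let ?F = "{a \<in> (\<Union>N. A N). w a = e}"
  have fin: "finite ?F" using adm by (simp add: admissible_def)
  have ev: "\<forall>\<^sub>F N in sequentially. a \<in> A N" if "a \<in> ?F" for a
  proof -
    obtain N where "a \<in> A N" using \<open>a \<in> ?F\<close> by blast
    then have "a \<in> A M" if "M \<ge> N" for M using incseqD[OF \<open>incseq A\<close> that] by blast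
    then show ?thesis by (auto simp: eventually_sequentially)
  qed
  have "\<forall>\<^sub>F N in sequentially. \<forall>a\<in>?F. a \<in> A N"
    by (rule eventually_ball_finite[OF fin]) (intro ballI ev)
  then show "\<forall>\<^sub>F N in sequentially. lcoeff (gf (A N) w) e = lcoeff (gf (\<Union>N. A N) w) e"
  proof eventually_elim
    case (elim N)
    then have "{a \<in> A N. w a = e} = ?F" by auto
    then show ?case by (simp only: lcoeff_gf[OF admN] lcoeff_gf[OF adm])
  qed
qed

text \<open>The degree of \<open>y j\<close> grows with j, so the degree of a monomial bounds every
  entry of its tableau, and only finitely many tableaux share a monomial. Each box may lose c, which
  the multiple of \<open>\<bar>c\<bar>\<close> in the bound makes up for.\<close>

lemma bconv_dsum_skew_schur:
  assumes y: "\<And>j. bounded_expo n B (y j)" "\<And>j. int j - c \<le> deg (y j)"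
    and \<alpha>: "is_partition \<alpha>" and \<eta>: "is_partition \<eta>"
  shows "bconv n (\<lambda>m. dsum (map y [0..<m]) (part \<alpha>) (part \<eta>)) (skew_schur \<alpha> \<eta> (\<lambda>j. mono_of (y j)))"
proof (cases "\<eta> \<subseteq> \<alpha>")
  case False
  then have "dsum (map y [0..<m]) (part \<alpha>) (part \<eta>) = 0" for m
    using dsum_eq_sum_tableaux[OF decseq_part[OF \<eta>] decseq_part[OF \<alpha>] fin_supp_part[OF \<alpha>], of y m]
      False[unfolded subset_partition_iff[OF \<eta> \<alpha>]] dsum_rev[OF fin_supp_part[OF \<alpha>]]
    by (simp only: if_False)
  then show ?thesis using False by (simp add: skew_schur_def bconv_const[OF bnd_0])
next
  case True
  let ?D = "\<alpha> - \<eta>" and ?w = "\<lambda>T. \<Sum>b\<in>\<alpha> - \<eta>. y (T b)"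
  have fin: "finite ?D" using \<alpha> by (simp add: is_partition_def)
  have sum_bd: "bounded_expo n (int (card F) * B) (\<Sum>b\<in>F. y (T b))" if "finite F" for F and T :: "nat \<times> nat \<Rightarrow> nat"
    using that
  proof (induction F)
    case (insert b F)
    then show ?case using bounded_expo_add[OF y(1)[of "T b"] insert.IH] by (simp add: algebra_simps)
  qed simp
  have adm: "admissible n {T. semistandard ?D T} ?w"
    unfolding admissible_def
  proof (intro conjI allI)
    show "\<exists>B. \<forall>T\<in>{T. semistandard ?D T}. bounded_expo n B (?w T)" using sum_bd[OF fin] by blast
    fix e
    let ?M = "deg e + (int (card ?D) + 1) * \<bar>c\<bar>"
    show "finite {T \<in> {T. semistandard ?D T}. ?w T = e}"
    proof (rule finite_subset)
      show "finite (PiE ?D (\<lambda>_. {..nat ?M}))" using fin by (intro finite_PiE) auto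
      show "{T \<in> {T. semistandard ?D T}. ?w T = e} \<subseteq> PiE ?D (\<lambda>_. {..nat ?M})"
      proof clarsimp
        fix T assume T: "semistandard ?D T"
        have "int (T b) \<le> deg (?w T) + (int (card ?D) + 1) * \<bar>c\<bar>" if b: "b \<in> ?D" for b
        proof -
          have "deg (?w T) = (\<Sum>b\<in>?D. deg (y (T b)))" by (rule deg_sum)
          moreover have "(\<Sum>x\<in>{b}. int (T x)) \<le> (\<Sum>x\<in>?D. int (T x))"
            using b fin by (intro sum_mono2) auto
          moreover have "(\<Sum>x\<in>?D. int (T x) - c) \<le> (\<Sum>b\<in>?D. deg (y (T b)))" by (intro sum_mono y)
          moreover have "int (card ?D) * c \<le> int (card ?D) * \<bar>c\<bar>" by (intro mult_left_mono) auto
          ultimately show ?thesis by (simp add: sum_subtractf algebra_simps)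
        qed
        then show "T \<in> PiE ?D (\<lambda>_. {..nat (deg (?w T) + (int (card ?D) + 1) * \<bar>c\<bar>)})"
          using T by (auto simp: semistandard_def PiE_iff le_nat_iff) force
      qed
    qed
  qed
  have un: "(\<Union>m. tableaux m ?D) = {T. semistandard ?D T}"
  proof (intro set_eqI iffI)
    fix T assume T: "T \<in> {T. semistandard ?D T}"
    have "finite (T ` ?D)" using fin by simp
    then obtain m where "\<And>b. b \<in> ?D \<Longrightarrow> T b < m" by (auto simp: finite_nat_iff_bounded)
    then have "T \<in> tableaux m ?D" using T by (auto simp: tableaux_def)
    then show "T \<in> (\<Union>m. tableaux m ?D)" by blast
  qed (auto simp: tableaux_def)
  have inc: "incseq (\<lambda>m. tableaux m ?D)" by (auto simp: incseq_def tableaux_def intro: less_le_trans)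
  have "gf (tableaux m ?D) ?w = dsum (map y [0..<m]) (part \<alpha>) (part \<eta>)" for m
    using dsum_eq_sum_tableaux[OF decseq_part[OF \<eta>] decseq_part[OF \<alpha>] fin_supp_part[OF \<alpha>], of y m]
      subset_partition_iff[OF \<eta> \<alpha>] True
    by (simp add: dsum_rev fin_supp_part \<alpha> \<eta> gf_finite finite_tableaux fin shape_part mono_of_sum)
  moreover have "gf {T. semistandard ?D T} ?w = skew_schur \<alpha> \<eta> (\<lambda>j. mono_of (y j))"
    using True by (simp add: skew_schur_def gf_def mono_of_sum)
  ultimately show ?thesis
    using bconv_gf_incseq[of n "\<lambda>m. tableaux m ?D" ?w, unfolded un, OF adm inc] by simp
qed

section \<open>The boundary of a partition\<close>

text \<open>
  The diagonals \<open>i - j = t\<close> and \<open>i - j = t + 1\<close> are separated by edge \<open>t\<close> of the boundary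
  of \<open>\<nu>\<close>. The edges are of two kinds, enumerated by \<open>down_edge\<close> and \<open>up_edge\<close>, and
  \<open>start t\<close> is the first coordinate of the first box of diagonal \<open>t\<close> outside \<open>\<nu>\<close>.
\<close>

locale boundary =
  fixes \<nu> :: diagram
  assumes nu: "is_partition \<nu>"
begin

definition down_edge :: "nat \<Rightarrow> int" where
  "down_edge j = int j - int (part (conjugate \<nu>) j)"

definition up_edge :: "nat \<Rightarrow> int" where
  "up_edge j = int (part \<nu> j) - 1 - int j"

definition start :: "int \<Rightarrow> nat" where
  "start t = (LEAST i. t \<le> down_edge i)"

text \<open>Before -radius all edges are up edges and from radius on all are down edges: there the
  boundary of \<nu> runs along the axes.\<close>

definition radius :: nat where
  "radius = max (part \<nu> 0) (part (conjugate \<nu>) 0)"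

lemma nu': "is_partition (conjugate \<nu>)"
  using nu by (rule is_partition_conjugate)

lemma strict_mono_down_edge: "strict_mono down_edge"
  unfolding strict_mono_Suc_iff down_edge_def
  using decseq_SucD[OF decseq_part[OF nu']] by (auto simp: le_diff_eq intro: le_less_trans) (smt (verit) of_nat_le_iff)

lemma strict_mono_up_edge: "i < j \<Longrightarrow> up_edge j < up_edge i"
  unfolding up_edge_def using decseqD[OF decseq_part[OF nu], of i j] by simp

lemma part_le_radius: "part \<nu> j \<le> radius" "part (conjugate \<nu>) j \<le> radius"
  using decseqD[OF decseq_part[OF nu], of 0 j] decseqD[OF decseq_part[OF nu'], of 0 j]
  by (simp_all add: radius_def)

lemma down_edge_bounds: "int j - int radius \<le> down_edge j" "down_edge j \<le> int j"
  using part_le_radius(2)[of j] by (auto simp: down_edge_def)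

lemma up_edge_bounds: "up_edge j < int radius - int j" "- int j \<le> up_edge j + 1"
  using part_le_radius(1)[of j] by (auto simp: up_edge_def)

text \<open>By strict monotonicity the down edges before t are those with index below
  \<open>start t\<close>, so \<open>start t\<close> counts them. The behaviour of
  \<open>start\<close> at either kind of edge follows from this.\<close>

lemma less_start_iff: "i < start t \<longleftrightarrow> down_edge i < t"
proof -
  have "t \<le> down_edge (nat t + radius)" using down_edge_bounds(1)[of "nat t + radius"] by linarith
  then have L: "t \<le> down_edge (start t)" unfolding start_def by (rule LeastI)
  show ?thesis
  proof
    show "down_edge i < t" if "i < start t" using that not_less_Least[of i "\<lambda>i. t \<le> down_edge i"]
      unfolding start_def[symmetric] by simp
    show "i < start t" if "down_edge i < t"
      using that L strict_mono_less_eq[OF strict_mono_down_edge, of "start t" i] by linarith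
  qed
qed

lemma le_start: "t \<le> int (start t)"
  using less_start_iff[of "start t" t] down_edge_bounds(2)[of "start t"] by simp

lemma mem_nu_iff: "(i, j) \<in> \<nu> \<longleftrightarrow> i < start (int i - int j)"
  using mem_partition_iff[OF nu', of j i] by (auto simp: less_start_iff down_edge_def)

lemma start_down: 
  assumes "t \<in> range down_edge"
  shows "start (t + 1) = Suc (start t)" "down_edge (start t) = t"
proof -
  obtain j where j: "t = down_edge j" using assms by blast
  have *: "i < start t \<longleftrightarrow> i < j" "i < start (t + 1) \<longleftrightarrow> i < Suc j" for i
    unfolding less_start_iff j using strict_mono_less[OF strict_mono_down_edge, of i j]
      strict_mono_less_eq[OF strict_mono_down_edge, of i j] by auto
  have "start t = j" using *(1)[of "start t"] *(1)[of j] by (metis less_irrefl linorder_neqE_nat *(1))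
  moreover have "start (t + 1) = Suc j" by (metis less_irrefl linorder_neqE_nat *(2))
  ultimately show "start (t + 1) = Suc (start t)" "down_edge (start t) = t" using j by auto
qed

lemma start_up: 
  assumes "t \<notin> range down_edge"
  shows "start (t + 1) = start t"
proof -
  have "down_edge i < t + 1 \<longleftrightarrow> down_edge i < t" for i
    using assms by (metis rangeI zle_add1_eq_le zless_add1_eq order.order_iff_strict)
  then have "i < start (t + 1) \<longleftrightarrow> i < start t" for i by (simp add: less_start_iff)
  then show ?thesis by (metis less_irrefl linorder_neqE_nat)
qed

text \<open>The Maya diagram of \<nu>: its two kinds of edges partition the integers. If t is no
  down edge, the first box outside \<nu> on diagonal t + 1 has first coordinate
  \<open>start t\<close>, and it ends the row whose up edge is t.\<close>

lemma range_up_edge: "t \<in> range up_edge \<longleftrightarrow> t \<notin> range down_edge"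
proof
  assume "t \<in> range up_edge"
  then obtain j where j: "t = up_edge j" by blast
  have "down_edge i \<noteq> up_edge j" for i
  proof (cases "(i, j) \<in> \<nu>")
    case True
    then have "i < part \<nu> j" "j < part (conjugate \<nu>) i"
      using mem_partition_iff[OF nu] mem_partition_iff[OF nu', of j i] by auto
    then show ?thesis by (simp add: down_edge_def up_edge_def)
  next
    case False
    then have "part \<nu> j \<le> i" "part (conjugate \<nu>) i \<le> j"
      using mem_partition_iff[OF nu, of i j] mem_partition_iff[OF nu', of j i] by auto
    then show ?thesis by (simp add: down_edge_def up_edge_def)
  qed
  then show "t \<notin> range down_edge" using j by (metis imageE)
next
  assume t: "t \<notin> range down_edge"
  let ?i = "start t"
  have "t < down_edge ?i" using less_start_iff[of ?i t] t by (metis less_irrefl linorder_neqE_linordered_idom rangeI)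
  then have ge: "int ?i - t - 1 \<ge> 0" using down_edge_bounds(2)[of ?i] by simp
  define j where "j = nat (int ?i - t - 1)"
  have j: "int j = int ?i - t - 1" using ge by (simp add: j_def)
  have "(?i, j) \<notin> \<nu>" unfolding mem_nu_iff j using start_up[OF t] by simp
  moreover have "(i, j) \<in> \<nu>" if "i < ?i" for i
  proof -
    have "(?i - 1, j) \<in> \<nu>" using that unfolding mem_nu_iff by (simp add: j of_nat_diff)
    then show ?thesis using nu that unfolding is_partition_def by (metis Suc_leI Suc_pred' le_refl less_Suc_eq_le not_less_zero neq0_conv)
  qed
  ultimately have "part \<nu> j = ?i" using mem_partition_iff[OF nu] by (meson less_irrefl not_less_iff_gr_or_eq)
  then have "up_edge j = t" using j by (simp add: up_edge_def)
  then show "t \<in> range up_edge" by blast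
qed

lemma start_large: "int radius \<le> t \<Longrightarrow> int (start t) = t"
proof -
  assume t: "int radius \<le> t"
  have "\<not> down_edge (nat t) < t"
  proof -
    have "part (conjugate \<nu>) (nat t) = 0"
      using part_conjugate_iff[OF nu, of 0 "nat t"] part_le_radius(1)[of 0] t by (metis gr0I le_less_trans nat_less_iff not_less of_nat_le_iff of_nat_less_iff int_nat_eq of_nat_0_le_iff order.trans nat_0_le)
    then show ?thesis using t by (simp add: down_edge_def)
  qed
  then have "start t \<le> nat t" using less_start_iff[of "nat t" t] by simp
  then show ?thesis using le_start[of t] t by linarith
qed

lemma start_small: "t \<le> - int radius \<Longrightarrow> start t = 0"
  using less_start_iff[of 0 t] down_edge_bounds(1)[of 0] by simp

end

section \<open>Slices of three-dimensional partitions\<close>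

lemma paths_iff:
  "p \<in> paths w a b \<longleftrightarrow> length p = length w \<and>
     (\<forall>i<length w. step (fst (w ! i)) ((a # p) ! i) (p ! i)) \<and> last (a # p) = b"
proof (induction w arbitrary: a p)
  case Nil
  then show ?case by auto
next
  case (Cons x w)
  obtain d e where x: "x = (d, e)" by fastforce
  show ?case
  proof (cases p)
    case (Cons k q)
    have "p \<in> paths (x # w) a b \<longleftrightarrow> step d a k \<and> q \<in> paths w k b" by (auto simp: x Cons)
    then show ?thesis unfolding Cons.IH by (auto simp: x Cons less_Suc_eq_0_disj)
  qed (auto simp: x)
qed

lemma path_wt_eq_sum:
  "length p = length w \<Longrightarrow> path_wt w a p = (\<Sum>i<length w. step_wt (snd (w ! i)) ((a # p) ! i) (p ! i))"
proof (induction w arbitrary: a p)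
  case (Cons x w)
  then obtain k q where p: "p = k # q" by (cases p) auto
  then show ?case using Cons by (cases x) (simp add: sum.lessThan_Suc_shift del: sum.lessThan_Suc)
qed simp

locale vertex_data = boundary +
  fixes lam \<mu> :: diagram
  assumes lam: "is_partition lam" and mu: "is_partition \<mu>"
begin

abbreviation "lam_end \<equiv> part (conjugate lam)"
abbreviation "mu_end \<equiv> part \<mu>"

lemma mem_lam_iff: "(j, k) \<in> lam \<longleftrightarrow> k < lam_end j"
  using mem_partition_iff[OF is_partition_conjugate[OF lam], of k j] by simp

lemma mem_mu_iff: "(k, i) \<in> \<mu> \<longleftrightarrow> k < mu_end i"
  by (rule mem_partition_iff[OF mu])

text \<open>Meaningful outside \<nu> only: over a box of \<nu> the column of an asymptotic \<pi> is
  infinite and \<open>card\<close> gives 0.\<close>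

definition height :: "(nat \<times> nat \<times> nat) set \<Rightarrow> nat \<Rightarrow> nat \<Rightarrow> nat" where
  "height \<pi> i j = card {k. (i, j, k) \<in> \<pi>}"

text \<open>By \<open>le_start\<close> the second coordinate is nonnegative, so \<open>nat\<close>
  truncates nothing.\<close>

definition slice :: "(nat \<times> nat \<times> nat) set \<Rightarrow> int \<Rightarrow> nat \<Rightarrow> nat" where
  "slice \<pi> t m = height \<pi> (start t + m) (nat (int (start t + m) - t))"

lemma down_closed:
  assumes \<pi>: "asymptotic_3d lam \<mu> \<nu> \<pi>"
  shows "(i, j, k) \<in> \<pi> \<Longrightarrow> i' \<le> i \<Longrightarrow> j' \<le> j \<Longrightarrow> k' \<le> k \<Longrightarrow> (i', j', k') \<in> \<pi>"
proof -
  have step: "(i + 1, j, k) \<in> \<pi> \<Longrightarrow> (i, j, k) \<in> \<pi>" "(i, j + 1, k) \<in> \<pi> \<Longrightarrow> (i, j, k) \<in> \<pi>"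
    "(i, j, k + 1) \<in> \<pi> \<Longrightarrow> (i, j, k) \<in> \<pi>" for i j k
    using \<pi> unfolding asymptotic_3d_def by blast+
  have "(i' + d, j, k) \<in> \<pi> \<Longrightarrow> (i', j, k) \<in> \<pi>" for d i' j k
    by (induction d) (auto dest: step(1)[simplified])
  moreover have "(i, j' + d, k) \<in> \<pi> \<Longrightarrow> (i, j', k) \<in> \<pi>" for d i j' k
    by (induction d) (auto dest: step(2)[simplified])
  moreover have "(i, j, k' + d) \<in> \<pi> \<Longrightarrow> (i, j, k') \<in> \<pi>" for d i j k'
    by (induction d) (auto dest: step(3)[simplified])
  ultimately show "(i, j, k) \<in> \<pi> \<Longrightarrow> i' \<le> i \<Longrightarrow> j' \<le> j \<Longrightarrow> k' \<le> k \<Longrightarrow> (i', j', k') \<in> \<pi>"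
    by (metis le_add_diff_inverse)
qed

lemma legs_subset:
  assumes \<pi>: "asymptotic_3d lam \<mu> \<nu> \<pi>"
  shows "(j, k) \<in> lam \<Longrightarrow> (i, j, k) \<in> \<pi>" "(k, i) \<in> \<mu> \<Longrightarrow> (i, j, k) \<in> \<pi>" "(i, j) \<in> \<nu> \<Longrightarrow> (i, j, k) \<in> \<pi>"
proof -
  have ev: "(j, k) \<in> lam \<Longrightarrow> \<forall>\<^sub>F i in sequentially. (i, j, k) \<in> \<pi>"
    "(k, i) \<in> \<mu> \<Longrightarrow> \<forall>\<^sub>F j in sequentially. (i, j, k) \<in> \<pi>"
    "(i, j) \<in> \<nu> \<Longrightarrow> \<forall>\<^sub>F k in sequentially. (i, j, k) \<in> \<pi>"
    using \<pi> unfolding asymptotic_3d_def by blast+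
  show "(i, j, k) \<in> \<pi>" if leg: "(j, k) \<in> lam"
  proof -
    obtain N where "\<forall>m\<ge>N. (m, j, k) \<in> \<pi>" using ev(1)[OF leg] by (auto simp: eventually_sequentially)
    then have "(max N i, j, k) \<in> \<pi>" by simp
    then show ?thesis by (rule down_closed[OF \<pi>]) auto
  qed
  show "(i, j, k) \<in> \<pi>" if leg: "(k, i) \<in> \<mu>"
  proof -
    obtain N where "\<forall>m\<ge>N. (i, m, k) \<in> \<pi>" using ev(2)[OF leg] by (auto simp: eventually_sequentially)
    then have "(i, max N j, k) \<in> \<pi>" by simp
    then show ?thesis by (rule down_closed[OF \<pi>]) auto
  qed
  show "(i, j, k) \<in> \<pi>" if leg: "(i, j) \<in> \<nu>"
  proof -
    obtain N where "\<forall>m\<ge>N. (i, j, m) \<in> \<pi>" using ev(3)[OF leg] by (auto simp: eventually_sequentially)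
    then have "(i, j, max N k) \<in> \<pi>" by simp
    then show ?thesis by (rule down_closed[OF \<pi>]) auto
  qed
qed

lemma mem_iff_less_height:
  assumes \<pi>: "asymptotic_3d lam \<mu> \<nu> \<pi>" and "(i, j) \<notin> \<nu>"
  shows "(i, j, k) \<in> \<pi> \<longleftrightarrow> k < height \<pi> i j"
proof -
  have "\<not> (\<forall>\<^sub>F k in sequentially. (i, j, k) \<in> \<pi>)" using assms unfolding asymptotic_3d_def by blast
  then obtain K where K: "(i, j, K) \<notin> \<pi>" by (auto simp: eventually_sequentially)
  define L where "L = (LEAST k. (i, j, k) \<notin> \<pi>)"
  have L: "(i, j, L) \<notin> \<pi>" unfolding L_def by (rule LeastI[where P = "\<lambda>k. (i, j, k) \<notin> \<pi>", OF K])
  have "(i, j, k) \<in> \<pi> \<longleftrightarrow> k < L" for k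
  proof
    show "k < L" if "(i, j, k) \<in> \<pi>" using down_closed[OF \<pi> that, of i j L] L by (meson le_refl not_le)
    show "(i, j, k) \<in> \<pi>" if "k < L" using not_less_Least[of k "\<lambda>k. (i, j, k) \<notin> \<pi>"] that unfolding L_def by blast
  qed
  moreover from this have "height \<pi> i j = L" by (simp add: height_def)
  ultimately show ?thesis by simp
qed

lemma height_antimono:
  assumes \<pi>: "asymptotic_3d lam \<mu> \<nu> \<pi>" and "(i, j) \<notin> \<nu>" "i \<le> i'" "j \<le> j'"
  shows "height \<pi> i' j' \<le> height \<pi> i j"
proof (rule ccontr)
  assume less: "\<not> ?thesis"
  have "(i', j') \<notin> \<nu>" using assms nu unfolding is_partition_def by blast
  then have "(i', j', height \<pi> i j) \<in> \<pi>" using mem_iff_less_height[OF \<pi>] less by simp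
  then have "(i, j, height \<pi> i j) \<in> \<pi>" using down_closed[OF \<pi>] assms by blast
  then show False using mem_iff_less_height[OF \<pi> assms(2)] by simp
qed

text \<open>By monotonicity it suffices to bound the finitely many columns through boxes next to a leg.\<close>

lemma eventually_not_bounded:
  fixes P :: "nat \<Rightarrow> nat \<Rightarrow> nat \<Rightarrow> bool"
  assumes \<alpha>: "is_partition \<alpha>" and ev: "\<And>a b. (a, b) \<notin> \<alpha> \<Longrightarrow> \<exists>c. \<not> P a b c"
    and mono: "\<And>a b c a' b' c'. P a b c \<Longrightarrow> a' \<le> a \<Longrightarrow> b' \<le> b \<Longrightarrow> c' \<le> c \<Longrightarrow> P a' b' c'"
  shows "\<exists>M. \<forall>a b c. P a b c \<longrightarrow> c < M \<or> (a, b) \<in> \<alpha>"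
proof -
  have "finite (fst ` \<alpha> \<union> snd ` \<alpha>)" using \<alpha> by (simp add: is_partition_def)
  then obtain L where L: "\<And>x. x \<in> fst ` \<alpha> \<union> snd ` \<alpha> \<Longrightarrow> x < L" by (auto simp: finite_nat_iff_bounded)
  obtain c where c: "\<And>a b. (a, b) \<notin> \<alpha> \<Longrightarrow> \<not> P a b (c a b)" using ev by metis
  define M where "M = Max ((\<lambda>(a, b). c a b) ` ({..L} \<times> {..L}))"
  have M: "c a b \<le> M" if "a \<le> L" "b \<le> L" for a b
    unfolding M_def using that by (intro Max_ge) (auto intro!: image_eqI[of _ _ "(a, b)"])
  have "c' < M" if P: "P a b c'" and n: "(a, b) \<notin> \<alpha>" for a b c'
  proof (rule ccontr)
    assume "\<not> c' < M"
    \<comment> \<open>Boxes of \<alpha> have both coordinates below L, so truncation at L cannot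
      lead into \<alpha> from outside.\<close>
    have "(min a L, min b L) \<notin> \<alpha>" 
    proof
      assume *: "(min a L, min b L) \<in> \<alpha>"
      then have "min a L < L" "min b L < L" using L by force+
      then show False using * n by (simp add: min_def split: if_splits)
    qed
    moreover have "P (min a L) (min b L) (c (min a L) (min b L))"
      using M[of "min a L" "min b L"] \<open>\<not> c' < M\<close> by (intro mono[OF P]) auto
    ultimately show False using c by blast
  qed
  then show ?thesis by blast
qed

lemma legs_bound:
  assumes \<pi>: "asymptotic_3d lam \<mu> \<nu> \<pi>"
  obtains M where "\<And>i j k. (i, j, k) \<in> \<pi> \<Longrightarrow> (i < M \<or> (j, k) \<in> lam) \<and> (j < M \<or> (k, i) \<in> \<mu>) \<and> (k < M \<or> (i, j) \<in> \<nu>)"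
proof -
  have ex: "(j, k) \<notin> lam \<Longrightarrow> \<exists>i. (i, j, k) \<notin> \<pi>" "(k, i) \<notin> \<mu> \<Longrightarrow> \<exists>j. (i, j, k) \<notin> \<pi>"
    "(i, j) \<notin> \<nu> \<Longrightarrow> \<exists>k. (i, j, k) \<notin> \<pi>" for i j k
    using \<pi> unfolding asymptotic_3d_def by (meson always_eventually)+
  obtain M1 where "\<And>i j k. (i, j, k) \<in> \<pi> \<Longrightarrow> i < M1 \<or> (j, k) \<in> lam"
    using eventually_not_bounded[OF lam, of "\<lambda>j k i. (i, j, k) \<in> \<pi>"] ex(1) down_closed[OF \<pi>] by blast
  moreover obtain M2 where "\<And>i j k. (i, j, k) \<in> \<pi> \<Longrightarrow> j < M2 \<or> (k, i) \<in> \<mu>"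
    using eventually_not_bounded[OF mu, of "\<lambda>k i j. (i, j, k) \<in> \<pi>"] ex(2) down_closed[OF \<pi>] by blast
  moreover obtain M3 where "\<And>i j k. (i, j, k) \<in> \<pi> \<Longrightarrow> k < M3 \<or> (i, j) \<in> \<nu>"
    using eventually_not_bounded[OF nu, of "\<lambda>i j k. (i, j, k) \<in> \<pi>"] ex(3) down_closed[OF \<pi>] by blast
  ultimately show thesis by (intro that[of "max M1 (max M2 M3)"]) (meson max.strict_coboundedI1 max.strict_coboundedI2)
qed

end

section \<open>The variables and their partial products\<close>

text \<open>\<open>ev n c r\<close> is the exponent of the variable \<open>q_{c+r}\<close>, and \<open>Q n c t\<close> is the exponent of
  \<open>\<qq>_t\<close> in the shifted variables.\<close>

definition ev :: "nat \<Rightarrow> int \<Rightarrow> int \<Rightarrow> expo" where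
  "ev n c r = Poly_Mapping.single (nat ((c + r) mod int n)) 1"

definition Q :: "nat \<Rightarrow> int \<Rightarrow> int \<Rightarrow> expo" where
  "Q n c t = (if t \<ge> 0 then \<Sum>r = 1..t. ev n c r else - (\<Sum>r = t + 1..0. ev n c r))"

lemma qv_eq_mono_of: "qv n (c + r) = mono_of (ev n c r)"
  by (simp add: qv_def ev_def qvar_eq_mono_of)

lemma deg_ev [simp]: "deg (ev n c r) = 1"
  by (simp add: ev_def)

lemma bounded_ev: "n \<ge> 1 \<Longrightarrow> bounded_expo n 0 (ev n c r)"
  by (auto simp: bounded_expo_def ev_def lookup_single when_def nat_less_iff)

lemma lookup_ev_le: "Poly_Mapping.lookup (ev n c r) i \<le> 1"
  by (simp add: ev_def lookup_single when_def)

lemma ev_cong: "r mod int n = s mod int n \<Longrightarrow> ev n c r = ev n c s"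
  unfolding ev_def by (metis mod_add_right_eq)

lemma Q_step: "Q n c (t + 1) = Q n c t + ev n c (t + 1)"
proof -
  consider "t \<ge> 0" | "t = - 1" | "t < - 1" by linarith
  then show ?thesis
  proof cases
    case 1
    then have "{1..t + 1} = insert (t + 1) {1..t}" by auto
    then show ?thesis using 1 by (simp add: Q_def add.commute)
  next
    case 3
    then have "{t + 1..0} = insert (t + 1) {t + 1 + 1..0}" by auto
    then show ?thesis using 3 by (simp add: Q_def)
  qed (simp add: Q_def)
qed

lemma Q_diff:
  assumes "s \<le> t"
  shows "Q n c t - Q n c s = (\<Sum>r = s + 1..t. ev n c r)"
  using assms
proof (induction t rule: int_ge_induct)
  case (step t)
  then have "{s + 1..t + 1} = insert (t + 1) {s + 1..t}" by auto
  moreover have "Q n c (t + 1) - Q n c s = ev n c (t + 1) + (Q n c t - Q n c s)" by (simp add: Q_step)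
  ultimately show ?case using step by simp
qed simp

lemma Q_0 [simp]: "Q n c 0 = 0"
  by (simp add: Q_def)

lemma deg_Q: "deg (Q n c t) = t"
  by (simp add: Q_def deg_sum deg_uminus)

lemma bounded_sum_0: "(\<And>a. a \<in> A \<Longrightarrow> bounded_expo n 0 (f a)) \<Longrightarrow> bounded_expo n 0 (sum f A)"
proof (induction A rule: infinite_finite_induct)
  case (insert a A)
  then show ?case using bounded_expo_add[of n 0 "f a" 0 "sum f A"] by simp
qed auto

lemma bounded_Q_diff: "n \<ge> 1 \<Longrightarrow> s \<le> t \<Longrightarrow> bounded_expo n 0 (Q n c t - Q n c s)"
  unfolding Q_diff by (intro bounded_sum_0 bounded_ev)

lemma Q_diff_ne_0: "s \<noteq> t \<Longrightarrow> Q n c t - Q n c s \<noteq> 0"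
  by (metis deg_diff deg_Q deg_0 right_minus_eq)

lemma bounded_uminus_sum: 
  assumes "n \<ge> 1"
  shows "finite A \<Longrightarrow> bounded_expo n (- int (card A)) (- (\<Sum>r\<in>A. ev n c r))"
proof (induction A rule: finite_induct)
  case (insert r A)
  have "bounded_expo n (- 1) (- ev n c r)"
    using bounded_ev[OF assms, of c r] lookup_ev_le[of n c r] by (auto simp: bounded_expo_def)
  from bounded_expo_add[OF this insert.IH] show ?case using insert by (simp add: algebra_simps)
qed simp

lemma bounded_Q:
  assumes "n \<ge> 1" "- int m \<le> t"
  shows "bounded_expo n (- int m) (Q n c t)"
proof -
  have "bounded_expo n (- int m) (Q n c (- int m))"
    using bounded_uminus_sum[OF assms(1), of "{- int m + 1..0}" c] by (cases "m = 0") (auto simp: Q_def)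
  from bounded_expo_add[OF bounded_Q_diff[OF assms, of c] this] show ?thesis by simp
qed

section \<open>Three-dimensional partitions as paths\<close>

lemma interlaced_refl: "decseq a \<Longrightarrow> interlaced a a"
  by (simp add: interlaced_def decseq_SucD)

context vertex_data
begin

lemma outside_nu: "(start t + m, nat (int (start t + m) - t)) \<notin> \<nu>"
  using le_start[of t] unfolding mem_nu_iff by simp

text \<open>Across a down edge, position m of the slice moves from (i, j) to (i + 1, j); across an
  up edge, from (i, j) to (i, j - 1). Position m + 1 sits at (i + 1, j + 1), and since heights
  decrease in both coordinates the slices interlace.\<close>

lemma slice_step:
  assumes \<pi>: "asymptotic_3d lam \<mu> \<nu> \<pi>"
  shows "step (t \<in> range down_edge) (slice \<pi> t) (slice \<pi> (t + 1))"
proof (cases "t \<in> range down_edge")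
  case True
  have "slice \<pi> (t + 1) m \<le> slice \<pi> t m" "slice \<pi> t (Suc m) \<le> slice \<pi> (t + 1) m" for m
    unfolding slice_def start_down(1)[OF True] using outside_nu[of t m] outside_nu[of "t + 1" m, unfolded start_down(1)[OF True]]
    by (auto intro!: height_antimono[OF \<pi>])
  then show ?thesis using True by (simp add: step_def interlaced_def)
next
  case False
  have "slice \<pi> t m \<le> slice \<pi> (t + 1) m" "slice \<pi> (t + 1) (Suc m) \<le> slice \<pi> t m" for m
    unfolding slice_def start_up[OF False] using outside_nu[of t m] outside_nu[of "t + 1" m, unfolded start_up[OF False]]
    by (auto intro!: height_antimono[OF \<pi>])
  then show ?thesis using False by (simp add: step_def interlaced_def)
qed

definition from_slices :: "(int \<Rightarrow> nat \<Rightarrow> nat) \<Rightarrow> (nat \<times> nat \<times> nat) set" where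
  "from_slices E = {(i, j, k). (i, j) \<in> \<nu> \<or> k < E (int i - int j) (i - start (int i - int j))}"

lemma from_slices_slice:
  assumes \<pi>: "asymptotic_3d lam \<mu> \<nu> \<pi>"
  shows "from_slices (slice \<pi>) = \<pi>"
proof -
  have "(i, j, k) \<in> from_slices (slice \<pi>) \<longleftrightarrow> (i, j, k) \<in> \<pi>" for i j k
  proof (cases "(i, j) \<in> \<nu>")
    case True
    then show ?thesis using legs_subset(3)[OF \<pi>] by (simp add: from_slices_def)
  next
    case False
    then have "start (int i - int j) \<le> i" by (simp add: mem_nu_iff)
    then have "slice \<pi> (int i - int j) (i - start (int i - int j)) = height \<pi> i j" by (simp add: slice_def)
    then show ?thesis using False mem_iff_less_height[OF \<pi>] by (simp add: from_slices_def)
  qed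
  then show ?thesis by auto
qed

lemma slice_from_slices: "slice (from_slices E) = E"
proof (intro ext)
  fix t m
  have "int (nat (int (start t + m) - t)) = int (start t + m) - t" using le_start[of t] by simp
  then show "slice (from_slices E) t m = E t m"
    using outside_nu[of t m] by (simp add: slice_def height_def from_slices_def)
qed

lemma asymptotic_from_slices:
  assumes steps: "\<And>t. step (t \<in> range down_edge) (E t) (E (t + 1))"
    and left: "\<And>t. t \<le> - N \<Longrightarrow> E t = mu_end" and right: "\<And>t. t \<ge> N \<Longrightarrow> E t = lam_end"
  shows "asymptotic_3d lam \<mu> \<nu> (from_slices E)"
proof -
  let ?g = "\<lambda>i j. E (int i - int j) (i - start (int i - int j))"
  have mem: "(i, j, k) \<in> from_slices E \<longleftrightarrow> (i, j) \<in> \<nu> \<or> k < ?g i j" for i j k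
    by (simp add: from_slices_def)
  have mono1: "?g (i + 1) j \<le> ?g i j" if "(i, j) \<notin> \<nu>" for i j
  proof -
    let ?t = "int i - int j"
    have t: "int (i + 1) - int j = ?t + 1" "start ?t \<le> i" using that by (auto simp: mem_nu_iff)
    show ?thesis
    proof (cases "?t \<in> range down_edge")
      case True
      then show ?thesis using steps[of ?t] unfolding t(1) start_down(1)[OF True] by (simp add: step_def interlaced_def)
    next
      case False
      then show ?thesis using steps[of ?t] t(2) unfolding t(1) start_up[OF False]
        by (simp add: step_def interlaced_def Suc_diff_le)
    qed
  qed
  have mono2: "?g i (j + 1) \<le> ?g i j" if "(i, j) \<notin> \<nu>" for i j
  proof -
    let ?t = "int i - int (j + 1)"
    have t: "int i - int j = ?t + 1" "start (?t + 1) \<le> i" using that by (auto simp: mem_nu_iff)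
    show ?thesis
    proof (cases "?t \<in> range down_edge")
      case True
      have "i - start ?t = Suc (i - Suc (start ?t))" using t(2) unfolding start_down(1)[OF True] by simp
      then show ?thesis using True steps[of ?t] unfolding t(1) start_down(1)[OF True] by (simp add: step_def interlaced_def)
    next
      case False
      then show ?thesis using steps[of ?t] unfolding t(1) start_up[OF False]
        by (simp add: step_def interlaced_def)
    qed
  qed
  have nu_down: "(i, j) \<in> \<nu>" if "(i + 1, j) \<in> \<nu> \<or> (i, j + 1) \<in> \<nu>" for i j
    using that nu unfolding is_partition_def by (meson le_add1 le_refl)
  \<comment> \<open>Membership that eventually agrees with a fixed truth value turns each asymptotic
    condition into a triviality, so it remains to compute three limits.\<close>
  have ev: "(\<forall>\<^sub>F x in sequentially. P x) \<longleftrightarrow> b" if "\<forall>\<^sub>F x in sequentially. P x = b" for P b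
  proof -
    have "(\<forall>\<^sub>F x in sequentially. P x) \<longleftrightarrow> (\<forall>\<^sub>F x :: nat in sequentially. b)"
      by (rule eventually_cong[OF that]) simp
    then show ?thesis by simp
  qed
  have lim1: "\<forall>\<^sub>F i in sequentially. ((i, j, k) \<in> from_slices E) = ((j, k) \<in> lam)" for j k
    unfolding eventually_sequentially
  proof (intro exI allI impI)
    fix i assume i: "j + nat N + radius \<le> i"
    then have "(i, j) \<notin> \<nu>" using part_le_radius(1)[of j] by (simp add: mem_partition_iff[OF nu])
    moreover have "int (start (int i - int j)) = int i - int j" "E (int i - int j) = lam_end"
      using i by (auto intro!: start_large right)
    moreover from this(1) have "i - start (int i - int j) = j" by linarith
    ultimately show "((i, j, k) \<in> from_slices E) = ((j, k) \<in> lam)" by (simp add: mem mem_lam_iff)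
  qed
  have lim2: "\<forall>\<^sub>F j in sequentially. ((i, j, k) \<in> from_slices E) = ((k, i) \<in> \<mu>)" for i k
    unfolding eventually_sequentially
  proof (intro exI allI impI)
    fix j assume j: "i + nat N + radius \<le> j"
    then have "(i, j) \<notin> \<nu>"
      using mem_nu_iff[of i j] start_small[of "int i - int j"] by simp
    moreover have "start (int i - int j) = 0" "E (int i - int j) = mu_end"
      using j by (auto intro!: start_small left)
    ultimately show "((i, j, k) \<in> from_slices E) = ((k, i) \<in> \<mu>)" by (simp add: mem mem_mu_iff)
  qed
  have lim3: "\<forall>\<^sub>F k in sequentially. ((i, j, k) \<in> from_slices E) = ((i, j) \<in> \<nu>)" for i j
    unfolding eventually_sequentially by (rule exI[of _ "?g i j"]) (auto simp: mem)
  show ?thesis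
    unfolding asymptotic_3d_def ev[OF lim1] ev[OF lim2] ev[OF lim3]
  proof (intro conjI allI impI refl)
    fix i j k
    assume "(i + 1, j, k) \<in> from_slices E \<or> (i, j + 1, k) \<in> from_slices E \<or> (i, j, k + 1) \<in> from_slices E"
    then show "(i, j, k) \<in> from_slices E"
      using nu_down[of i j] mono1[of i j] mono2[of i j] unfolding mem by (meson less_le_trans add_lessD1)
  qed
qed

definition window :: "nat \<Rightarrow> (nat \<times> nat \<times> nat) set set" where
  "window N = {\<pi>. asymptotic_3d lam \<mu> \<nu> \<pi> \<and> (\<forall>t \<le> - int N. slice \<pi> t = mu_end) \<and>
     (\<forall>t \<ge> int N. slice \<pi> t = lam_end)}"

lemma incseq_window: "incseq window"
  by (auto simp: incseq_def window_def)

text \<open>Every \<pi> lies in some window because it equals its legs far out. The offset M is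
  there because the formula for a window is available only from a certain size on.\<close>

lemma Union_window: "(\<Union>N. window (M + N)) = {\<pi>. asymptotic_3d lam \<mu> \<nu> \<pi>}"
proof (intro set_eqI iffI)
  fix \<pi> assume "\<pi> \<in> {\<pi>. asymptotic_3d lam \<mu> \<nu> \<pi>}"
  then have \<pi>: "asymptotic_3d lam \<mu> \<nu> \<pi>" by simp
  obtain L where L: "\<And>i j k. (i, j, k) \<in> \<pi> \<Longrightarrow> (i < L \<or> (j, k) \<in> lam) \<and> (j < L \<or> (k, i) \<in> \<mu>) \<and> (k < L \<or> (i, j) \<in> \<nu>)"
    using legs_bound[OF \<pi>] by blast
  let ?N = "L + radius"
  have "slice \<pi> t = lam_end" if t: "t \<ge> int ?N" for t
  proof
    fix m
    have s: "int (start t) = t" using t by (intro start_large) simp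
    have "(start t + m, m, k) \<in> \<pi> \<longleftrightarrow> k < lam_end m" for k
      using L[of "start t + m" m k] legs_subset(1)[OF \<pi>, of m k] s t by (auto simp: mem_lam_iff)
    then show "slice \<pi> t m = lam_end m" using s by (simp add: slice_def height_def nat_diff_distrib)
  qed
  moreover have "slice \<pi> t = mu_end" if t: "t \<le> - int ?N" for t
  proof
    fix m
    have s: "start t = 0" using t by (intro start_small) simp
    have "(m, nat (int m - t), k) \<in> \<pi> \<longleftrightarrow> k < mu_end m" for k
      using L[of m "nat (int m - t)" k] legs_subset(2)[OF \<pi>, of k m] s t by (auto simp: mem_mu_iff)
    then show "slice \<pi> t m = mu_end m" using s by (simp add: slice_def height_def)
  qed
  ultimately have "\<pi> \<in> window ?N" using \<pi> by (simp add: window_def)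
  then have "\<pi> \<in> window (M + ?N)" using incseqD[OF incseq_window, of ?N "M + ?N"] by auto
  then show "\<pi> \<in> (\<Union>N. window (M + N))" by blast
qed (auto simp: window_def)

definition word :: "(int \<Rightarrow> expo) \<Rightarrow> nat \<Rightarrow> (bool \<times> expo) list" where
  "word q N = map (\<lambda>t. (t \<in> range down_edge, q t)) [- int N..int N - 1]"

definition slices :: "nat \<Rightarrow> (nat \<times> nat \<times> nat) set \<Rightarrow> (nat \<Rightarrow> nat) list" where
  "slices N \<pi> = map (slice \<pi>) [1 - int N..int N]"

lemma nth_slices:
  assumes "\<pi> \<in> window N" "i \<le> 2 * N"
  shows "(mu_end # slices N \<pi>) ! i = slice \<pi> (int i - int N)"
proof (cases i)
  case 0
  then show ?thesis using assms by (simp add: window_def)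
next
  case (Suc j)
  then show ?thesis using assms(2) by (simp add: slices_def algebra_simps)
qed

lemma length_word [simp]: "length (word q N) = 2 * N"
  by (simp add: word_def nat_diff_distrib nat_add_distrib)

lemma nth_word: "i < 2 * N \<Longrightarrow> word q N ! i = (int i - int N \<in> range down_edge, q (int i - int N))"
  using nth_upto[of "- int N" i "int N - 1"] by (simp add: word_def)

lemma length_slices [simp]: "length (slices N \<pi>) = 2 * N"
  by (simp add: slices_def)

lemma slices_in_paths:
  assumes "\<pi> \<in> window N"
  shows "slices N \<pi> \<in> paths (word q N) mu_end lam_end"
  unfolding paths_iff
proof (intro conjI allI impI)
  have \<pi>: "asymptotic_3d lam \<mu> \<nu> \<pi>" using assms by (simp add: window_def)
  show "length (slices N \<pi>) = length (word q N)" by simp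
  have "last (mu_end # slices N \<pi>) = slice \<pi> (int (2 * N) - int N)"
    unfolding last_conv_nth[OF list.distinct(2)] using nth_slices[OF assms, of "2 * N"] by simp
  then show "last (mu_end # slices N \<pi>) = lam_end" using assms by (simp add: window_def)
  fix i assume "i < length (word q N)"
  then have i: "i < 2 * N" by simp
  have "slices N \<pi> ! i = slice \<pi> (int i - int N + 1)"
    using nth_slices[OF assms, of "Suc i"] i by (simp add: algebra_simps)
  then show "step (fst (word q N ! i)) ((mu_end # slices N \<pi>) ! i) (slices N \<pi> ! i)"
    using slice_step[OF \<pi>, of "int i - int N"] i nth_slices[OF assms, of i] by (simp add: nth_word)
qed

lemma bij_betw_slices: "bij_betw (slices N) (window N) (paths (word q N) mu_end lam_end)"
proof (rule bij_betw_byWitness)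
  \<comment> \<open>Clamping t to the window continues the path by its two end sequences.\<close>
  define E where "E p t = (mu_end # p) ! nat (max (- int N) (min (int N) t) + int N)" for p t
  show "\<forall>\<pi>\<in>window N. from_slices (E (slices N \<pi>)) = \<pi>"
  proof
    fix \<pi> assume \<pi>: "\<pi> \<in> window N"
    have "E (slices N \<pi>) t = slice \<pi> t" for t
    proof -
      let ?i = "nat (max (- int N) (min (int N) t) + int N)"
      have i: "?i \<le> 2 * N" "int ?i - int N = max (- int N) (min (int N) t)" by linarith+
      have "slice \<pi> (max (- int N) (min (int N) t)) = slice \<pi> t"
      proof (cases "t \<le> - int N \<or> t \<ge> int N")
        case True
        then show ?thesis using \<pi> by (auto simp: window_def max_def min_def)
      qed (auto simp: max_def min_def)
      then show ?thesis unfolding E_def nth_slices[OF \<pi> i(1)] i(2) .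
    qed
    then have "E (slices N \<pi>) = slice \<pi>" by blast
    then show "from_slices (E (slices N \<pi>)) = \<pi>" using \<pi> from_slices_slice by (simp add: window_def)
  qed
  have path: "from_slices (E p) \<in> window N \<and> slices N (from_slices (E p)) = p"
    if p: "p \<in> paths (word q N) mu_end lam_end" for p
  proof -
    have len: "length p = 2 * N" and last: "last (mu_end # p) = lam_end"
      and st: "\<And>i. i < 2 * N \<Longrightarrow> step (int i - int N \<in> range down_edge) ((mu_end # p) ! i) (p ! i)"
      using p unfolding paths_iff by (auto simp: nth_word)
    have left: "E p t = mu_end" if "t \<le> - int N" for t using that by (simp add: E_def)
    have right: "E p t = lam_end" if "t \<ge> int N" for t
    proof -
      have "nat (max (- int N) (min (int N) t) + int N) = length p" using that len by simp
      then show ?thesis using last unfolding E_def last_conv_nth[OF list.distinct(2)] by simp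
    qed
    have mid: "E p t = (mu_end # p) ! nat (t + int N)" if "- int N \<le> t" "t \<le> int N" for t
      using that by (simp add: E_def)
    have "step (t \<in> range down_edge) (E p t) (E p (t + 1))" for t
    proof (cases "- int N \<le> t \<and> t < int N")
      case True
      have i: "nat (t + int N) < 2 * N" "int (nat (t + int N)) - int N = t" using True by linarith+
      have "nat (t + 1 + int N) = Suc (nat (t + int N))" using True by linarith
      then show ?thesis using st[OF i(1)] i(2) mid[of t] mid[of "t + 1"] True by simp
    next
      case False
      \<comment> \<open>Outside the window the sequence is constant, and a partition interlaces
        itself, so the step is valid whatever the kind of the edge.\<close>
      then have "E p t = E p (t + 1) \<and> (E p t = mu_end \<or> E p t = lam_end)"
        using left[of t] left[of "t + 1"] right[of t] right[of "t + 1"] by (cases "t < - int N") auto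
      then show ?thesis using interlaced_refl[OF decseq_part[OF mu]]
          interlaced_refl[OF decseq_part[OF is_partition_conjugate[OF lam]]] by (auto simp: step_def)
    qed
    from asymptotic_from_slices[OF this left right] have "asymptotic_3d lam \<mu> \<nu> (from_slices (E p))" .
    then have w: "from_slices (E p) \<in> window N" using left right by (simp add: window_def slice_from_slices)
    have "slices N (from_slices (E p)) = p"
    proof (rule nth_equalityI)
      fix i assume "i < length (slices N (from_slices (E p)))"
      then have i: "i < 2 * N" by simp
      have "slices N (from_slices (E p)) ! i = E p (int (Suc i) - int N)"
        using nth_slices[OF w, of "Suc i"] i by (simp add: slice_from_slices)
      also have "\<dots> = p ! i" using mid[of "int (Suc i) - int N"] i by (simp del: of_nat_Suc)
      finally show "slices N (from_slices (E p)) ! i = p ! i" .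
    qed (simp add: len)
    then show ?thesis using w by simp
  qed
  show "\<forall>p\<in>paths (word q N) mu_end lam_end. slices N (from_slices (E p)) = p" using path by blast
  show "(\<lambda>p. from_slices (E p)) ` paths (word q N) mu_end lam_end \<subseteq> window N" using path by blast
  show "slices N ` window N \<subseteq> paths (word q N) mu_end lam_end" using slices_in_paths by blast
qed

end

section \<open>The weight of a three-dimensional partition\<close>

text \<open>Passing from j to \<open>Suc j\<close> raises the quotient \<open>(j + k) div n\<close>
  by one for exactly one residue k, the one congruent to \<open>- Suc j\<close>; thus each step adds
  a single variable.\<close>

lemma sum_div_mult_ev:
  fixes e :: "int \<Rightarrow> expo"
  assumes "n \<ge> 1" and periodic: "\<And>r s. r mod int n = s mod int n \<Longrightarrow> e r = e s"
  shows "(\<Sum>k<n. of_nat ((j + k) div n) * e (int k)) = (\<Sum>s = 1..j. e (- int s))"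
proof (induction j)
  case (Suc j)
  define k0 where "k0 = nat ((- int (Suc j)) mod int n)"
  have k0: "int k0 = (- int (Suc j)) mod int n" "k0 < n"
    using assms(1) by (simp_all add: k0_def nat_less_iff)
  have dvd: "Suc (j + k) mod n = 0 \<longleftrightarrow> k = k0" if "k < n" for k
  proof -
    have "Suc (j + k) mod n = 0 \<longleftrightarrow> int n dvd int k - (- int (Suc j))"
      by (simp add: mod_eq_0_iff_dvd algebra_simps flip: int_dvd_int_iff)
    also have "\<dots> \<longleftrightarrow> int k mod int n = int k0 mod int n"
      unfolding mod_eq_dvd_iff[symmetric] k0 by simp
    also have "\<dots> \<longleftrightarrow> k = k0" using that k0(2) by simp
    finally show ?thesis .
  qed
  have "(\<Sum>k<n. of_nat ((Suc j + k) div n) * e (int k)) =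
      (\<Sum>k<n. of_nat ((j + k) div n) * e (int k) + (if k = k0 then e (int k) else 0))"
  proof (rule sum.cong)
    fix k assume "k \<in> {..<n}"
    then have "(Suc j + k) div n = (j + k) div n + of_bool (k = k0)"
      using dvd[of k] by (simp only: add_Suc div_Suc of_bool_def lessThan_iff) simp
    then show "of_nat ((Suc j + k) div n) * e (int k) =
        of_nat ((j + k) div n) * e (int k) + (if k = k0 then e (int k) else 0)"
      by (simp add: distrib_right)
  qed simp
  also have "\<dots> = (\<Sum>s = 1..j. e (- int s)) + e (int k0)"
    using k0(2) by (simp add: sum.distrib Suc)
  also have "e (int k0) = e (- int (Suc j))" unfolding k0 by (rule periodic) simp
  finally show ?case by simp
qed simp

lemma sum_columns:
  fixes f :: "nat \<Rightarrow> 'a :: comm_semiring_1"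
  assumes "\<And>i k. (i, k) \<in> \<alpha> \<longleftrightarrow> k < a i" "\<And>i. i \<ge> R \<Longrightarrow> a i = 0"
  shows "(\<Sum>(i, k)\<in>\<alpha>. f i) = (\<Sum>i<R. of_nat (a i) * f i)"
proof -
  have eq: "\<alpha> = Sigma {..<R} (\<lambda>i. {..<a i})"
  proof (intro set_eqI)
    fix b :: "nat \<times> nat" obtain i k where b: "b = (i, k)" by fastforce
    show "b \<in> \<alpha> \<longleftrightarrow> b \<in> Sigma {..<R} (\<lambda>i. {..<a i})"
      using assms(2)[of i] by (cases "i < R") (auto simp: b assms(1))
  qed
  show ?thesis unfolding eq by (subst sum.Sigma[symmetric]) auto
qed

text \<open>By the two preceding lemmas a box with first coordinate i contributes one variable for
  each of -1, ..., -i. After interchanging the sums, the variable at -s is counted by the boxes with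
  i at least s, and these count the boxes of a leg on diagonal -s, or s after the reflection used
  for \<mu>. This is how \<open>q_A\<close> enters the weight.\<close>

lemma A_stat_exponent:
  fixes e :: "int \<Rightarrow> expo"
  assumes "n \<ge> 1" and periodic: "\<And>r s. r mod int n = s mod int n \<Longrightarrow> e r = e s"
    and \<alpha>: "\<And>i k. (i, k) \<in> \<alpha> \<longleftrightarrow> k < a i" "\<And>i. i \<ge> R \<Longrightarrow> a i = 0" and "R \<le> N"
  shows "(\<Sum>k<n. of_nat (A_stat \<alpha> k n) * e (int k)) =
    (\<Sum>s = 1..N. of_nat (\<Sum>i | i < R \<and> s \<le> i. a i) * e (- int s))"
proof -
  have "(\<Sum>k<n. of_nat (A_stat \<alpha> k n) * e (int k)) =
      (\<Sum>(i, j)\<in>\<alpha>. \<Sum>k<n. of_nat ((i + k) div n) * e (int k))"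
    unfolding A_stat_def of_nat_sum sum_distrib_right
    by (subst sum.swap) (simp add: case_prod_beta)
  also have "\<dots> = (\<Sum>i<R. of_nat (a i) * (\<Sum>s = 1..i. e (- int s)))"
  proof -
    have "(\<Sum>k<n. of_nat ((i + k) div n) * e (int k)) = (\<Sum>s = 1..i. e (- int s))" for i
      by (rule sum_div_mult_ev[OF assms(1) periodic])
    then show ?thesis by (simp only:) (rule sum_columns[OF \<alpha>])
  qed
  also have "\<dots> = (\<Sum>i<R. \<Sum>s | s \<in> {1..N} \<and> s \<le> i. of_nat (a i) * e (- int s))"
  proof (rule sum.cong)
    fix i assume "i \<in> {..<R}"
    then have "{s. s \<in> {1..N} \<and> s \<le> i} = {1..i}" using \<open>R \<le> N\<close> by auto
    then show "of_nat (a i) * (\<Sum>s = 1..i. e (- int s)) = (\<Sum>s | s \<in> {1..N} \<and> s \<le> i. of_nat (a i) * e (- int s))"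
      by (simp add: sum_distrib_left)
  qed simp
  also have "\<dots> = (\<Sum>s = 1..N. \<Sum>i | i \<in> {..<R} \<and> s \<le> i. of_nat (a i) * e (- int s))"
    by (rule sum.swap_restrict) auto
  finally show ?thesis by (simp add: sum_distrib_right)
qed

lemma sum_by_parts:
  fixes f g :: "nat \<Rightarrow> 'a :: comm_ring"
  shows "(\<Sum>i<K. (f i - f (Suc i)) * g i) = f 0 * g 0 - f K * g K + (\<Sum>i<K. f (Suc i) * (g (Suc i) - g i))"
  by (induction K) (auto simp: algebra_simps)

lemma bij_betw_int_shift: "bij_betw (\<lambda>i. int i + 1 - int N) {..<2 * N} {1 - int N..int N}"
  by (rule bij_betw_byWitness[where f' = "\<lambda>t. nat (t - 1 + int N)"]) (auto simp: nat_less_iff)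

context vertex_data
begin

definition bound :: nat where
  "bound = radius + part lam 0 + lam_end 0 + part \<mu> 0 + part (conjugate \<mu>) 0"

lemma lam_end_bound: "lam_end j \<le> bound" "j \<ge> bound \<Longrightarrow> lam_end j = 0"
proof -
  show "lam_end j \<le> bound"
    using decseqD[OF decseq_part[OF is_partition_conjugate[OF lam]], of 0 j] by (simp add: bound_def)
  show "lam_end j = 0" if "j \<ge> bound"
    using part_conjugate_iff[OF lam, of 0 j] that by (simp add: bound_def)
qed

lemma mu_end_bound: "mu_end j \<le> bound" "j \<ge> bound \<Longrightarrow> mu_end j = 0"
proof -
  show "mu_end j \<le> bound"
    using decseqD[OF decseq_part[OF mu], of 0 j] by (simp add: bound_def)
  show "mu_end j = 0" if "j \<ge> bound"
    using part_conjugate_iff[OF mu, of j 0] that by (simp add: bound_def)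
qed

lemma mu_end_pos: "0 < mu_end j \<Longrightarrow> j < bound"
  using mu_end_bound(2)[of j] by (cases "j < bound") auto

lemma nu_bound: "(i, j) \<in> \<nu> \<Longrightarrow> i < bound \<and> j < bound"
  using mem_partition_iff[OF nu, of i j] mem_partition_iff[OF nu', of j i] part_le_radius[of j] part_le_radius[of i]
  by (auto simp: bound_def)

definition outer_height :: "(nat \<times> nat \<times> nat) set \<Rightarrow> nat \<Rightarrow> nat \<Rightarrow> nat" where
  "outer_height \<pi> i j = (if (i, j) \<in> \<nu> then 0 else height \<pi> i j)"

text \<open>The total of \<open>xi\<close> over the column at (i, j). Over a box of \<nu> the leg
  cancels the boxes, and only the corrections for the two other legs remain.\<close>

definition column :: "(nat \<times> nat \<times> nat) set \<Rightarrow> nat \<Rightarrow> nat \<Rightarrow> int" where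
  "column \<pi> i j = int (outer_height \<pi> i j) - int (lam_end j) - int (mu_end i)"

text \<open>Far out in the first or second coordinate a column is the cross-section of a single leg,
  which the correction cancels while the other leg is absent. Hence one cube carries the whole
  weight.\<close>

lemma column_bound:
  assumes \<pi>: "asymptotic_3d lam \<mu> \<nu> \<pi>"
  obtains M where "M \<ge> bound" "\<And>i j k. (i, j, k) \<in> \<pi> \<Longrightarrow> xi lam \<mu> \<nu> (i, j, k) \<noteq> 0 \<Longrightarrow> i < M \<and> j < M \<and> k < M"
    "\<And>i j. (i, j) \<notin> \<nu> \<Longrightarrow> height \<pi> i j \<le> M" "\<And>i j. M \<le> i \<or> M \<le> j \<Longrightarrow> column \<pi> i j = 0"
proof -
  obtain L where L: "\<And>i j k. (i, j, k) \<in> \<pi> \<Longrightarrow> (i < L \<or> (j, k) \<in> lam) \<and> (j < L \<or> (k, i) \<in> \<mu>) \<and> (k < L \<or> (i, j) \<in> \<nu>)"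
    using legs_bound[OF \<pi>] by blast
  have lamb: "j < bound \<and> k < bound" if "(j, k) \<in> lam" for j k
    using that lam_end_bound[of j] unfolding mem_lam_iff by (cases "j < bound") auto
  have mub: "i < bound \<and> k < bound" if "(k, i) \<in> \<mu>" for i k
    using that mu_end_bound[of i] unfolding mem_mu_iff by (cases "i < bound") auto
  define M where "M = L + bound"
  have h: "height \<pi> i j \<le> M" if "(i, j) \<notin> \<nu>" for i j
  proof (rule ccontr)
    assume "\<not> height \<pi> i j \<le> M"
    then have "(i, j, M) \<in> \<pi>" using mem_iff_less_height[OF \<pi> that] by simp
    then show False using L that by (force simp: M_def)
  qed
  have "i < M \<and> j < M \<and> k < M" if "(i, j, k) \<in> \<pi>" "xi lam \<mu> \<nu> (i, j, k) \<noteq> 0" for i j k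
    using that L[OF that(1)] lamb[of j k] mub[of k i] nu_bound[of i j]
    by (auto simp: xi_def M_def of_bool_def split: if_splits)
  moreover have "column \<pi> i j = 0" if "M \<le> i \<or> M \<le> j" for i j
  proof -
    have out: "(i, j) \<notin> \<nu>" using nu_bound[of i j] that by (auto simp: M_def)
    have "height \<pi> i j = lam_end j + mu_end i"
    proof (cases "M \<le> i")
      case True
      have "k < height \<pi> i j \<longleftrightarrow> k < lam_end j" for k
        using mem_iff_less_height[OF \<pi> out, of k] L[of i j k] legs_subset(1)[OF \<pi>, of j k i] True
        by (auto simp: mem_lam_iff M_def)
      then have "height \<pi> i j = lam_end j" by (metis less_irrefl linorder_neqE_nat)
      then show ?thesis using mu_end_bound(2)[of i] True by (simp add: M_def)
    next
      case False
      then have "M \<le> j" using that by simp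
      have "k < height \<pi> i j \<longleftrightarrow> k < mu_end i" for k
        using mem_iff_less_height[OF \<pi> out, of k] L[of i j k] legs_subset(2)[OF \<pi>, of k i j] \<open>M \<le> j\<close>
        by (auto simp: mem_mu_iff M_def)
      then have "height \<pi> i j = mu_end i" by (metis less_irrefl linorder_neqE_nat)
      then show ?thesis using lam_end_bound(2)[of j] \<open>M \<le> j\<close> by (simp add: M_def)
    qed
    then show ?thesis using out by (simp add: column_def outer_height_def)
  qed
  ultimately show thesis using h by (intro that[of M]) (auto simp: M_def)
qed

lemma sum_xi_column:
  assumes \<pi>: "asymptotic_3d lam \<mu> \<nu> \<pi>" and M: "M \<ge> bound" "(i, j) \<notin> \<nu> \<Longrightarrow> height \<pi> i j \<le> M"
  shows "(\<Sum>k | k < M \<and> (i, j, k) \<in> \<pi>. xi lam \<mu> \<nu> (i, j, k)) = column \<pi> i j"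
proof -
  have card_less: "{..<K} \<inter> {k. k < c} = {..<c}" if "c \<le> K" for c K :: nat
    using that by auto
  have xi: "xi lam \<mu> \<nu> (i, j, k) = 1 - of_bool ((i, j) \<in> \<nu>) - of_bool (k < lam_end j) - of_bool (k < mu_end i)" for k
    by (simp add: xi_def mem_lam_iff mem_mu_iff)
  have lp: "lam_end j \<le> M" and mp: "mu_end i \<le> M" using M(1) lam_end_bound(1)[of j] mu_end_bound(1)[of i] by simp_all
  show ?thesis
  proof (cases "(i, j) \<in> \<nu>")
    case True
    then have "{k. k < M \<and> (i, j, k) \<in> \<pi>} = {..<M}" using legs_subset(3)[OF \<pi>] by auto
    then show ?thesis using True lp mp
      by (simp add: xi sum_subtractf card_less column_def outer_height_def sum_negf)
  next
    case False
    let ?h = "height \<pi> i j"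
    have set: "{k. k < M \<and> (i, j, k) \<in> \<pi>} = {..<?h}"
      unfolding mem_iff_less_height[OF \<pi> False] using M(2)[OF False] by auto
    have "lam_end j \<le> ?h" "mu_end i \<le> ?h"
      using mem_iff_less_height[OF \<pi> False] legs_subset(1)[OF \<pi>, of j _ i] legs_subset(2)[OF \<pi>, of _ i j]
      unfolding mem_lam_iff mem_mu_iff by (meson not_le less_irrefl)+
    then show ?thesis unfolding set using False by (simp add: xi sum_subtractf card_less column_def outer_height_def)
  qed
qed

text \<open>Colour and variable depend only on i - j modulo n, so grouping by colour can give way to
  the diagonal itself; the third coordinate is then summed out inside the cube.\<close>

lemma weight_eq_column_sum:
  assumes \<pi>: "asymptotic_3d lam \<mu> \<nu> \<pi>" and n: "n \<ge> 1" and M: "M \<ge> bound"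
    "\<And>i j k. (i, j, k) \<in> \<pi> \<Longrightarrow> xi lam \<mu> \<nu> (i, j, k) \<noteq> 0 \<Longrightarrow> i < M \<and> j < M \<and> k < M"
    "\<And>i j. (i, j) \<notin> \<nu> \<Longrightarrow> height \<pi> i j \<le> M"
  shows "(\<Sum>a = 0..<int n. of_int (weight n lam \<mu> \<nu> \<pi> a) * ev n c a) =
    (\<Sum>(i, j)\<in>{..<M} \<times> {..<M}. of_int (column \<pi> i j) * ev n c (int i - int j))"
proof -
  let ?xi = "xi lam \<mu> \<nu>" and ?C = "\<lambda>(i, j, k). (int i - int j) mod int n"
  let ?Z = "{b. b \<in> \<pi> \<and> ?xi b \<noteq> 0}"
  let ?Y = "{(i, j, k). i < M \<and> j < M \<and> k < M \<and> (i, j, k) \<in> \<pi>}"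
  have finY: "finite ?Y" by (rule finite_subset[of _ "{..<M} \<times> {..<M} \<times> {..<M}"]) auto
  have sub: "?Z \<subseteq> ?Y"
  proof
    fix b assume b: "b \<in> ?Z"
    obtain i j k where [simp]: "b = (i, j, k)" by (cases b)
    show "b \<in> ?Y" using b M(2)[of i j k] by simp
  qed
  then have fin: "finite ?Z" using finY by (rule finite_subset)
  have w: "weight n lam \<mu> \<nu> \<pi> a = (\<Sum>b | b \<in> ?Z \<and> ?C b = a. ?xi b)" if "a \<in> {0..<int n}" for a
    unfolding weight_def
  proof (rule sum.cong)
    show "{(i, j, k). (i, j, k) \<in> \<pi> \<and> has_color n a (i, j) \<and> ?xi (i, j, k) \<noteq> 0} = {b \<in> ?Z. ?C b = a}"
      using that by (auto simp: has_color_def)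
  qed auto
  have "(\<Sum>a = 0..<int n. of_int (weight n lam \<mu> \<nu> \<pi> a) * ev n c a) =
      (\<Sum>a = 0..<int n. \<Sum>b | b \<in> ?Z \<and> ?C b = a. of_int (?xi b) * ev n c (?C b))"
    by (intro sum.cong refl) (simp add: w sum_distrib_right)
  also have "\<dots> = (\<Sum>b\<in>?Z. of_int (?xi b) * ev n c (?C b))"
    by (rule sum.group[OF fin]) (use n in auto)
  also have "\<dots> = (\<Sum>b\<in>?Z. of_int (?xi b) * ev n c (case b of (i, j, k) \<Rightarrow> int i - int j))"
    by (intro sum.cong refl arg_cong2[of _ _ _ _ "(*)"] ev_cong) auto
  also have "\<dots> = (\<Sum>b\<in>?Y. of_int (?xi b) * ev n c (case b of (i, j, k) \<Rightarrow> int i - int j))"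
    by (rule sum.mono_neutral_left[OF finY sub]) auto
  also have "\<dots> = (\<Sum>b\<in>Sigma ({..<M} \<times> {..<M}) (\<lambda>(i, j). {k. k < M \<and> (i, j, k) \<in> \<pi>}).
      case b of ((i, j), k) \<Rightarrow> of_int (?xi (i, j, k)) * ev n c (int i - int j))"
    by (rule sum.reindex_bij_witness[where j = "\<lambda>(i, j, k). ((i, j), k)" and i = "\<lambda>((i, j), k). (i, j, k)"]) auto
  also have "\<dots> = (\<Sum>(i, j)\<in>{..<M} \<times> {..<M}. \<Sum>k | k < M \<and> (i, j, k) \<in> \<pi>. of_int (?xi (i, j, k)) * ev n c (int i - int j))"
    by (subst sum.Sigma[symmetric]) (auto intro!: sum.cong)
  also have "\<dots> = (\<Sum>(i, j)\<in>{..<M} \<times> {..<M}. of_int (column \<pi> i j) * ev n c (int i - int j))"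
    by (intro sum.cong refl) (auto simp: sum_xi_column[OF \<pi> M(1,3), symmetric] sum_distrib_right)
  finally show ?thesis .
qed

text \<open>The number of boxes of the \<lambda>-leg on diagonal t: a box (j, k) of \<lambda> meets
  it at i = t + j, if this is nonnegative.\<close>

definition lam_legs :: "int \<Rightarrow> nat" where
  "lam_legs t = (\<Sum>j | j < bound \<and> - t \<le> int j. lam_end j)"

definition mu_legs :: "int \<Rightarrow> nat" where
  "mu_legs t = (\<Sum>i | i < bound \<and> t \<le> int i. mu_end i)"

lemma sum_column_diagonal:
  assumes \<pi>: "asymptotic_3d lam \<mu> \<nu> \<pi>" and "fin_supp (slice \<pi> t)"
    and M: "\<And>i j. M \<le> i \<or> M \<le> j \<Longrightarrow> column \<pi> i j = 0"
  shows "(\<Sum>(i, j) | i < M \<and> j < M \<and> int i - int j = t. column \<pi> i j) =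
    int (psize (slice \<pi> t)) - int (lam_legs t) - int (mu_legs t)"
proof -
  obtain L where L: "\<And>m. m \<ge> L \<Longrightarrow> slice \<pi> t m = 0" using assms(2) by (auto simp: fin_supp_def)
  \<comment> \<open>Large enough for the square of side M, the support of the slice beyond
    \<open>start t\<close>, and both legs; the absolute value of t allows for passing between the
    two coordinates of a diagonal.\<close>
  define K where "K = M + L + start t + bound + nat \<bar>t\<bar>"
  let ?I = "{i. i < K \<and> t \<le> int i}" and ?j = "\<lambda>i. nat (int i - t)"
  have "(\<Sum>(i, j) | i < M \<and> j < M \<and> int i - int j = t. column \<pi> i j) = (\<Sum>i\<in>?I. column \<pi> i (?j i))"
    by (rule sum.reindex_bij_witness_not_neutral[where S' = "{}" and T' = "{i \<in> ?I. M \<le> i \<or> M \<le> ?j i}" and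
          j = fst and i = "\<lambda>i. (i, ?j i)"]) (use M in \<open>auto simp: K_def\<close>)
  also have "\<dots> = (\<Sum>i\<in>?I. int (outer_height \<pi> i (?j i))) - (\<Sum>i\<in>?I. int (lam_end (?j i))) - (\<Sum>i\<in>?I. int (mu_end i))"
    by (simp add: column_def sum_subtractf)
  also have "(\<Sum>i\<in>?I. int (mu_end i)) = int (mu_legs t)"
    unfolding mu_legs_def of_nat_sum
    by (rule sum.mono_neutral_right) (auto simp: K_def dest: mu_end_pos)
  also have "(\<Sum>i\<in>?I. int (lam_end (?j i))) = int (lam_legs t)"
    unfolding lam_legs_def of_nat_sum
    by (rule sum.reindex_bij_witness_not_neutral[where T' = "{}" and S' = "{i \<in> ?I. bound \<le> ?j i}" and
          j = ?j and i = "\<lambda>j. nat (int j + t)"]) (auto simp: K_def lam_end_bound nat_less_iff)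
  also have "(\<Sum>i\<in>?I. int (outer_height \<pi> i (?j i))) = (\<Sum>i = start t..<start t + L. int (outer_height \<pi> i (?j i)))"
  proof (rule sum.mono_neutral_right)
    show "{start t..<start t + L} \<subseteq> ?I" using le_start[of t] by (auto simp: K_def)
    show "\<forall>i\<in>?I - {start t..<start t + L}. int (outer_height \<pi> i (?j i)) = 0"
    proof
      fix i assume i: "i \<in> ?I - {start t..<start t + L}"
      show "int (outer_height \<pi> i (?j i)) = 0"
      proof (cases "i < start t")
        case True
        then have "(i, ?j i) \<in> \<nu>" using i by (simp add: mem_nu_iff)
        then show ?thesis by (simp add: outer_height_def)
      next
        case False
        then have e: "start t + (i - start t) = i" "slice \<pi> t (i - start t) = 0" using i L by auto
        then show ?thesis unfolding slice_def outer_height_def by simp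
      qed
    qed
  qed simp
  also have "\<dots> = (\<Sum>m<L. int (slice \<pi> t m))"
  proof (rule sum.reindex_bij_witness[where j = "\<lambda>i. i - start t" and i = "\<lambda>m. start t + m"])
    fix i assume i: "i \<in> {start t..<start t + L}"
    then have "(i, ?j i) \<notin> \<nu>" and e: "start t + (i - start t) = i"
      using le_start[of t] by (auto simp: mem_nu_iff)
    then show "int (slice \<pi> t (i - start t)) = int (outer_height \<pi> i (?j i))"
      unfolding slice_def e by (simp add: outer_height_def)
  qed auto
  also have "\<dots> = int (psize (slice \<pi> t))" using psize_eq[OF L] by simp
  finally show ?thesis .
qed

lemma lam_legs_nonneg: "t \<ge> 0 \<Longrightarrow> lam_legs t = psize lam_end"
  unfolding lam_legs_def by (subst psize_eq[of bound]) (auto simp: lam_end_bound intro!: sum.cong)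

lemma mu_legs_nonpos: "t \<le> 0 \<Longrightarrow> mu_legs t = psize mu_end"
  unfolding mu_legs_def by (subst psize_eq[of bound]) (auto simp: mu_end_bound intro!: sum.cong)

lemma lam_legs_small: "t \<le> - int bound \<Longrightarrow> lam_legs t = 0"
  unfolding lam_legs_def by (rule sum.neutral) auto

lemma mu_legs_large: "t \<ge> int bound \<Longrightarrow> mu_legs t = 0"
  unfolding mu_legs_def by (rule sum.neutral) auto

lemma fin_supp_slice:
  assumes "\<pi> \<in> window N"
  shows "fin_supp (slice \<pi> t)"
proof -
  have \<pi>: "asymptotic_3d lam \<mu> \<nu> \<pi>" using assms by (simp add: window_def)
  have "fin_supp (slice \<pi> (- int N + int m))" for m
  proof (induction m)
    case 0
    then show ?case using assms fin_supp_part[OF mu] by (simp add: window_def)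
  next
    case (Suc m)
    then show ?case using step_fin_supp[OF slice_step[OF \<pi>, of "- int N + int m"]] by (simp add: algebra_simps)
  qed
  from this[of "nat (t + int N)"] show ?thesis
    using assms fin_supp_part[OF mu] by (cases "t \<le> - int N") (auto simp: window_def)
qed

lemma weight_eq_slice_sum:
  assumes \<pi>: "\<pi> \<in> window N" and n: "n \<ge> 1" and N: "bound \<le> N"
  shows "(\<Sum>a = 0..<int n. of_int (weight n lam \<mu> \<nu> \<pi> a) * ev n c a) =
    (\<Sum>t = 1 - int N..int N. of_int (int (psize (slice \<pi> t)) - int (lam_legs t) - int (mu_legs t)) * ev n c t)"
proof -
  have asym: "asymptotic_3d lam \<mu> \<nu> \<pi>" using \<pi> by (simp add: window_def)
  obtain M where M: "M \<ge> bound" "\<And>i j k. (i, j, k) \<in> \<pi> \<Longrightarrow> xi lam \<mu> \<nu> (i, j, k) \<noteq> 0 \<Longrightarrow> i < M \<and> j < M \<and> k < M"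
    "\<And>i j. (i, j) \<notin> \<nu> \<Longrightarrow> height \<pi> i j \<le> M" "\<And>i j. M \<le> i \<or> M \<le> j \<Longrightarrow> column \<pi> i j = 0"
    using column_bound[OF asym] by blast
  let ?S = "{..<M} \<times> {..<M}" and ?T = "{- int (M + N)..int (M + N)}"
  let ?d = "\<lambda>t. of_int (int (psize (slice \<pi> t)) - int (lam_legs t) - int (mu_legs t)) * ev n c t"
  have "(\<Sum>a = 0..<int n. of_int (weight n lam \<mu> \<nu> \<pi> a) * ev n c a) =
      (\<Sum>(i, j)\<in>?S. of_int (column \<pi> i j) * ev n c (int i - int j))"
    by (rule weight_eq_column_sum[OF asym n M(1-3)])
  also have "\<dots> = (\<Sum>t\<in>?T. \<Sum>b | b \<in> ?S \<and> (case b of (i, j) \<Rightarrow> int i - int j) = t.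
      case b of (i, j) \<Rightarrow> of_int (column \<pi> i j) * ev n c (int i - int j))"
    by (rule sum.group[symmetric]) auto
  also have "\<dots> = (\<Sum>t\<in>?T. ?d t)"
  proof (rule sum.cong)
    fix t
    have set: "{b. b \<in> ?S \<and> (case b of (i, j) \<Rightarrow> int i - int j) = t} = {(i, j). i < M \<and> j < M \<and> int i - int j = t}"
      by auto
    have "(\<Sum>b | b \<in> ?S \<and> (case b of (i, j) \<Rightarrow> int i - int j) = t.
        case b of (i, j) \<Rightarrow> of_int (column \<pi> i j) * ev n c (int i - int j)) =
        of_int (\<Sum>(i, j) | i < M \<and> j < M \<and> int i - int j = t. column \<pi> i j) * ev n c t"
      unfolding set of_int_sum sum_distrib_right by (rule sum.cong) auto
    then show "(\<Sum>b | b \<in> ?S \<and> (case b of (i, j) \<Rightarrow> int i - int j) = t.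
        case b of (i, j) \<Rightarrow> of_int (column \<pi> i j) * ev n c (int i - int j)) = ?d t"
      using sum_column_diagonal[OF asym fin_supp_slice[OF \<pi>], of M t] M(4) by simp
  qed simp
  \<comment> \<open>Beyond the window the slice is the full cross-section of one leg and the other
    leg is absent, so the summand vanishes.\<close>
  also have "\<dots> = (\<Sum>t = 1 - int N..int N. ?d t)"
  proof (rule sum.mono_neutral_right)
    show "\<forall>t\<in>?T - {1 - int N..int N}. ?d t = 0"
    proof
      fix t assume t: "t \<in> ?T - {1 - int N..int N}"
      show "?d t = 0"
      proof (cases "t \<le> - int N")
        case True
        then have "slice \<pi> t = mu_end" using \<pi> by (simp add: window_def)
        then show ?thesis using True N by (simp add: mu_legs_nonpos lam_legs_small)
      next
        case False
        then have "t \<ge> int N" using t by auto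
        then have "slice \<pi> t = lam_end" using \<pi> by (simp add: window_def)
        then show ?thesis using \<open>t \<ge> int N\<close> N by (simp add: lam_legs_nonneg mu_legs_large)
      qed
    qed
  qed auto
  finally show ?thesis .
qed

text \<open>Summation by parts, as consecutive values of \<open>Q n c\<close> differ by one
  variable. Since \<open>Q n c 0 = 0\<close>, the boundary terms at -N and N spread the size of
  \<mu> over the diagonals up to 0 and the size of \<lambda> over the positive ones.\<close>

lemma path_wt_slices:
  assumes \<pi>: "\<pi> \<in> window N"
  shows "path_wt (word (Q n c) N) mu_end (slices N \<pi>) =
    (\<Sum>t = 1 - int N..int N. of_int (int (psize (slice \<pi> t)) -
       (if t \<le> 0 then int (psize mu_end) else int (psize lam_end))) * ev n c t)"
proof -
  define S :: "int \<Rightarrow> expo" where "S t = of_int (int (psize (slice \<pi> t)))" for t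
  let ?g = "\<lambda>i. Q n c (int i - int N)" and ?f = "\<lambda>i. S (int i - int N)"
  have "path_wt (word (Q n c) N) mu_end (slices N \<pi>) = (\<Sum>i<2 * N. (?f i - ?f (Suc i)) * ?g i)"
    unfolding path_wt_eq_sum[of "slices N \<pi>" "word (Q n c) N", simplified] length_word
  proof (rule sum.cong)
    fix i assume "i \<in> {..<2 * N}"
    then have i: "i < 2 * N" by simp
    have "slices N \<pi> ! i = slice \<pi> (int (Suc i) - int N)"
      using nth_slices[OF \<pi>, of "Suc i"] i by (simp del: of_nat_Suc)
    then show "step_wt (snd (word (Q n c) N ! i)) ((mu_end # slices N \<pi>) ! i) (slices N \<pi> ! i) = (?f i - ?f (Suc i)) * ?g i"
      using nth_slices[OF \<pi>, of i] i by (simp add: step_wt_def nth_word S_def)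
  qed simp
  also have "\<dots> = ?f 0 * ?g 0 - ?f (2 * N) * ?g (2 * N) + (\<Sum>i<2 * N. ?f (Suc i) * (?g (Suc i) - ?g i))"
    by (rule sum_by_parts)
  also have "(\<Sum>i<2 * N. ?f (Suc i) * (?g (Suc i) - ?g i)) =
      (\<Sum>i<2 * N. S (int i + 1 - int N) * ev n c (int i + 1 - int N))"
    using Q_step[of n c "int i - int N" for i] by (simp add: algebra_simps)
  also have "\<dots> = (\<Sum>t = 1 - int N..int N. S t * ev n c t)"
    by (rule sum.reindex_bij_betw[OF bij_betw_int_shift])
  also have "?f 0 = of_nat (psize mu_end)" using \<pi> by (simp add: window_def S_def)
  also have "?f (2 * N) = of_nat (psize lam_end)" using \<pi> by (simp add: window_def S_def)
  also have "?g 0 = - (\<Sum>t = 1 - int N..0. ev n c t)"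
    by (cases "N = 0") (auto simp: Q_def algebra_simps)
  also have "?g (2 * N) = (\<Sum>t = 1..int N. ev n c t)" by (simp add: Q_def)
  also have "of_nat (psize mu_end) * - (\<Sum>t = 1 - int N..0. ev n c t) - of_nat (psize lam_end) * (\<Sum>t = 1..int N. ev n c t)
      + (\<Sum>t = 1 - int N..int N. S t * ev n c t) =
      (\<Sum>t = 1 - int N..int N. S t * ev n c t) -
      ((\<Sum>t = 1 - int N..0. of_nat (psize mu_end) * ev n c t) + (\<Sum>t = 1..int N. of_nat (psize lam_end) * ev n c t))"
    by (simp add: sum_distrib_left)
  also have "(\<Sum>t = 1 - int N..0. of_nat (psize mu_end) * ev n c t) + (\<Sum>t = 1..int N. of_nat (psize lam_end) * ev n c t) =
      (\<Sum>t = 1 - int N..int N. of_int (if t \<le> 0 then int (psize mu_end) else int (psize lam_end)) * ev n c t)"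
  proof -
    have un: "{1 - int N..int N} = {1 - int N..0} \<union> {1..int N}" by auto
    show ?thesis unfolding un by (subst sum.union_disjoint) (auto intro!: arg_cong2[of _ _ _ _ "(+)"] sum.cong)
  qed
  finally show ?thesis by (simp add: S_def sum_subtractf left_diff_distrib)
qed

text \<open>Both sides subtract a correction from the slice sizes. The corrections differ by the
  \<lambda>-leg on negative diagonals, by the \<mu>-leg on positive ones, and by all of \<lambda> on
  diagonal 0, which both legs meet fully while the path subtracts \<mu> alone.\<close>

lemma weight_eq_path_wt:
  assumes \<pi>: "\<pi> \<in> window N" and n: "n \<ge> 1" and N: "bound \<le> N" "1 \<le> N"
  shows "(\<Sum>a = 0..<int n. of_int (weight n lam \<mu> \<nu> \<pi> a) * ev n c a) =
    path_wt (word (Q n c) N) mu_end (slices N \<pi>) - (of_nat (psize lam_end) * ev n c 0 +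
      (\<Sum>k<n. of_nat (A_stat lam k n) * ev n c (int k)) +
      (\<Sum>k<n. of_nat (A_stat (conjugate \<mu>) k n) * ev n c (- int k)))"
proof -
  let ?l = "\<lambda>t. of_nat (lam_legs t) * ev n c t" and ?m = "\<lambda>t. of_nat (mu_legs t) * ev n c t"
  have A1: "(\<Sum>k<n. of_nat (A_stat lam k n) * ev n c (int k)) = (\<Sum>t = 1 - int N..-1. ?l t)"
  proof -
    have "(\<Sum>k<n. of_nat (A_stat lam k n) * ev n c (int k)) =
        (\<Sum>s = 1..N. of_nat (\<Sum>i | i < bound \<and> s \<le> i. lam_end i) * ev n c (- int s))"
      by (rule A_stat_exponent[OF n _ mem_lam_iff lam_end_bound(2) N(1)]) (auto intro: ev_cong)
    also have "\<dots> = (\<Sum>s = 1..N. ?l (- int s))" by (simp add: lam_legs_def)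
    also have "\<dots> = (\<Sum>t = - int N..-1. ?l t)"
      by (rule sum.reindex_bij_witness[where j = "\<lambda>s. - int s" and i = "\<lambda>t. nat (- t)"]) auto
    also have "\<dots> = (\<Sum>t = 1 - int N..-1. ?l t)"
      using N by (intro sum.mono_neutral_right) (auto simp: lam_legs_small)
    finally show ?thesis .
  qed
  have A2: "(\<Sum>k<n. of_nat (A_stat (conjugate \<mu>) k n) * ev n c (- int k)) = (\<Sum>t = 1..int N. ?m t)"
  proof -
    have "(\<Sum>k<n. of_nat (A_stat (conjugate \<mu>) k n) * ev n c (- int k)) =
        (\<Sum>s = 1..N. of_nat (\<Sum>i | i < bound \<and> s \<le> i. mu_end i) * ev n c (- (- int s)))"
      by (rule A_stat_exponent[OF n, where e = "\<lambda>r. ev n c (- r)"])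
        (auto simp: mem_mu_iff mu_end_bound N intro!: ev_cong mod_minus_cong)
    also have "\<dots> = (\<Sum>s = 1..N. ?m (int s))" by (simp add: mu_legs_def)
    also have "\<dots> = (\<Sum>t = 1..int N. ?m t)"
      by (rule sum.reindex_bij_witness[where j = "\<lambda>s. int s" and i = nat]) auto
    finally show ?thesis .
  qed
  let ?P = "\<lambda>t. int (psize (slice \<pi> t)) - (if t \<le> 0 then int (psize mu_end) else int (psize lam_end))"
  let ?W = "\<lambda>t. int (psize (slice \<pi> t)) - int (lam_legs t) - int (mu_legs t)"
  have un: "{1 - int N..int N} = {1 - int N..-1} \<union> ({0} \<union> {1..int N})" using N(2) by auto
  have "(\<Sum>t = 1 - int N..int N. of_int (?P t - ?W t) * ev n c t) =
      (\<Sum>t = 1 - int N..-1. of_int (?P t - ?W t) * ev n c t) +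
      (of_int (?P 0 - ?W 0) * ev n c 0 + (\<Sum>t = 1..int N. of_int (?P t - ?W t) * ev n c t))"
    unfolding un by (subst sum.union_disjoint) (auto simp: sum.union_disjoint)
  also have "(\<Sum>t = 1 - int N..-1. of_int (?P t - ?W t) * ev n c t) = (\<Sum>t = 1 - int N..-1. ?l t)"
    by (intro sum.cong) (auto simp: mu_legs_nonpos)
  also have "(\<Sum>t = 1..int N. of_int (?P t - ?W t) * ev n c t) = (\<Sum>t = 1..int N. ?m t)"
    by (intro sum.cong) (auto simp: lam_legs_nonneg)
  also have "?P 0 - ?W 0 = int (psize lam_end)" by (simp add: mu_legs_nonpos lam_legs_nonneg)
  finally show ?thesis
    unfolding weight_eq_slice_sum[OF \<pi> n N(1)] path_wt_slices[OF \<pi>] A1 A2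
    by (simp add: sum_subtractf left_diff_distrib algebra_simps)
qed

end

section \<open>The vertex as a product\<close>

definition inf_prod :: "nat \<Rightarrow> 'a set \<Rightarrow> ('a \<Rightarrow> laurent) \<Rightarrow> laurent" where
  "inf_prod n A g = (SOME l. \<forall>S. exhausts S A \<longrightarrow> bconv n (\<lambda>N. \<Prod>i\<in>S N. g i) l)"

lemma bconv_inf_prod:
  assumes "\<And>i. i \<in> A \<Longrightarrow> near1 n (w i) (g i)" "\<And>d. finite {i\<in>A. w i \<le> d}" "exhausts S A"
  shows "bconv n (\<lambda>N. \<Prod>i\<in>S N. g i) (inf_prod n A g)"
proof -
  have "\<exists>l. \<forall>S. exhausts S A \<longrightarrow> bconv n (\<lambda>N. \<Prod>i\<in>S N. g i) l"
    using infinite_product_exists[OF assms(1,2)] by metis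
  from someI_ex[OF this] show ?thesis unfolding inf_prod_def using assms(3) by blast
qed

text \<open>A summand common to all labels is multiplied by the total decrease, because the sizes
  telescope along the descent. It splits off the power of q_0.\<close>

lemma dsum_shift:
  "dsum (map (\<lambda>j. y j + f) js) a b = mono_of (step_wt f a b) * dsum (map y js) a b"
proof (induction js arbitrary: a)
  case Nil
  then show ?case by (simp add: step_wt_def)
next
  case (Cons j js)
  have "step_wt (y j + f) a k + step_wt f k b = step_wt f a b + step_wt (y j) a k" for k
    by (simp add: step_wt_def algebra_simps)
  then have "mono_of (step_wt (y j + f) a k) * mono_of (step_wt f k b) = mono_of (step_wt f a b) * mono_of (step_wt (y j) a k)" for k
    by (simp flip: mono_of_add)
  then show ?case by (simp add: Cons sum_distrib_left flip: mult.assoc)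
qed

lemma dsum_nonzero:
  "dsum es a b \<noteq> 0 \<Longrightarrow> decseq a \<Longrightarrow> decseq b \<and> (\<forall>j. b j \<le> a j)"
proof (induction es arbitrary: a)
  case (Cons e es)
  then have "(\<Sum>k | interlaced a k. mono_of (step_wt e a k) * dsum es k b) \<noteq> 0" by simp
  then obtain k where "k \<in> {k. interlaced a k}" "mono_of (step_wt e a k) * dsum es k b \<noteq> 0"
    by (rule sum.not_neutral_contains_not_neutral)
  then have k: "interlaced a k" "dsum es k b \<noteq> 0" by auto
  have ka: "k j \<le> a j" "a (Suc j) \<le> k j" for j using k(1) by (auto simp: interlaced_def)
  then have "decseq k" by (intro decseq_SucI) (meson order_trans)
  with Cons.IH[OF k(2)] ka show ?case by (meson order_trans)
qed (auto split: if_splits)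

lemma word_prod_map:
  fixes xs :: "int list"
  assumes "sorted_wrt (<) xs"
  shows "word_prod (map (\<lambda>t. (P t, q t)) xs) =
    (\<Prod>(s, t) | s \<in> set xs \<and> t \<in> set xs \<and> s < t \<and> \<not> P s \<and> P t. geo (q t - q s))"
  using assms
proof (induction xs)
  case (Cons x xs)
  let ?S = "\<lambda>xs. {(s, t). s \<in> set xs \<and> t \<in> set xs \<and> s < t \<and> \<not> P s \<and> P t}"
  have x: "x < y" if "y \<in> set xs" for y using Cons.prems that by simp
  have d: "distinct xs" using Cons.prems by (simp add: strict_sorted_iff)
  have fin: "finite (?S xs)" by (rule finite_subset[of _ "set xs \<times> set xs"]) auto
  have eq: "?S (x # xs) = (if P x then {} else (\<lambda>t. (x, t)) ` {t \<in> set xs. P t}) \<union> ?S xs"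
    using x by (auto dest: order.strict_trans)
  have "(\<Prod>(s, t)\<in>?S (x # xs). geo (q t - q s)) =
      (if P x then 1 else \<Prod>t | t \<in> set xs \<and> P t. geo (q t - q x)) * (\<Prod>(s, t)\<in>?S xs. geo (q t - q s))"
  proof (cases "P x")
    case True
    then show ?thesis unfolding eq by simp
  next
    case False
    have "(\<Prod>(s, t)\<in>(\<lambda>t. (x, t)) ` {t \<in> set xs. P t}. geo (q t - q s)) = (\<Prod>t | t \<in> set xs \<and> P t. geo (q t - q x))"
      by (subst prod.reindex) (auto simp: inj_on_def)
    moreover have "x \<notin> set xs" using x by blast
    then have "(\<lambda>t. (x, t)) ` {t \<in> set xs. P t} \<inter> ?S xs = {}" by auto
    ultimately show ?thesis unfolding eq using False fin by (subst prod.union_disjoint) auto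
  qed
  moreover have "(\<Prod>(d, f)\<leftarrow>filter fst (map (\<lambda>t. (P t, q t)) xs). geo (f - q x)) =
      (\<Prod>t | t \<in> set xs \<and> P t. geo (q t - q x))"
  proof -
    have "(\<Prod>(d, f)\<leftarrow>filter fst (map (\<lambda>t. (P t, q t)) xs). geo (f - q x)) = (\<Prod>t\<leftarrow>filter P xs. geo (q t - q x))"
      by (simp add: filter_map comp_def)
    also have "\<dots> = (\<Prod>t\<in>set (filter P xs). geo (q t - q x))"
      using d by (intro prod.distinct_set_conv_list[symmetric]) simp
    finally show ?thesis by simp
  qed
  ultimately show ?case using Cons by simp
qed simp

lemma
  assumes A: "admissible n A w" and e: "bounded_expo n B e"
  shows admissible_shift: "admissible n A (\<lambda>a. w a + e)"
    and gf_shift: "gf A (\<lambda>a. w a + e) = gf A w * mono_of e"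
proof -
  have adm: "admissible n {()} (\<lambda>_. e)" using e by (auto simp: admissible_def)
  have bij: "bij_betw (\<lambda>a. (a, ())) A (A \<times> {()})" by (rule bij_betw_byWitness[where f' = fst]) auto
  show "admissible n A (\<lambda>a. w a + e)"
    by (rule admissible_bij_betw[OF bij _ admissible_Times[OF A adm]]) simp
  have "gf A (\<lambda>a. w a + e) = gf (A \<times> {()}) (\<lambda>(a, b). w a + e)"
    by (rule gf_bij_betw[OF bij]) simp
  then show "gf A (\<lambda>a. w a + e) = gf A w * mono_of e"
    using gf_Times[OF A adm] by (simp add: gf_finite)
qed

text \<open>Restricts the variables without naming a lower bound. For finite sets this already gives
  admissibility, so no explicit bounds on path weights are computed.\<close>

definition in_vars :: "nat \<Rightarrow> expo \<Rightarrow> bool" where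
  "in_vars n e \<longleftrightarrow> (\<forall>i\<ge>n. Poly_Mapping.lookup e i = 0)"

lemma in_vars_bounded: "in_vars n e \<Longrightarrow> \<exists>B. bounded_expo n B e"
proof -
  assume e: "in_vars n e"
  let ?B = "Min (insert 0 (Poly_Mapping.lookup e ` {..<n}))"
  have "Poly_Mapping.keys e \<subseteq> {..<n}" using e by (auto simp: in_vars_def in_keys_iff) (metis not_le)
  moreover have "?B \<le> Poly_Mapping.lookup e i" for i
    using e by (cases "i < n") (auto simp: in_vars_def intro: Min_le)
  ultimately show ?thesis unfolding bounded_expo_def by blast
qed

lemma in_vars_add: "in_vars n a \<Longrightarrow> in_vars n b \<Longrightarrow> in_vars n (a + b)"
  by (simp add: in_vars_def lookup_add)

lemma in_vars_0: "in_vars n 0"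
  by (simp add: in_vars_def)

lemma in_vars_uminus: "in_vars n a \<Longrightarrow> in_vars n (- a)"
  by (simp add: in_vars_def)

lemma in_vars_diff: "in_vars n a \<Longrightarrow> in_vars n b \<Longrightarrow> in_vars n (a - b)"
  by (simp add: in_vars_def lookup_minus)

lemma in_vars_of_int_mult: "in_vars n a \<Longrightarrow> in_vars n (of_int c * a)"
  by (simp add: in_vars_def lookup_of_int_mult)

lemma in_vars_of_nat_mult: "in_vars n a \<Longrightarrow> in_vars n (of_nat c * a)"
  using in_vars_of_int_mult[of n a "int c"] by simp

lemma in_vars_sum: "(\<And>a. a \<in> A \<Longrightarrow> in_vars n (f a)) \<Longrightarrow> in_vars n (sum f A)"
  by (induction A rule: infinite_finite_induct) (auto intro: in_vars_add in_vars_0)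

lemma in_vars_ev: "n \<ge> 1 \<Longrightarrow> in_vars n (ev n c r)"
  by (auto simp: in_vars_def ev_def lookup_single when_def nat_less_iff dest: leD)

lemma in_vars_Q: "n \<ge> 1 \<Longrightarrow> in_vars n (Q n c t)"
  by (simp add: Q_def in_vars_sum in_vars_ev in_vars_uminus)

lemma in_vars_path_wt: "\<forall>x\<in>set w. in_vars n (snd x) \<Longrightarrow> in_vars n (path_wt w a p)"
  by (induction w a p rule: path_wt.induct)
    (simp_all add: step_wt_def in_vars_add in_vars_of_int_mult in_vars_0 del: of_int_diff)

lemma admissible_finite_in_vars:
  assumes "finite A" "\<And>a. a \<in> A \<Longrightarrow> in_vars n (w a)"
  shows "admissible n A w"
proof -
  have "\<forall>a\<in>A. \<exists>B. bounded_expo n B (w a)" using assms(2) in_vars_bounded by blast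
  then obtain b where "\<forall>a\<in>A. bounded_expo n (b a) (w a)" by (rule bchoice[THEN exE])
  then have b: "\<And>a. a \<in> A \<Longrightarrow> bounded_expo n (b a) (w a)" by blast
  have "bounded_expo n (Min (insert 0 (b ` A))) (w a)" if "a \<in> A" for a
    using that assms(1) by (intro bounded_expo_mono[OF b order_refl]) (auto intro: Min_le)
  then show ?thesis by (rule admissible_finite[OF assms(1)])
qed

section \<open>Pairs of boundary edges and their product\<close>

context boundary
begin

definition pairs :: "(int \<times> int) set" where
  "pairs = {(s, t). s < t \<and> s \<notin> range down_edge \<and> t \<in> range down_edge}"

lemma not_down_edge_less: "s \<notin> range down_edge \<Longrightarrow> s < int radius"
proof -
  assume "s \<notin> range down_edge"
  then obtain j where "s = up_edge j" using range_up_edge by blast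
  then show "s < int radius" using up_edge_bounds(1)[of j] by simp
qed

lemma down_edge_ge: "t \<in> range down_edge \<Longrightarrow> - int radius \<le> t"
proof -
  assume "t \<in> range down_edge"
  then obtain j where "t = down_edge j" by blast
  then show "- int radius \<le> t" using down_edge_bounds(1)[of j] by simp
qed

lemma down_edge_less_iff: "radius \<le> N \<Longrightarrow> down_edge j < int N \<longleftrightarrow> j < N"
  using less_start_iff[of j "int N"] start_large[of "int N"] by simp

lemma part_eq_0: "radius \<le> j \<Longrightarrow> part \<nu> j = 0"
  using part_conjugate_iff[OF nu, of j 0] part_le_radius(2)[of 0] by simp

lemma up_edge_ge_iff: "radius \<le> N \<Longrightarrow> - int N \<le> up_edge j \<longleftrightarrow> j < N"
  using part_eq_0[of j] by (cases "radius \<le> j") (auto simp: up_edge_def)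

text \<open>From the radius on, a window contains precisely the first N edges of each kind. This is
  where N tableau variables on either side come from.\<close>

lemma filter_down_edges:
  assumes "radius \<le> N"
  shows "filter (\<lambda>t. t \<in> range down_edge) [- int N..int N - 1] = map down_edge [0..<N]"
proof (rule sorted_distinct_set_unique)
  show "sorted (filter (\<lambda>t. t \<in> range down_edge) [- int N..int N - 1])" by (simp add: sorted_wrt_filter)
  show "sorted (map down_edge [0..<N])"
    using strict_mono_less_eq[OF strict_mono_down_edge] by (simp add: sorted_map sorted_wrt_upt sorted_wrt_mono_rel[of _ "(<)"])
  show "distinct (map down_edge [0..<N])"
    using strict_mono_imp_inj_on[OF strict_mono_down_edge] by (simp add: distinct_map)
  show "set (filter (\<lambda>t. t \<in> range down_edge) [- int N..int N - 1]) = set (map down_edge [0..<N])"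
  proof (intro set_eqI)
    fix t
    have "t \<in> range down_edge \<and> - int N \<le> t \<and> t < int N \<longleftrightarrow> t \<in> down_edge ` {..<N}"
    proof
      assume "t \<in> range down_edge \<and> - int N \<le> t \<and> t < int N"
      then obtain j where "t = down_edge j" "t < int N" by blast
      then show "t \<in> down_edge ` {..<N}" using down_edge_less_iff[OF assms, of j] by simp
    next
      assume "t \<in> down_edge ` {..<N}"
      then obtain j where j: "t = down_edge j" "j < N" by blast
      then have "t \<in> range down_edge" "t < int N" using down_edge_less_iff[OF assms, of j] by auto
      then show "t \<in> range down_edge \<and> - int N \<le> t \<and> t < int N" using down_edge_ge[of t] assms by simp
    qed
    then show "t \<in> set (filter (\<lambda>t. t \<in> range down_edge) [- int N..int N - 1]) \<longleftrightarrow> t \<in> set (map down_edge [0..<N])"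
      by (auto simp: atLeast0LessThan)
  qed
qed simp

lemma filter_up_edges:
  assumes "radius \<le> N"
  shows "filter (\<lambda>t. t \<notin> range down_edge) [- int N..int N - 1] = rev (map up_edge [0..<N])"
proof (rule sorted_distinct_set_unique)
  show "sorted (filter (\<lambda>t. t \<notin> range down_edge) [- int N..int N - 1])" by (simp add: sorted_wrt_filter)
  show "sorted (rev (map up_edge [0..<N]))"
    unfolding sorted_wrt_rev sorted_wrt_map
    by (rule sorted_wrt_mono_rel[of _ "(<)"]) (auto intro: less_imp_le strict_mono_up_edge)
  have "inj up_edge" using strict_mono_up_edge by (metis injI linorder_neqE_nat order_less_irrefl)
  then show "distinct (rev (map up_edge [0..<N]))" by (simp add: distinct_map inj_on_subset[OF _ subset_UNIV])
  show "set (filter (\<lambda>t. t \<notin> range down_edge) [- int N..int N - 1]) = set (rev (map up_edge [0..<N]))"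
  proof (intro set_eqI)
    fix t
    have "t \<notin> range down_edge \<and> - int N \<le> t \<and> t < int N \<longleftrightarrow> t \<in> up_edge ` {..<N}"
      unfolding range_up_edge[symmetric]
    proof
      assume "t \<in> range up_edge \<and> - int N \<le> t \<and> t < int N"
      then obtain j where "t = up_edge j" "- int N \<le> t" by blast
      then show "t \<in> up_edge ` {..<N}" using up_edge_ge_iff[OF assms, of j] by simp
    next
      assume "t \<in> up_edge ` {..<N}"
      then obtain j where j: "t = up_edge j" "j < N" by blast
      then have "t \<in> range up_edge" "- int N \<le> t" using up_edge_ge_iff[OF assms, of j] by auto
      then show "t \<in> range up_edge \<and> - int N \<le> t \<and> t < int N"
        using not_down_edge_less[of t] range_up_edge[of t] assms by simp
    qed
    then show "t \<in> set (filter (\<lambda>t. t \<notin> range down_edge) [- int N..int N - 1]) \<longleftrightarrow> t \<in> set (rev (map up_edge [0..<N]))"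
      by (auto simp: atLeast0LessThan)
  qed
qed simp

text \<open>Up edges are bounded above and down edges below, so a bounded gap confines both members
  of a pair.\<close>

lemma finite_pairs: "finite {(s, t) \<in> pairs. t - s \<le> d}"
proof (rule finite_subset)
  show "{(s, t) \<in> pairs. t - s \<le> d} \<subseteq> {- int radius - d..int radius} \<times> {- int radius..int radius + d}"
  proof clarify
    fix s t assume st: "(s, t) \<in> pairs" "t - s \<le> d"
    then have "s < int radius" "- int radius \<le> t" "s < t"
      using not_down_edge_less[of s] down_edge_ge[of t] by (auto simp: pairs_def)
    then show "s \<in> {- int radius - d..int radius} \<and> t \<in> {- int radius..int radius + d}" using st(2) by auto
  qed
qed simp

lemma near1_pair:
  "n \<ge> 1 \<Longrightarrow> s < t \<Longrightarrow> near1 n (t - s) (geo (Q n c t - Q n c s))"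
  using near1_geo[OF bounded_Q_diff[of n s t c] Q_diff_ne_0[of s t n c]] by (simp add: deg_diff deg_Q)

definition window_pairs :: "nat \<Rightarrow> (int \<times> int) set" where
  "window_pairs N = {(s, t) \<in> pairs. - int N \<le> s \<and> t < int N}"

lemma exhausts_window_pairs: "exhausts window_pairs pairs"
  unfolding exhausts_def
proof (intro conjI allI ballI)
  show "finite (window_pairs N)" for N
    by (rule finite_subset[of _ "{- int N..int N} \<times> {- int N..int N}"]) (auto simp: window_pairs_def pairs_def)
  show "window_pairs N \<subseteq> pairs" for N by (auto simp: window_pairs_def)
  fix p assume p: "p \<in> pairs"
  obtain s t where [simp]: "p = (s, t)" by fastforce
  have "p \<in> window_pairs N" if "N \<ge> nat \<bar>s\<bar> + nat \<bar>t\<bar> + 1" for N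
    using p that by (auto simp: window_pairs_def)
  then show "\<forall>\<^sub>F N in sequentially. p \<in> window_pairs N" by (auto simp: eventually_sequentially)
qed

definition pair_prod :: "nat \<Rightarrow> int \<Rightarrow> laurent" where
  "pair_prod n c = inf_prod n pairs (\<lambda>(s, t). geo (Q n c t - Q n c s))"

lemma bconv_pair_prod:
  assumes "n \<ge> 1" "exhausts S pairs"
  shows "bconv n (\<lambda>N. \<Prod>(s, t)\<in>S N. geo (Q n c t - Q n c s)) (pair_prod n c)"
  unfolding pair_prod_def
proof (rule bconv_inf_prod[where w = "\<lambda>(s, t). t - s", OF _ _ assms(2)])
  show "near1 n (case p of (s, t) \<Rightarrow> t - s) (case p of (s, t) \<Rightarrow> geo (Q n c t - Q n c s))" if "p \<in> pairs" for p
    using that assms(1) by (auto simp: pairs_def near1_pair)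
  have "{p \<in> pairs. (case p of (s, t) \<Rightarrow> t - s) \<le> d} = {(s, t) \<in> pairs. t - s \<le> d}" for d by auto
  then show "finite {p \<in> pairs. (case p of (s, t) \<Rightarrow> t - s) \<le> d}" for d using finite_pairs by simp
qed

end

section \<open>The generating function of a window and its limit\<close>

context vertex_data
begin

lemma word_ok_word:
  assumes "n \<ge> 1"
  shows "word_ok n (word (Q n c) N)"
proof -
  have "word_ok n (map (\<lambda>t. (t \<in> range down_edge, Q n c t)) xs)" if "sorted_wrt (<) xs" for xs
    using that
  proof (induction xs)
    case (Cons s xs)
    have "bounded_expo n 0 (Q n c t - Q n c s) \<and> Q n c t \<noteq> Q n c s" if "t \<in> set xs" for t
    proof -
      have "s < t" using Cons.prems that by simp
      then show ?thesis using bounded_Q_diff[OF assms, of s t c] Q_diff_ne_0[of s t n c] by simp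
    qed
    then show ?case using Cons by auto
  qed simp
  then show ?thesis by (simp add: word_def)
qed

lemma word_prod_word: "word_prod (word (Q n c) N) = (\<Prod>(s, t)\<in>window_pairs N. geo (Q n c t - Q n c s))"
  unfolding word_def by (subst word_prod_map) (auto simp: window_pairs_def pairs_def intro!: prod.cong)

definition prefactor :: "nat \<Rightarrow> int \<Rightarrow> expo" where
  "prefactor n c = of_nat (psize lam_end) * ev n c 0 + (\<Sum>k<n. of_nat (A_stat lam k n) * ev n c (int k)) +
     (\<Sum>k<n. of_nat (A_stat (conjugate \<mu>) k n) * ev n c (- int k))"

lemma in_vars_prefactor: "n \<ge> 1 \<Longrightarrow> in_vars n (- prefactor n c)"
  unfolding prefactor_def
  by (intro in_vars_uminus in_vars_add in_vars_sum in_vars_of_nat_mult in_vars_ev)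

definition weight_expo :: "nat \<Rightarrow> int \<Rightarrow> (nat \<times> nat \<times> nat) set \<Rightarrow> expo" where
  "weight_expo n c \<pi> = (\<Sum>a = 0..<int n. of_int (weight n lam \<mu> \<nu> \<pi> a) * ev n c a)"

text \<open>In a window the only infinite sums are the geometric series, which sorting has already
  separated. Finiteness of the sorted paths gives the summability from which everything else is
  pulled back.\<close>

lemma
  assumes n: "n \<ge> 1" and N: "bound \<le> N" "1 \<le> N"
  defines "P \<equiv> {\<eta>. is_partition \<eta> \<and> \<eta> \<subseteq> \<mu>}"
  shows admissible_window: "admissible n (window N) (weight_expo n c)"
    and gf_window: "gf (window N) (weight_expo n c) =
      (\<Prod>(s, t)\<in>window_pairs N. geo (Q n c t - Q n c s)) *
      (\<Sum>\<eta>\<in>P. dsum (map (\<lambda>j. Q n c (down_edge j)) [0..<N]) mu_end (part \<eta>) *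
        (mono_of (step_wt (ev n c 0) lam_end (part \<eta>)) *
         dsum (map (\<lambda>j. - Q n c (up_edge j) - ev n c 0) [0..<N]) lam_end (part \<eta>))) * mono_of (- prefactor n c)"
proof -
  let ?w = "word (Q n c) N"
  let ?sw = "filter fst ?w @ filter (\<lambda>x. \<not> fst x) ?w"
  define ds where "ds = map (\<lambda>j. Q n c (down_edge j)) [0..<N]"
  define us where "us = rev (map (\<lambda>j. Q n c (up_edge j)) [0..<N])"
  have rN: "radius \<le> N" using N(1) by (simp add: bound_def)
  have down: "filter fst ?w = map (Pair True) ds"
  proof -
    have "filter fst ?w = map (\<lambda>t. (True, Q n c t)) (filter (\<lambda>t. t \<in> range down_edge) [- int N..int N - 1])"
      by (simp add: word_def filter_map comp_def)
    then show ?thesis unfolding filter_down_edges[OF rN] by (simp add: ds_def)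
  qed
  have up: "filter (\<lambda>x. \<not> fst x) ?w = map (Pair False) us"
  proof -
    have "filter (\<lambda>x. \<not> fst x) ?w = map (\<lambda>t. (False, Q n c t)) (filter (\<lambda>t. t \<notin> range down_edge) [- int N..int N - 1])"
      by (simp add: word_def filter_map comp_def)
    then show ?thesis unfolding filter_up_edges[OF rN] by (simp add: us_def rev_map)
  qed
  have fmu: "fin_supp mu_end" and flam: "fin_supp lam_end"
    using fin_supp_part mu is_partition_conjugate[OF lam] by auto
  have fin: "finite (paths ?sw mu_end lam_end)"
    unfolding down up by (rule sum_down_up_paths(1)[OF fmu flam])
  have adm_sw: "admissible n (paths ?sw mu_end lam_end) (path_wt ?sw mu_end)"
    by (rule admissible_finite_in_vars[OF fin in_vars_path_wt]) (auto simp: word_def in_vars_Q[OF n])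
  note gfp = gf_paths[OF word_ok_word[OF n] fmu adm_sw] and adm_w = admissible_paths[OF word_ok_word[OF n] fmu adm_sw]
  obtain B1 where B1: "bounded_expo n B1 (- prefactor n c)"
    using in_vars_bounded[OF in_vars_prefactor[OF n]] by blast
  have w: "weight_expo n c \<pi> = path_wt ?w mu_end (slices N \<pi>) + - prefactor n c" if "\<pi> \<in> window N" for \<pi>
    using weight_eq_path_wt[OF that n N] by (simp add: weight_expo_def prefactor_def)
  show "admissible n (window N) (weight_expo n c)"
    by (rule admissible_bij_betw[OF bij_betw_slices w admissible_shift[OF adm_w B1]])
  have "gf (window N) (weight_expo n c) = gf (paths ?w mu_end lam_end) (\<lambda>p. path_wt ?w mu_end p + - prefactor n c)"
    by (rule gf_bij_betw[OF bij_betw_slices]) (rule w)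
  also have "\<dots> = gf (paths ?w mu_end lam_end) (path_wt ?w mu_end) * mono_of (- prefactor n c)"
    by (rule gf_shift[OF adm_w B1])
  also have "gf (paths ?w mu_end lam_end) (path_wt ?w mu_end) =
      (\<Prod>(s, t)\<in>window_pairs N. geo (Q n c t - Q n c s)) * gf (paths ?sw mu_end lam_end) (path_wt ?sw mu_end)"
    unfolding gfp word_prod_word ..
  also have "gf (paths ?sw mu_end lam_end) (path_wt ?sw mu_end) =
      (\<Sum>k | \<forall>m. k m \<le> max (mu_end m) (lam_end m). dsum ds mu_end k * dsum (rev (map uminus us)) lam_end k)"
    unfolding gf_finite[OF fin] unfolding down up by (rule sum_down_up_paths(2)[OF fmu flam])
  also have "\<dots> = (\<Sum>\<eta>\<in>P. dsum ds mu_end (part \<eta>) * dsum (rev (map uminus us)) lam_end (part \<eta>))"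
  proof -
    let ?K = "{k. \<forall>m. k m \<le> max (mu_end m) (lam_end m)}"
    have "fin_supp (\<lambda>m. max (mu_end m) (lam_end m))"
      unfolding fin_supp_def by (rule exI[of _ bound]) (simp add: mu_end_bound lam_end_bound)
    then have finK: "finite ?K" by (rule finite_below)
    have sub: "part ` P \<subseteq> ?K"
      using subset_partition_iff mu by (auto simp: P_def le_max_iff_disj)
    \<comment> \<open>A descent from \<mu> reaches only decreasing sequences below \<mu>, so the
      other members of the finite box contribute nothing.\<close>
    have zero: "dsum ds mu_end k * dsum (rev (map uminus us)) lam_end k = 0" if "k \<in> ?K - part ` P" for k
    proof (rule ccontr)
      assume "\<not> ?thesis"
      then have "dsum ds mu_end k \<noteq> 0" by auto
      then have k: "decseq k" "\<forall>j. k j \<le> mu_end j" using dsum_nonzero decseq_part[OF mu] by blast+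
      then have "fin_supp k" using fmu fin_supp_le by blast
      then have "is_partition (shape k)" using k is_partition_shape by blast
      then have "shape k \<in> P" using k(2) subset_partition_iff[OF _ mu, of "shape k"] by (simp add: P_def)
      then have "k \<in> part ` P" by (metis imageI part_shape)
      then show False using that by blast
    qed
    have inj: "inj_on part P" by (rule inj_on_inverseI[of _ shape]) (simp add: P_def shape_part)
    have "(\<Sum>k\<in>?K. dsum ds mu_end k * dsum (rev (map uminus us)) lam_end k) =
        (\<Sum>k\<in>part ` P. dsum ds mu_end k * dsum (rev (map uminus us)) lam_end k)"
      using zero by (intro sum.mono_neutral_right finK sub) blast
    then show ?thesis by (simp add: sum.reindex[OF inj])
  qed
  \<comment> \<open>The negated label differs from the exponent of the overlined variable by one
    copy of q_0. Written as a common shift, it leaves the sum through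
    \<open>dsum_shift\<close>.\<close>
  also have "rev (map uminus us) = map (\<lambda>j. (- Q n c (up_edge j) - ev n c 0) + ev n c 0) [0..<N]"
    by (simp add: us_def rev_map comp_def)
  finally show "gf (window N) (weight_expo n c) =
      (\<Prod>(s, t)\<in>window_pairs N. geo (Q n c t - Q n c s)) *
      (\<Sum>\<eta>\<in>P. dsum (map (\<lambda>j. Q n c (down_edge j)) [0..<N]) mu_end (part \<eta>) *
        (mono_of (step_wt (ev n c 0) lam_end (part \<eta>)) *
         dsum (map (\<lambda>j. - Q n c (up_edge j) - ev n c 0) [0..<N]) lam_end (part \<eta>))) * mono_of (- prefactor n c)"
    by (simp only: dsum_shift ds_def)
qed

end

section \<open>Edge labels as the variables of the Schur functions\<close>

lemma qfrak_eq_mono_of: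
  assumes x: "\<And>s. x s = mono_of (e s)" and G: "G 0 = 0" "\<And>t. G (t + 1) = G t + e (t + 1)"
  shows "qfrak x t = mono_of (G t)"
proof -
  have "(\<Sum>s = 1..t. e s) = G t" if "t \<ge> 0" for t
    using that
  proof (induction t rule: int_ge_induct)
    case (step t)
    then have "{1..t + 1} = insert (t + 1) {1..t}" by auto
    then have "(\<Sum>s = 1..t + 1. e s) = e (t + 1) + (\<Sum>s = 1..t. e s)" by simp
    then show ?case unfolding step.IH G(2) by (simp only: add.commute)
  qed (simp add: G)
  moreover have "(\<Sum>s = t + 1..0. - e s) = G t" if "t \<le> 0" for t
    using that
  proof (induction t rule: int_le_induct)
    case (step t)
    then have "{t - 1 + 1..0} = insert t {t + 1..0}" by auto
    then show ?case using step G(2)[of "t - 1"] by simp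
  qed (simp add: G)
  ultimately show ?thesis by (auto simp: qfrak_def x inverse_mono_of simp flip: mono_of_sum)
qed

lemma qfrak_qv: "qfrak (\<lambda>r. qv n (c + r)) t = mono_of (Q n c t)"
  by (rule qfrak_eq_mono_of[where e = "ev n c"]) (simp_all add: qv_eq_mono_of Q_step)

text \<open>Exchanging \<open>q_k\<close> and \<open>q_{-k}\<close> reflects a partial product: the
  variables with indices 1, ..., t become those with indices -t, ..., -1, and their product is taken
  from \<open>- t - 1\<close> to -1. The extra \<open>ev n c 0\<close> appears since
  \<open>Q n c (- 1) = - ev n c 0\<close>.\<close>

lemma qfrak_bar_qv: "qfrak (bar (\<lambda>r. qv n (c + r))) t = mono_of (- Q n c (- t - 1) - ev n c 0)"
proof (rule qfrak_eq_mono_of[where e = "\<lambda>r. ev n c (- r)" and G = "\<lambda>t. - Q n c (- t - 1) - ev n c 0"])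
  show "bar (\<lambda>r. qv n (c + r)) s = mono_of (ev n c (- s))" for s
    using qv_eq_mono_of[of n c "- s"] by (simp add: bar_def)
  have "Q n c (- 1) = - ev n c 0" using Q_step[of n c "- 1"] by (simp add: eq_neg_iff_add_eq_0)
  then show "- Q n c (- 0 - 1) - ev n c 0 = 0" by simp
  show "- Q n c (- (t + 1) - 1) - ev n c 0 = - Q n c (- t - 1) - ev n c 0 + ev n c (- (t + 1))" for t
  proof -
    have e: "- t - 2 + 1 = - t - 1" "- (t + 1) = - t - 1" "- t - 1 - 1 = - t - 2" by auto
    have "- x - z = - (x + y) - z + y" for x y z :: expo by simp
    then show ?thesis unfolding e Q_step[of n c "- t - 2", unfolded e] .
  qed
qed

context vertex_data
begin

lemma skew_mu_eq:
  "skew_schur \<mu> \<eta> (qfrak_seq (\<lambda>r. qv n (c + r)) (conjugate \<nu>)) = skew_schur \<mu> \<eta> (\<lambda>j. mono_of (Q n c (down_edge j)))"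
  unfolding qfrak_seq_def qfrak_qv down_edge_def ..

lemma skew_lam_eq:
  "skew_schur (conjugate lam) \<eta> (qfrak_seq (bar (\<lambda>r. qv n (c + r))) \<nu>) =
   skew_schur (conjugate lam) \<eta> (\<lambda>j. mono_of (- Q n c (up_edge j) - ev n c 0))"
proof -
  have "- (int j - int (part \<nu> j)) - 1 = up_edge j" for j by (simp add: up_edge_def)
  then show ?thesis unfolding qfrak_seq_def qfrak_bar_qv by simp
qed

lemma bconv_skew_mu:
  assumes n: "n \<ge> 1" and \<eta>: "is_partition \<eta>"
  shows "bconv n (\<lambda>N. dsum (map (\<lambda>j. Q n c (down_edge j)) [0..<N]) mu_end (part \<eta>))
    (skew_schur \<mu> \<eta> (\<lambda>j. mono_of (Q n c (down_edge j))))"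
proof (rule bconv_dsum_skew_schur[where c = "int radius"])
  have "- int radius \<le> down_edge j" for j using down_edge_bounds(1)[of j] by simp
  then show "bounded_expo n (- int radius) (Q n c (down_edge j))" for j by (rule bounded_Q[OF n])
  show "int j - int radius \<le> deg (Q n c (down_edge j))" for j using down_edge_bounds(1)[of j] by (simp add: deg_Q)
qed (use mu \<eta> in auto)

lemma bconv_skew_lam:
  assumes n: "n \<ge> 1" and \<eta>: "is_partition \<eta>"
  shows "bconv n (\<lambda>N. dsum (map (\<lambda>j. - Q n c (up_edge j) - ev n c 0) [0..<N]) lam_end (part \<eta>))
    (skew_schur (conjugate lam) \<eta> (\<lambda>j. mono_of (- Q n c (up_edge j) - ev n c 0)))"
proof -
  \<comment> \<open>All up edges are below the radius, so the label at the radius bounds the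
    exponents of all variables from below.\<close>
  obtain B where B: "bounded_expo n B (- Q n c (int radius) - ev n c 0)"
    using in_vars_bounded[OF in_vars_diff[OF in_vars_uminus[OF in_vars_Q[OF n]] in_vars_ev[OF n]]] by blast
  show ?thesis
  proof (rule bconv_dsum_skew_schur[where c = "int radius" and B = B])
    fix j
    have "up_edge j \<le> int radius" using up_edge_bounds(1)[of j] by simp
    from bounded_expo_add[OF bounded_Q_diff[OF n this, of c] B]
    have "bounded_expo n B (Q n c (int radius) - Q n c (up_edge j) + (- Q n c (int radius) - ev n c 0))" by simp
    moreover have "Q n c (int radius) - Q n c (up_edge j) + (- Q n c (int radius) - ev n c 0) = - Q n c (up_edge j) - ev n c 0"
      by simp
    ultimately show "bounded_expo n B (- Q n c (up_edge j) - ev n c 0)" by (simp only:)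
    show "int j - int radius \<le> deg (- Q n c (up_edge j) - ev n c 0)"
      using up_edge_bounds(1)[of j] by (simp add: deg_diff deg_uminus deg_Q)
  qed (use is_partition_conjugate[OF lam] \<eta> in auto)
qed

text \<open>The shift c is carried along because \<open>O_factor\<close> evaluates the empty vertex
  at shifted variables. Only the finitely many subdiagrams of \<mu> occur as \<eta>, so the window
  formula passes to the limit term by term.\<close>

lemma vertex_eq:
  assumes n: "n \<ge> 1"
  shows "vertex n lam \<mu> \<nu> (\<lambda>r. qv n (c + r)) = pair_prod n c *
      (\<Sum>\<eta> | is_partition \<eta> \<and> \<eta> \<subseteq> \<mu>. skew_schur \<mu> \<eta> (\<lambda>j. mono_of (Q n c (down_edge j))) *
        (mono_of (step_wt (ev n c 0) lam_end (part \<eta>)) *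
         skew_schur (conjugate lam) \<eta> (\<lambda>j. mono_of (- Q n c (up_edge j) - ev n c 0)))) *
      mono_of (- prefactor n c)" (is "_ = ?R")
proof -
  define M where "M = bound + 1"
  have M: "bound \<le> M + N" "1 \<le> M + N" for N by (simp_all add: M_def)
  have bmono: "\<exists>B. bnd n B (mono_of e)" if "in_vars n e" for e
    using in_vars_bounded[OF that] by (simp add: bnd_mono_of)
  have c1: "bconv n (\<lambda>_. mono_of e) (mono_of e)" if "in_vars n e" for e
    using bmono[OF that] bconv_const by blast
  have lim: "filterlim (\<lambda>N. M + N) sequentially sequentially"
    by (simp add: filterlim_at_top_mono[OF filterlim_ident] eventually_sequentially)
  have "bconv n (\<lambda>N. (\<Prod>(s, t)\<in>window_pairs N. geo (Q n c t - Q n c s)) *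
      (\<Sum>\<eta> | is_partition \<eta> \<and> \<eta> \<subseteq> \<mu>. dsum (map (\<lambda>j. Q n c (down_edge j)) [0..<N]) mu_end (part \<eta>) *
        (mono_of (step_wt (ev n c 0) lam_end (part \<eta>)) *
         dsum (map (\<lambda>j. - Q n c (up_edge j) - ev n c 0) [0..<N]) lam_end (part \<eta>))) * mono_of (- prefactor n c)) ?R"
    by (intro bconv_mult bconv_sum bconv_pair_prod[OF n exhausts_window_pairs] bconv_skew_mu[OF n] bconv_skew_lam[OF n] c1)
      (auto simp: step_wt_def intro: in_vars_of_int_mult in_vars_prefactor in_vars_ev n simp del: of_int_diff)
  from bconv_subseq[OF this lim]
  have "bconv n (\<lambda>N. gf (window (M + N)) (weight_expo n c)) ?R"
    unfolding gf_window[OF n M] .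
  then have "gf (\<Union>N. window (M + N)) (weight_expo n c) = ?R"
    by (rule gf_incseq[OF admissible_window[OF n M], rotated])
      (use incseq_window in \<open>auto simp: incseq_def\<close>)
  moreover have "vertex n lam \<mu> \<nu> (\<lambda>r. qv n (c + r)) = gf {\<pi>. asymptotic_3d lam \<mu> \<nu> \<pi>} (weight_expo n c)"
    unfolding vertex_def gf_def weight_expo_def mono_of_sum by (simp add: qv_eq_mono_of mono_of_powi)
  ultimately show ?thesis unfolding Union_window by simp
qed

end

section \<open>The vertex of three empty partitions\<close>

lemma boundary_empty: "boundary {}"
  by standard (simp add: is_partition_def)

lemma is_partition_empty: "is_partition {}"
  by (simp add: is_partition_def)

lemma part_empty: "part {} j = 0"
  by (simp add: part_def)

lemma range_down_edge_empty: "range (boundary.down_edge {}) = {0..}"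
proof -
  have "boundary.down_edge {} j = int j" for j
    using boundary.down_edge_def[OF boundary_empty] by (simp add: conjugate_def part_empty)
  then show ?thesis by (auto simp: image_iff) (metis nonneg_int_cases)
qed

lemma pairs_empty: "boundary.pairs {} = {(s, t). s < 0 \<and> 0 \<le> t}"
  unfolding boundary.pairs_def[OF boundary_empty] range_down_edge_empty by auto

lemma vertex_empty:
  assumes n: "n \<ge> 1"
  shows "vertex n {} {} {} (\<lambda>r. qv n (c + r)) = boundary.pair_prod {} n c"
proof -
  interpret vertex_data "{}" "{}" "{}"
    by (intro vertex_data.intro boundary_empty vertex_data_axioms.intro is_partition_empty)
  have P: "{\<eta> :: diagram. is_partition \<eta> \<and> \<eta> \<subseteq> {}} = {{}}" by (auto simp: is_partition_empty)
  have ext: "{T :: nat \<times> nat \<Rightarrow> nat. semistandard {} T} = {\<lambda>_. undefined}" by (auto simp: semistandard_def)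
  have [simp]: "conjugate {} = {}" "part {} = (\<lambda>_. 0)" by (auto simp: conjugate_def part_empty)
  have "prefactor n c = 0" by (simp add: prefactor_def psize_def A_stat_def)
  then show ?thesis unfolding vertex_eq[OF n] P by (simp add: skew_schur_def ext step_wt_def)
qed

text \<open>Shifting the variables by \<open>k\<close> moves the cut separating the two members of a pair from 0 to \<open>k\<close>.\<close>

lemma bconv_vertex_empty:
  assumes n: "n \<ge> 1" and S: "exhausts S {(s, t). s < k \<and> k \<le> t}"
  shows "bconv n (\<lambda>N. \<Prod>(s, t)\<in>S N. geo (Q n 0 t - Q n 0 s)) (vertex n {} {} {} (\<lambda>r. qv n (k + r)))"
proof -
  let ?f = "\<lambda>(s, t). (s - k, t - k)" and ?h = "\<lambda>(s, t). (s + k, t + k)"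
  have sub: "finite (S N)" "S N \<subseteq> {(s, t). s < k \<and> k \<le> t}" for N using S unfolding exhausts_def by blast+
  have ex: "exhausts (\<lambda>N. ?f ` S N) (boundary.pairs {})"
    unfolding exhausts_def
  proof (intro conjI allI ballI)
    show "finite (?f ` S N)" "?f ` S N \<subseteq> boundary.pairs {}" for N
      using sub[of N] unfolding pairs_empty by auto
    fix p assume "p \<in> boundary.pairs {}"
    then have "?h p \<in> {(s, t). s < k \<and> k \<le> t}" unfolding pairs_empty by auto
    then have "\<forall>\<^sub>F N in sequentially. ?h p \<in> S N" using S unfolding exhausts_def by (elim conjE bspec)
    then show "\<forall>\<^sub>F N in sequentially. p \<in> ?f ` S N"
      by eventually_elim (auto intro!: image_eqI[of _ _ "?h p"] split: prod.splits)
  qed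
  have Qk: "Q n k (t - k) - Q n k (s - k) = Q n 0 t - Q n 0 s" if "s < t" for s t
  proof -
    have "(\<Sum>r = s - k + 1..t - k. ev n k r) = (\<Sum>r = s + 1..t. ev n 0 r)"
      by (rule sum.reindex_bij_witness[where j = "\<lambda>r. r + k" and i = "\<lambda>r. r - k"]) (auto simp: ev_def add.commute)
    then show ?thesis using that by (simp add: Q_diff)
  qed
  have "(\<Prod>(s, t)\<in>?f ` S N. geo (Q n k t - Q n k s)) = (\<Prod>(s, t)\<in>S N. geo (Q n 0 t - Q n 0 s))" for N
  proof (rule prod.reindex_bij_witness[where j = ?h and i = ?f])
    fix p assume "p \<in> ?f ` S N"
    then obtain s t where st: "p = (s - k, t - k)" "(s, t) \<in> S N" by auto
    then have "s < t" using sub(2)[of N] by auto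
    then show "(case ?h p of (s, t) \<Rightarrow> geo (Q n 0 t - Q n 0 s)) = (case p of (s, t) \<Rightarrow> geo (Q n k t - Q n k s))"
      by (simp add: st Qk)
  qed auto
  with boundary.bconv_pair_prod[OF boundary_empty n ex, of k] show ?thesis
    unfolding vertex_empty[OF n] by simp
qed

text \<open>The inverse is the product of \<open>1 - mono_of (Q n 0 t - Q n 0 s)\<close> over the
  same pairs, which converges as well; on each finite window the two products cancel exactly. This
  gives the negative powers in \<open>O_factor\<close> their meaning.\<close>

lemma vertex_empty_unit:
  assumes n: "n \<ge> 1"
  shows "vertex n {} {} {} (\<lambda>r. qv n (k + r)) * inverse (vertex n {} {} {} (\<lambda>r. qv n (k + r))) = 1"
proof -
  define S where "S N = {(s, t). k - int N \<le> s \<and> s < k \<and> k \<le> t \<and> t < k + int N}" for N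
  let ?A = "{(s, t). s < k \<and> k \<le> t}"
  have S: "exhausts S ?A"
    unfolding exhausts_def
  proof (intro conjI allI ballI)
    show "finite (S N)" for N
      by (rule finite_subset[of _ "{k - int N..k} \<times> {k..k + int N}"]) (auto simp: S_def)
    show "S N \<subseteq> ?A" for N by (auto simp: S_def)
    fix p assume p: "p \<in> ?A"
    obtain s t where [simp]: "p = (s, t)" by fastforce
    have "p \<in> S N" if "N \<ge> nat (k - s) + nat (t - k) + 1" for N using p that by (auto simp: S_def)
    then show "\<forall>\<^sub>F N in sequentially. p \<in> S N" by (auto simp: eventually_sequentially)
  qed
  let ?g = "\<lambda>(s, t). 1 - mono_of (Q n 0 t - Q n 0 s)"
  have near: "near1 n (case p of (s, t) \<Rightarrow> t - s) (?g p)" if "p \<in> ?A" for p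
    using that near1_one_minus[OF bounded_Q_diff[OF n, of "fst p" "snd p" 0]] by (auto simp: deg_diff deg_Q)
  have fin: "finite {p \<in> ?A. (case p of (s, t) \<Rightarrow> t - s) \<le> d}" for d
    by (rule finite_subset[of _ "{k - d..k} \<times> {k..k + d}"]) auto
  have "bconv n (\<lambda>N. (\<Prod>p\<in>S N. ?g p) * (\<Prod>(s, t)\<in>S N. geo (Q n 0 t - Q n 0 s)))
      (inf_prod n ?A ?g * vertex n {} {} {} (\<lambda>r. qv n (k + r)))"
    by (rule bconv_mult[OF bconv_inf_prod[OF near fin S] bconv_vertex_empty[OF n S]])
  moreover have "(\<Prod>p\<in>S N. ?g p) * (\<Prod>(s, t)\<in>S N. geo (Q n 0 t - Q n 0 s)) = 1" for N
  proof -
    have "(\<Prod>p\<in>S N. ?g p) * (\<Prod>(s, t)\<in>S N. geo (Q n 0 t - Q n 0 s)) =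
        (\<Prod>p\<in>S N. ?g p * (case p of (s, t) \<Rightarrow> geo (Q n 0 t - Q n 0 s)))" by (rule prod.distrib[symmetric])
    also have "\<dots> = 1"
    proof (rule prod.neutral, clarify)
      fix s t assume "(s, t) \<in> S N"
      then have "s < t" by (auto simp: S_def)
      then show "(1 - mono_of (Q n 0 t - Q n 0 s)) * geo (Q n 0 t - Q n 0 s) = 1"
        using geo_mult[OF bounded_Q_diff[OF n, of s t 0] Q_diff_ne_0[of s t n 0]] by simp
    qed
    finally show ?thesis .
  qed
  ultimately have "bconv n (\<lambda>_. 1) (inf_prod n ?A ?g * vertex n {} {} {} (\<lambda>r. qv n (k + r)))" by (simp only:)
  then have "inf_prod n ?A ?g * vertex n {} {} {} (\<lambda>r. qv n (k + r)) = 1" using bconv_1 by (rule bconv_unique)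
  then have one: "vertex n {} {} {} (\<lambda>r. qv n (k + r)) * inf_prod n ?A ?g = 1" by (simp add: mult.commute)
  then show ?thesis using laurent_inverse_unique[OF one] by simp
qed

section \<open>Comparison with the empty vertex\<close>

context boundary
begin

definition content_count :: "int \<Rightarrow> nat" where
  "content_count k = card {(i, j) \<in> \<nu>. int i - int j = k}"

lemma content_count_eq: "int (content_count k) = int (start k) - max k 0"
proof -
  have "bij_betw (\<lambda>i. (i, nat (int i - k))) {nat (max k 0)..<start k} {(i, j) \<in> \<nu>. int i - int j = k}"
    by (rule bij_betw_byWitness[where f' = fst]) (auto simp: mem_nu_iff nat_le_iff)
  then have "content_count k = start k - nat (max k 0)"
    unfolding content_count_def using bij_betw_same_card by fastforce
  then show ?thesis using le_start[of k] by (simp add: of_nat_diff max_def)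
qed

text \<open>For the empty partition, edge k is an up edge exactly when k is negative. The first
  difference of the diagonal counts is thus the up-edge indicator of the empty partition minus that
  of \<nu>.\<close>

lemma content_count_step:
  "int (content_count (k + 1)) - int (content_count k) = of_bool (k < 0) - of_bool (k \<notin> range down_edge)"
proof (cases "k \<in> range down_edge")
  case True
  then show ?thesis unfolding content_count_eq start_down(1)[OF True] by (auto simp: max_def)
next
  case False
  then show ?thesis unfolding content_count_eq start_up[OF False] by (auto simp: max_def)
qed

lemma content_count_eq_0: "int radius \<le> \<bar>k\<bar> \<Longrightarrow> content_count k = 0"
  using content_count_eq[of k] start_large[of k] start_small[of k] by (cases "k \<ge> 0") auto

lemma finite_nu: "finite \<nu>"
  using nu by (simp add: is_partition_def)

text \<open>Reaches one diagonal beyond the radius on both sides, so that outside it the counts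
  vanish at k and at both neighbours.\<close>

definition contents :: "int set" where
  "contents = {- int radius - 1..int radius + 1}"

lemma sum_content_count_color:
  assumes "\<bar>d\<bar> \<le> 1"
  shows "(\<Sum>k | k \<in> contents \<and> k mod int n = r mod int n. content_count (k + d)) = color_count n \<nu> (r + d)"
proof -
  let ?K = "{k. k \<in> contents \<and> k mod int n = r mod int n}"
  have "{b \<in> \<nu>. has_color n (r + d) b} = (\<Union>k\<in>?K. {(i, j) \<in> \<nu>. int i - int j = k + d})"
  proof (intro set_eqI)
    fix b :: "nat \<times> nat" obtain i j where b: "b = (i, j)" by fastforce
    have "int i - int j - d \<in> contents" if "(i, j) \<in> \<nu>"
    proof -
      have "i < part \<nu> j" "j < part (conjugate \<nu>) i"
        using that mem_partition_iff[OF nu, of i j] mem_partition_iff[OF nu', of j i] by auto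
      then have "i < radius" "j < radius" using part_le_radius[of j] part_le_radius[of i] by simp_all
      then show ?thesis using assms by (auto simp: contents_def)
    qed
    moreover have "(int i - int j) mod int n = (r + d) mod int n \<longleftrightarrow> (int i - int j - d) mod int n = r mod int n"
      by (simp add: mod_eq_dvd_iff algebra_simps)
    ultimately show "b \<in> {b \<in> \<nu>. has_color n (r + d) b} \<longleftrightarrow> b \<in> (\<Union>k\<in>?K. {(i, j) \<in> \<nu>. int i - int j = k + d})"
      by (auto simp: b has_color_def) 
  qed
  moreover have "card (\<Union>k\<in>?K. {(i, j) \<in> \<nu>. int i - int j = k + d}) = (\<Sum>k\<in>?K. card {(i, j) \<in> \<nu>. int i - int j = k + d})"
  proof (rule card_UN_disjoint)
    show "finite ?K" by (rule finite_subset[of _ contents]) (auto simp: contents_def)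
  qed (auto intro: finite_subset[OF _ finite_nu])
  ultimately show ?thesis by (simp add: color_count_def content_count_def)
qed

text \<open>The opposite order to \<open>pairs\<close>: a down edge before an up edge. Each box of
  \<nu> yields one such pair, the edges at the two ends of its hook.\<close>

definition hook_pairs :: "(int \<times> int) set" where
  "hook_pairs = {(s, t). s < t \<and> s \<in> range down_edge \<and> t \<notin> range down_edge}"

text \<open>For a single pair \<open>s < t\<close>, the exponents of the factor of \<open>(s, t)\<close> on both sides agree:
  the second differences of \<open>content_count\<close> telescope.\<close>

lemma pair_exponent:
  assumes "s < t"
  shows "of_bool (s \<notin> range down_edge \<and> t \<in> range down_edge) +
      (\<Sum>k\<in>contents. of_bool (s < k \<and> k \<le> t) * (2 * content_count k)) =
    of_bool (s < 0 \<and> 0 \<le> t) + of_bool (s \<in> range down_edge \<and> t \<notin> range down_edge) +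
      (\<Sum>k\<in>contents. of_bool (s < k \<and> k \<le> t) * (content_count (k - 1) + content_count (k + 1)))"
    (is "?l + ?L = ?r + ?R")
proof -
  define d where "d k = int (content_count (k + 1)) - int (content_count k)" for k
  have int: "int (\<Sum>k\<in>contents. of_bool (s < k \<and> k \<le> t) * f k) = (\<Sum>k = s + 1..t. int (f k))"
    if "\<And>k. k \<notin> contents \<Longrightarrow> f k = 0" for f
  proof -
    have "(\<Sum>k\<in>contents. of_bool (s < k \<and> k \<le> t) * int (f k)) = (\<Sum>k\<in>{s + 1..t} \<inter> contents. int (f k))"
      by (rule sum.mono_neutral_cong_right) (auto simp: contents_def)
    also have "\<dots> = (\<Sum>k = s + 1..t. int (f k))"
      using that by (intro sum.mono_neutral_left) auto
    finally show ?thesis by simp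
  qed
  have out: "content_count k = 0 \<and> content_count (k - 1) = 0 \<and> content_count (k + 1) = 0" if "k \<notin> contents" for k
    using that by (auto simp: contents_def intro!: content_count_eq_0)
  have "(\<Sum>k = s + 1..t. d k - d (k - 1)) = d t - d s"
    using less_imp_le[OF assms]
  proof (induction t rule: int_ge_induct)
    case (step t)
    then have "{s + 1..t + 1} = insert (t + 1) {s + 1..t}" by auto
    then show ?case using step by simp
  qed simp
  moreover have "int ?R - int ?L = (\<Sum>k = s + 1..t. d k - d (k - 1))"
  proof -
    have "int ?L = (\<Sum>k = s + 1..t. int (2 * content_count k))"
      by (rule int) (simp add: out)
    moreover have "int ?R = (\<Sum>k = s + 1..t. int (content_count (k - 1) + content_count (k + 1)))"
      by (rule int) (simp add: out)
    ultimately show ?thesis by (simp add: d_def add.commute flip: sum_subtractf)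
  qed
  \<comment> \<open>A difference x - y of indicators is that of x without y minus that of y without
    x. Applied to the up edges of \<nu> it yields the two mixed pairs; for the empty partition one
    of them is excluded by s < t.\<close>
  moreover have "d t - d s = int ?l - int ?r"
    unfolding d_def content_count_step using assms by auto
  ultimately have "int (?l + ?L) = int (?r + ?R)" by simp
  then show ?thesis by (simp only: of_nat_eq_iff)
qed

definition square :: "nat \<Rightarrow> (int \<times> int) set" where
  "square N = {(s, t). - int N \<le> s \<and> s < t \<and> t < int N}"

lemma finite_square: "finite (square N)"
  by (rule finite_subset[of _ "{- int N..int N} \<times> {- int N..int N}"]) (auto simp: square_def)

definition cut_square :: "int \<Rightarrow> nat \<Rightarrow> (int \<times> int) set" where
  "cut_square k N = {(s, t) \<in> square N. s < k \<and> k \<le> t}"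

lemma exhausts_cut_square: "exhausts (cut_square k) {(s, t). s < k \<and> k \<le> t}"
  unfolding exhausts_def
proof (intro conjI allI ballI)
  show "finite (cut_square k N)" for N
    by (rule finite_subset[OF _ finite_square[of N]]) (auto simp: cut_square_def)
  show "cut_square k N \<subseteq> {(s, t). s < k \<and> k \<le> t}" for N by (auto simp: cut_square_def)
  fix p assume p: "p \<in> {(s, t). s < k \<and> k \<le> t}"
  obtain s t where [simp]: "p = (s, t)" by fastforce
  have "p \<in> cut_square k N" if "N \<ge> nat \<bar>s\<bar> + nat \<bar>t\<bar> + 1" for N
    using p that by (auto simp: cut_square_def square_def)
  then show "\<forall>\<^sub>F N in sequentially. p \<in> cut_square k N" by (auto simp: eventually_sequentially)
qed

lemma hook_pairs_subset: "radius \<le> N \<Longrightarrow> hook_pairs \<subseteq> square N"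
proof clarify
  fix s t assume "radius \<le> N" "(s, t) \<in> hook_pairs"
  then show "(s, t) \<in> square N"
    using down_edge_ge[of s] not_down_edge_less[of t] by (auto simp: hook_pairs_def square_def)
qed

text \<open>All windows are cut out of one square, where the identity holds pair by pair in the
  exponents. Negative exponents are kept on the opposite side, so no inverses occur, and N must be
  large enough for the square to contain the finitely many hook pairs.\<close>

lemma square_identity:
  fixes g :: "int \<times> int \<Rightarrow> laurent"
  assumes "radius \<le> N"
  shows "prod g (window_pairs N) * (\<Prod>k\<in>contents. prod g (cut_square k N) ^ (2 * content_count k)) =
    prod g (cut_square 0 N) * prod g hook_pairs *
      (\<Prod>k\<in>contents. prod g (cut_square k N) ^ (content_count (k - 1) + content_count (k + 1)))"
proof -
  have filter: "prod g {p \<in> square N. P p} = (\<Prod>p\<in>square N. g p ^ of_bool (P p))" for P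
    unfolding prod.inter_filter[OF finite_square] by (rule prod.cong) auto
  have cut: "(\<Prod>k\<in>contents. prod g (cut_square k N) ^ f k) =
      (\<Prod>p\<in>square N. g p ^ (\<Sum>k\<in>contents. of_bool (fst p < k \<and> k \<le> snd p) * f k))" for f
  proof -
    have "cut_square k N = {p \<in> square N. fst p < k \<and> k \<le> snd p}" for k by (auto simp: cut_square_def)
    then have "(\<Prod>k\<in>contents. prod g (cut_square k N) ^ f k) =
        (\<Prod>k\<in>contents. \<Prod>p\<in>square N. g p ^ (of_bool (fst p < k \<and> k \<le> snd p) * f k))"
      by (simp add: filter prod_power_distrib power_mult)
    also have "\<dots> = (\<Prod>p\<in>square N. \<Prod>k\<in>contents. g p ^ (of_bool (fst p < k \<and> k \<le> snd p) * f k))"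
      by (rule prod.swap)
    finally show ?thesis by (simp add: power_sum)
  qed
  have sets: "window_pairs N = {p \<in> square N. fst p \<notin> range down_edge \<and> snd p \<in> range down_edge}"
    "cut_square 0 N = {p \<in> square N. fst p < 0 \<and> 0 \<le> snd p}"
    by (auto simp: window_pairs_def pairs_def square_def cut_square_def)
  have hooks: "hook_pairs = {p \<in> square N. fst p \<in> range down_edge \<and> snd p \<notin> range down_edge}"
    using hook_pairs_subset[OF assms] by (auto simp: hook_pairs_def square_def)
  show ?thesis
    unfolding cut unfolding sets hooks filter prod.distrib[symmetric] power_add[symmetric]
  proof (rule prod.cong)
    fix p assume "p \<in> square N"
    then have "fst p < snd p" by (auto simp: square_def)
    from pair_exponent[OF this] show
      "g p ^ (of_bool (fst p \<notin> range down_edge \<and> snd p \<in> range down_edge) +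
          (\<Sum>k\<in>contents. of_bool (fst p < k \<and> k \<le> snd p) * (2 * content_count k))) =
       g p ^ (of_bool (fst p < 0 \<and> 0 \<le> snd p) + of_bool (fst p \<in> range down_edge \<and> snd p \<notin> range down_edge) +
          (\<Sum>k\<in>contents. of_bool (fst p < k \<and> k \<le> snd p) * (content_count (k - 1) + content_count (k + 1))))"
      by (rule arg_cong)
  qed simp
qed

lemma pair_prod_identity:
  assumes n: "n \<ge> 1"
  defines "V \<equiv> \<lambda>k. vertex n {} {} {} (\<lambda>r. qv n (k + r))"
  shows "pair_prod n 0 * (\<Prod>k\<in>contents. V k ^ (2 * content_count k)) =
    V 0 * (\<Prod>(s, t)\<in>hook_pairs. geo (Q n 0 t - Q n 0 s)) *
      (\<Prod>k\<in>contents. V k ^ (content_count (k - 1) + content_count (k + 1)))" (is "?L = V 0 * ?H * ?R")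
proof -
  let ?g = "\<lambda>(s, t). geo (Q n 0 t - Q n 0 s)"
  have V: "bconv n (\<lambda>N. prod ?g (cut_square k N)) (V k)" for k
    unfolding V_def by (rule bconv_vertex_empty[OF n exhausts_cut_square])
  have H: "bnd n 0 ?H"
    by (rule bnd_prod) (auto simp: hook_pairs_def intro!: near1_bnd[OF near1_pair[OF n]])
  let ?l = "\<lambda>N. prod ?g (window_pairs N) * (\<Prod>k\<in>contents. prod ?g (cut_square k N) ^ (2 * content_count k))"
  let ?r = "\<lambda>N. prod ?g (cut_square 0 N) * ?H *
      (\<Prod>k\<in>contents. prod ?g (cut_square k N) ^ (content_count (k - 1) + content_count (k + 1)))"
  have "bconv n ?l ?L"
    by (intro bconv_mult bconv_prod bconv_power V bconv_pair_prod[OF n exhausts_window_pairs])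
  moreover have "bconv n ?r (V 0 * ?H * ?R)"
    by (intro bconv_mult bconv_prod bconv_power V bconv_const[OF H])
  moreover have "filterlim (\<lambda>N. radius + N) sequentially sequentially"
    by (simp add: filterlim_at_top_mono[OF filterlim_ident] eventually_sequentially)
  ultimately have "bconv n (\<lambda>N. ?l (radius + N)) ?L" "bconv n (\<lambda>N. ?r (radius + N)) (V 0 * ?H * ?R)"
    using bconv_subseq by blast+
  moreover have "?l (radius + N) = ?r (radius + N)" for N by (rule square_identity) simp
  ultimately show ?thesis using bconv_unique by (simp only:)
qed

lemma prod_contents_color:
  fixes V :: "int \<Rightarrow> laurent"
  assumes n: "n \<ge> 1" and V: "\<And>k. V (k mod int n) = V k"
  shows "(\<Prod>k\<in>contents. V k ^ f k) = (\<Prod>r = 0..<int n. V r ^ (\<Sum>k | k \<in> contents \<and> k mod int n = r mod int n. f k))"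
proof -
  have fin: "finite contents" by (simp add: contents_def)
  have "(\<Prod>k\<in>contents. V k ^ f k) = (\<Prod>r = 0..<int n. \<Prod>k | k \<in> contents \<and> k mod int n = r. V k ^ f k)"
    by (rule prod.group[symmetric, OF fin]) (use n in auto)
  also have "\<dots> = (\<Prod>r = 0..<int n. V r ^ (\<Sum>k | k \<in> contents \<and> k mod int n = r mod int n. f k))"
  proof (rule prod.cong)
    fix r assume "r \<in> {0..<int n}"
    then have r: "r mod int n = r" by simp
    have "(\<Prod>k | k \<in> contents \<and> k mod int n = r. V k ^ f k) = (\<Prod>k | k \<in> contents \<and> k mod int n = r. V r ^ f k)"
      using V by (intro prod.cong) auto
    then show "(\<Prod>k | k \<in> contents \<and> k mod int n = r. V k ^ f k) = V r ^ (\<Sum>k | k \<in> contents \<and> k mod int n = r mod int n. f k)"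
      by (simp add: r power_sum)
  qed simp
  finally show ?thesis .
qed

lemma pair_prod_eq:
  assumes n: "n \<ge> 1"
  shows "pair_prod n 0 = vertex n {} {} {} (qv n) * (\<Prod>(s, t)\<in>hook_pairs. geo (Q n 0 t - Q n 0 s)) * O_factor n \<nu> (qv n)"
proof -
  define V where "V = (\<lambda>k. vertex n {} {} {} (\<lambda>r. qv n (k + r)))"
  let ?I = "\<lambda>k. inverse (V k)" and ?c = "color_count n \<nu>" and ?H = "\<Prod>(s, t)\<in>hook_pairs. geo (Q n 0 t - Q n 0 s)"
  have per: "V (k mod int n) = V k" for k
    by (simp add: V_def qv_def mod_add_left_eq)
  have unit: "V k * ?I k = 1" for k unfolding V_def by (rule vertex_empty_unit[OF n])
  have s0: "(\<Sum>k | k \<in> contents \<and> k mod int n = r mod int n. 2 * content_count k) = 2 * ?c r" for r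
    using sum_content_count_color[of 0 n r] by (simp flip: sum_distrib_left)
  have s1: "(\<Sum>k | k \<in> contents \<and> k mod int n = r mod int n. content_count (k - 1) + content_count (k + 1)) =
      ?c (r - 1) + ?c (r + 1)" for r
    using sum_content_count_color[of "- 1" n r] sum_content_count_color[of 1 n r] by (simp add: sum.distrib)
  have id: "pair_prod n 0 * (\<Prod>r = 0..<int n. V r ^ (2 * ?c r)) = V 0 * ?H * (\<Prod>r = 0..<int n. V r ^ (?c (r - 1) + ?c (r + 1)))"
  proof -
    have "pair_prod n 0 * (\<Prod>k\<in>contents. V k ^ (2 * content_count k)) =
        V 0 * ?H * (\<Prod>k\<in>contents. V k ^ (content_count (k - 1) + content_count (k + 1)))"
      unfolding V_def by (rule pair_prod_identity[OF n])
    then show ?thesis unfolding prod_contents_color[of n V, OF n per] s0 s1 .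
  qed
  \<comment> \<open>Only now are inverses introduced: the factors with exponent
    \<open>2 * ?c r\<close> are inserted together with their inverses, and the identity is applied
    to the first half.\<close>
  have "pair_prod n 0 = pair_prod n 0 * (\<Prod>r = 0..<int n. V r ^ (2 * ?c r)) * (\<Prod>r = 0..<int n. ?I r ^ (2 * ?c r))"
  proof -
    have "(\<Prod>r = 0..<int n. V r ^ (2 * ?c r)) * (\<Prod>r = 0..<int n. ?I r ^ (2 * ?c r)) = 1"
      unfolding prod.distrib[symmetric] power_mult_distrib[symmetric] unit by simp
    then show ?thesis by (simp add: mult.assoc)
  qed
  also have "\<dots> = V 0 * ?H * (\<Prod>r = 0..<int n. V r ^ (?c (r - 1) + ?c (r + 1)) * ?I r ^ (2 * ?c r))"
    unfolding id by (simp add: prod.distrib mult.assoc)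
  also have "(\<Prod>r = 0..<int n. V r ^ (?c (r - 1) + ?c (r + 1)) * ?I r ^ (2 * ?c r)) = O_factor n \<nu> (qv n)"
    unfolding O_factor_def laurent_power_mult_inverse[OF unit, symmetric]
    by (rule prod.cong) (simp_all add: V_def algebra_simps)
  finally show ?thesis by (simp add: V_def)
qed

section \<open>Hooks as pairs of edges\<close>

lemma mem_nu_iff_edges: "(i, j) \<in> \<nu> \<longleftrightarrow> down_edge i < up_edge j"
proof (cases "(i, j) \<in> \<nu>")
  case True
  then have "i < part \<nu> j" "j < part (conjugate \<nu>) i"
    using mem_partition_iff[OF nu] mem_partition_iff[OF nu', of j i] by auto
  then show ?thesis using True by (simp add: down_edge_def up_edge_def)
next
  case False
  then have "part \<nu> j \<le> i" "part (conjugate \<nu>) i \<le> j"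
    using mem_partition_iff[OF nu, of i j] mem_partition_iff[OF nu', of j i] by auto
  then show ?thesis using False by (simp add: down_edge_def up_edge_def)
qed

text \<open>A hook is a chain of boxes on consecutive diagonals, one on each: those from i - j
  upwards have second coordinate j, the smaller ones first coordinate i. Its extreme boxes adjoin
  the down edge of i and the up edge of j.\<close>

lemma sum_hook:
  fixes f :: "int \<Rightarrow> expo"
  assumes "(i, j) \<in> \<nu>"
  shows "(\<Sum>(x, y)\<in>hook \<nu> (i, j). f (int x - int y)) = (\<Sum>r = down_edge i + 1..up_edge j. f r)"
proof (rule sum.reindex_bij_witness[where j = "\<lambda>(x, y). int x - int y"
      and i = "\<lambda>r. if r \<ge> int i - int j then (nat (r + int j), j) else (i, nat (int i - r))"])
  have ij: "i < part \<nu> j" "j < part (conjugate \<nu>) i"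
    using assms mem_partition_iff[OF nu] mem_partition_iff[OF nu', of j i] by auto
  have row: "(x, j) \<in> \<nu> \<longleftrightarrow> x < part \<nu> j" and col: "(i, y) \<in> \<nu> \<longleftrightarrow> y < part (conjugate \<nu>) i" for x y
    using mem_partition_iff[OF nu] mem_partition_iff[OF nu', of y i] by auto
  {
    fix b assume "b \<in> hook \<nu> (i, j)"
    then obtain a where "b = (i + a, j) \<and> i + a < part \<nu> j \<or> b = (i, j + a) \<and> j + a < part (conjugate \<nu>) i"
      using row col by (auto simp: hook_def)
    then show "(if (case b of (x, y) \<Rightarrow> int x - int y) \<ge> int i - int j
          then (nat ((case b of (x, y) \<Rightarrow> int x - int y) + int j), j)
          else (i, nat (int i - (case b of (x, y) \<Rightarrow> int x - int y)))) = b"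
      "(case b of (x, y) \<Rightarrow> int x - int y) \<in> {down_edge i + 1..up_edge j}"
      using ij by (auto simp: down_edge_def up_edge_def)
  }
  {
    fix r assume r: "r \<in> {down_edge i + 1..up_edge j}"
    show "(case if r \<ge> int i - int j then (nat (r + int j), j) else (i, nat (int i - r)) of (x, y) \<Rightarrow> int x - int y) = r"
      by auto
    show "(if r \<ge> int i - int j then (nat (r + int j), j) else (i, nat (int i - r))) \<in> hook \<nu> (i, j)"
    proof (cases "r \<ge> int i - int j")
      case True
      then have "nat (r + int j) = i + nat (r + int j - int i)" "nat (r + int j) < part \<nu> j"
        using r by (auto simp: up_edge_def)
      then show ?thesis using True row by (auto simp: hook_def)
    next
      case False
      then have "nat (int i - r) = j + nat (int i - r - int j)" "nat (int i - r) < part (conjugate \<nu>) i"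
        using r by (auto simp: down_edge_def)
      then show ?thesis using False col by (auto simp: hook_def)
    qed
  }
qed auto

lemma hook_exponent:
  assumes n: "n \<ge> 1" and ij: "(i, j) \<in> \<nu>"
  shows "(\<Prod>s = 1..int n. qv n s ^ color_count n (hook \<nu> (i, j)) s) = mono_of (Q n 0 (up_edge j) - Q n 0 (down_edge i))"
proof -
  let ?h = "hook \<nu> (i, j)" and ?c = "\<lambda>(x, y). int x - int y :: int"
  have fin: "finite ?h" by (rule finite_subset[OF _ finite_nu]) (auto simp: hook_def)
  \<comment> \<open>The product runs over s = 1, ..., n, so colour 0 is represented by n.\<close>
  let ?rep = "\<lambda>b. (?c b - 1) mod int n + 1"
  have "(\<Prod>s = 1..int n. qv n s ^ color_count n ?h s) = mono_of (\<Sum>s = 1..int n. of_nat (color_count n ?h s) * ev n 0 s)"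
    using qv_eq_mono_of[of n 0] by (simp add: mono_of_power mono_of_sum)
  also have "(\<Sum>s = 1..int n. of_nat (color_count n ?h s) * ev n 0 s) = (\<Sum>s = 1..int n. \<Sum>b | b \<in> ?h \<and> ?rep b = s. ev n 0 (?c b))"
  proof (rule sum.cong)
    fix s assume s: "s \<in> {1..int n}"
    have "has_color n s b \<longleftrightarrow> ?rep b = s" for b
    proof -
      have "?rep b = s \<longleftrightarrow> (?c b - 1) mod int n = (s - 1) mod int n" using s by auto
      also have "\<dots> \<longleftrightarrow> ?c b mod int n = s mod int n" by (simp add: mod_eq_dvd_iff)
      finally show ?thesis by (auto simp: has_color_def split: prod.splits)
    qed
    then have set: "{b \<in> ?h. has_color n s b} = {b. b \<in> ?h \<and> ?rep b = s}" by auto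
    have "ev n 0 (?c b) = ev n 0 s" if "b \<in> {b \<in> ?h. has_color n s b}" for b
      using that by (intro ev_cong) (auto simp: has_color_def split: prod.splits)
    then have "(\<Sum>b | b \<in> ?h \<and> has_color n s b. ev n 0 (?c b)) = of_nat (color_count n ?h s) * ev n 0 s"
      by (simp add: color_count_def)
    then show "of_nat (color_count n ?h s) * ev n 0 s = (\<Sum>b | b \<in> ?h \<and> ?rep b = s. ev n 0 (?c b))"
      unfolding set[symmetric] by simp
  qed simp
  also have "\<dots> = (\<Sum>b\<in>?h. ev n 0 (?c b))"
  proof (rule sum.group[OF fin])
    have "0 < int n" using n by simp
    then show "?rep ` ?h \<subseteq> {1..int n}" using pos_mod_bound[of "int n"] by (auto simp: add1_zle_eq)
  qed simp
  also have "\<dots> = (\<Sum>r = down_edge i + 1..up_edge j. ev n 0 r)"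
    using sum_hook[OF ij, of "ev n 0"] by (simp add: case_prod_beta)
  also have "\<dots> = Q n 0 (up_edge j) - Q n 0 (down_edge i)"
    using ij mem_nu_iff_edges by (simp add: Q_diff)
  finally show ?thesis .
qed

text \<open>The hook exponent is a difference of two edge labels, and a box is determined by the
  edges of its two coordinates; hence the hook product is a product over
  \<open>hook_pairs\<close>.\<close>

lemma H_factor_eq:
  assumes n: "n \<ge> 1"
  shows "H_factor n \<nu> (qv n) = (\<Prod>(s, t)\<in>hook_pairs. geo (Q n 0 t - Q n 0 s))"
proof -
  have inj: "inj down_edge" "inj up_edge"
    using strict_mono_imp_inj_on[OF strict_mono_down_edge] strict_mono_up_edge
    by (blast, metis injI linorder_neqE_nat order_less_irrefl)
  have bij: "bij_betw (\<lambda>(i, j). (down_edge i, up_edge j)) \<nu> hook_pairs"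
    unfolding bij_betw_def
  proof
    show "inj_on (\<lambda>(i, j). (down_edge i, up_edge j)) \<nu>" using inj by (auto simp: inj_on_def)
    show "(\<lambda>(i, j). (down_edge i, up_edge j)) ` \<nu> = hook_pairs"
    proof (intro set_eqI)
      fix p :: "int \<times> int" obtain s t where p: "p = (s, t)" by fastforce
      show "p \<in> (\<lambda>(i, j). (down_edge i, up_edge j)) ` \<nu> \<longleftrightarrow> p \<in> hook_pairs"
        unfolding p hook_pairs_def range_up_edge[symmetric] using mem_nu_iff_edges by auto
    qed
  qed
  have "H_factor n \<nu> (qv n) = (\<Prod>p\<in>\<nu>. case (case p of (i, j) \<Rightarrow> (down_edge i, up_edge j)) of (s, t) \<Rightarrow> geo (Q n 0 t - Q n 0 s))"
    unfolding H_factor_def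
  proof (rule prod.cong)
    fix p assume "p \<in> \<nu>"
    then show "1 / (1 - (\<Prod>s = 1..int n. qv n s ^ color_count n (hook \<nu> p) s)) =
        (case (case p of (i, j) \<Rightarrow> (down_edge i, up_edge j)) of (s, t) \<Rightarrow> geo (Q n 0 t - Q n 0 s))"
      by (cases p) (simp add: hook_exponent[OF n] geo_def)
  qed simp
  also have "\<dots> = (\<Prod>(s, t)\<in>hook_pairs. geo (Q n 0 t - Q n 0 s))"
    by (rule prod.reindex_bij_betw[OF bij])
  finally show ?thesis .
qed

end

section \<open>The empty vertex and the MacMahon function\<close>

text \<open>A factor of multiplicity \<open>Suc m\<close> is split into copies indexed by r up to m,
  which makes the product an instance of \<open>infinite_product_exists\<close>. The assumptions
  concern the sums of v with multiples of d, as v itself may have negative entries.\<close>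

lemma MacMahon_limit:
  assumes e: "\<And>m. bounded_expo n 0 (v + of_nat (Suc m) * d)" "\<And>m. int m + 1 \<le> deg (v + of_nat (Suc m) * d)"
  shows "bconv n (\<lambda>K. \<Prod>m\<le>K. geo (v + of_nat (Suc m) * d) ^ Suc m) (MacMahon (mono_of v) (mono_of d))"
proof -
  let ?e = "\<lambda>m. v + of_nat (Suc m) * d" and ?A = "{(m :: nat, r). r \<le> m}"
  let ?S = "\<lambda>K. Sigma {..K} (\<lambda>m. {..m})"
  have ne: "?e m \<noteq> 0" for m using e(2)[of m] by auto
  have near: "near1 n (int m + 1) (geo (?e m))" for m
    by (rule near1_mono[OF near1_geo[OF e(1) ne] e(2)])
  have near1: "near1 n (int (fst p) + 1) (geo (?e (fst p)))" if "p \<in> ?A" for p :: "nat \<times> nat" by (rule near)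
  have fin: "finite {p \<in> ?A. int (fst p) + 1 \<le> d}" for d
    by (rule finite_subset[of _ "{..nat d} \<times> {..nat d}"]) auto
  obtain l where l: "\<And>S. exhausts S ?A \<Longrightarrow> bconv n (\<lambda>N. \<Prod>p\<in>S N. geo (?e (fst p))) l"
    using infinite_product_exists[OF near1 fin] by blast
  have ex: "exhausts ?S ?A" by (auto simp: exhausts_def eventually_sequentially)
  have eq: "(\<Prod>p\<in>?S K. geo (?e (fst p))) = (\<Prod>m\<le>K. geo (?e m) ^ Suc m)" for K
    using prod.Sigma[of "{..K}" "\<lambda>m. {..m}" "\<lambda>m r. geo (?e m)"]
    by (simp add: case_prod_beta del: of_nat_Suc power_Suc)
  have conv: "bconv n (\<lambda>K. \<Prod>m\<le>K. geo (?e m) ^ Suc m) l" using l[OF ex] unfolding eq .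
  define f where "f m = 1 / (1 - mono_of v * mono_of d ^ Suc m) ^ Suc m" for m
  have f: "(1 - mono_of (?e m)) ^ Suc m * geo (?e m) ^ Suc m = 1" "f m = geo (?e m) ^ Suc m" for m
  proof -
    show 1: "(1 - mono_of (?e m)) ^ Suc m * geo (?e m) ^ Suc m = 1"
      unfolding power_mult_distrib[symmetric] geo_mult[OF e(1) ne] by simp
    have "mono_of v * mono_of d ^ Suc m = mono_of (?e m)" by (simp only: mono_of_power mono_of_add)
    then show "f m = geo (?e m) ^ Suc m"
      unfolding f_def divide_laurent_def using laurent_inverse_unique[OF 1] by simp
  qed
  have f0: "f m \<noteq> 0" for m using f(1)[of m] by (metis f(2) mult_zero_right zero_neq_one)
  have "near1 n 1 (\<Prod>m\<le>K. geo (?e m) ^ Suc m)" for K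
  proof -
    have "near1 n 1 (geo (?e m) ^ k)" for m k
    proof -
      have "near1 n 1 (geo (?e m))" by (rule near1_mono[OF near]) simp
      then show ?thesis by (induction k) (simp_all add: near1_1 near1_mult del: of_nat_Suc)
    qed
    then show ?thesis by (intro near1_prod)
  qed
  then have "lcoeff l 0 = 1" by (rule lcoeff_infinite_product_0[OF conv])
  then have l0: "l \<noteq> 0" by auto
  have lim: "(\<lambda>K. \<Prod>m\<le>K. f (m + 0)) \<longlonglongrightarrow> l" using bconv_tendsto[OF conv] by (simp add: f(2) del: power_Suc)
  then have "f has_prod l" using l0 by (simp add: has_prod_def raw_has_prod_def)
  \<comment> \<open>\<open>has_prod\<close> also assigns the value 0 to products with a zero factor;
    \<open>f0\<close> excludes that case.\<close>
  moreover have "p = l" if "f has_prod p" for p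
    using that f0 LIMSEQ_unique[OF _ lim] by (auto simp: has_prod_def raw_has_prod_def)
  ultimately have "prodinf f = l" unfolding prodinf_def by (rule the_equality)
  then show ?thesis using conv unfolding MacMahon_def f_def by simp
qed

lemma Q_period:
  assumes n: "n \<ge> 1"
  shows "Q n c (t + int n * k) = Q n c t + of_int k * Q n c (int n)"
proof -
  have shift: "Q n c (t + int n) = Q n c t + Q n c (int n)" for t
  proof -
    have ev: "ev n c (s + int n) = ev n c s" for s by (rule ev_cong) simp
    show ?thesis
    proof (induction t rule: int_induct[of _ 0])
      case (step1 t)
      have "Q n c (t + 1 + int n) = Q n c (t + int n) + ev n c (t + int n + 1)"
        using Q_step[of n c "t + int n"] by (simp add: algebra_simps)
      also have "ev n c (t + int n + 1) = ev n c (t + 1)" using ev[of "t + 1"] by (simp add: algebra_simps)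
      finally show ?case using step1 by (simp add: Q_step add.assoc add.left_commute)
    next
      case (step2 t)
      have "Q n c (t + int n) = Q n c (t - 1 + int n) + ev n c (t + int n)"
        using Q_step[of n c "t - 1 + int n"] by (simp add: algebra_simps)
      moreover have "Q n c t = Q n c (t - 1) + ev n c t" using Q_step[of n c "t - 1"] by simp
      ultimately show ?case using step2 ev[of t] by (simp add: algebra_simps)
    qed simp
  qed
  show ?thesis
  proof (induction k rule: int_induct[of _ 0])
    case (step1 k)
    then show ?case using shift[of "t + int n * k"] by (simp add: algebra_simps)
  next
    case (step2 k)
    have "t + int n * (k - 1) + int n = t + int n * k" by (simp add: algebra_simps)
    then show ?case using step2 shift[of "t + int n * (k - 1)"] by (simp add: algebra_simps)
  qed simp
qed

text \<open>Division with remainder by n writes the pair as s = a - 1 - n (r + 1) and t = n (m - r)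
  + b. By \<open>Q_period\<close> its exponent depends on a, b and m only, while r runs through 0,
  ..., m; this is the source of the multiplicities in the MacMahon function.\<close>

lemma vertex_empty_eq_prod:
  assumes n: "n \<ge> 1"
  shows "vertex n {} {} {} (qv n) =
    (\<Prod>(a, b)\<in>{1..int n} \<times> {0..<int n}. MacMahon (mono_of (Q n 0 b - Q n 0 (a - 1))) (mono_of (Q n 0 (int n))))"
proof -
  let ?I = "{1..int n} \<times> {0..<int n}" and ?T = "\<lambda>K :: nat. Sigma {..K} (\<lambda>m. {..m})"
  let ?f = "\<lambda>((a, b), m, r). (a - 1 - int n * (int r + 1), int n * (int m - int r) + b)"
  let ?g = "\<lambda>(s, t). ((int n - (- s - 1) mod int n, t mod int n),
      nat ((- s - 1) div int n + t div int n), nat ((- s - 1) div int n))"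
  define S where "S K = ?f ` (?I \<times> ?T K)" for K
  have gf: "?g (?f x) = x" if x: "x \<in> ?I \<times> ?T K" for x K
  proof -
    obtain a b m r where [simp]: "x = ((a, b), m, r)" by (metis surj_pair)
    have ab: "1 \<le> a" "a \<le> int n" "0 \<le> b" "b < int n" "r \<le> m" using x by auto
    have md: "(x + int n * y) mod int n = x" "(x + int n * y) div int n = y" if "0 \<le> x" "x < int n" for x y
      using that by simp_all
    define s t where "s = a - 1 - int n * (int r + 1)" and "t = int n * (int m - int r) + b"
    have st: "- s - 1 = (int n - a) + int n * int r" "t = b + int n * (int m - int r)"
      by (simp_all add: s_def t_def algebra_simps)
    have "(- s - 1) mod int n = int n - a" "(- s - 1) div int n = int r" "t mod int n = b" "t div int n = int m - int r"
      unfolding st by (rule md; use ab in simp)+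
    then have "?g (s, t) = x" using ab by simp
    then show ?thesis by (simp add: s_def t_def)
  qed
  have inj: "inj_on ?f (?I \<times> ?T K)" for K by (rule inj_on_inverseI[of _ ?g]) (rule gf)
  have fg: "?f (?g p) = p \<and> ?g p \<in> ?I \<times> ?T (snd (snd (?g p)) + nat (snd p div int n))"
    if p: "p \<in> {(s, t). s < 0 \<and> 0 \<le> t}" for p
  proof -
    obtain s t where [simp]: "p = (s, t)" by fastforce
    have st: "s < 0" "0 \<le> t" using p by auto
    define \<rho> \<kappa> \<beta> \<tau> where "\<rho> = (- s - 1) mod int n" and "\<kappa> = (- s - 1) div int n"
      and "\<beta> = t mod int n" and "\<tau> = t div int n"
    note defs = this
    have x: "0 \<le> \<kappa>" "0 \<le> \<tau>" "0 \<le> \<rho>" "\<rho> < int n" "0 \<le> \<beta>" "\<beta> < int n"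
      using st n unfolding defs by (auto simp: pos_imp_zdiv_nonneg_iff)
    have "int n * \<kappa> + \<rho> = - s - 1" "int n * \<tau> + \<beta> = t" unfolding defs by auto
    then have "int n - \<rho> - 1 - int n * (\<kappa> + 1) = s" "int n * \<tau> + \<beta> = t" by (simp_all add: algebra_simps)
    moreover have "?g p = ((int n - \<rho>, \<beta>), nat (\<kappa> + \<tau>), nat \<kappa>)" "snd p div int n = \<tau>" by (simp_all add: defs)
    ultimately show ?thesis using x by (simp add: nat_add_distrib)
  qed
  have S: "exhausts S {(s, t). s < 0 \<and> 0 \<le> t}"
    unfolding exhausts_def
  proof (intro conjI allI ballI)
    show "finite (S K)" for K unfolding S_def by auto
    show "S K \<subseteq> {(s, t). s < 0 \<and> 0 \<le> t}" for K
    proof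
      fix p assume "p \<in> S K"
      then obtain x where x: "x \<in> ?I \<times> ?T K" "p = ?f x" unfolding S_def by blast
      obtain a b m r where [simp]: "x = ((a, b), m, r)" by (metis surj_pair)
      have ab: "1 \<le> a" "a \<le> int n" "0 \<le> b" "b < int n" "r \<le> m" using x by auto
      have "int n \<le> int n * (int r + 1)" by (simp add: distrib_left)
      then have "a - 1 < int n * (int r + 1)" using ab by linarith
      moreover have "0 \<le> int n * (int m - int r) + b" using ab by simp
      ultimately show "p \<in> {(s, t). s < 0 \<and> 0 \<le> t}" using x(2) by simp
    qed
    fix p :: "int \<times> int" assume p: "p \<in> {(s, t). s < 0 \<and> 0 \<le> t}"
    let ?K = "snd (snd (?g p)) + nat (snd p div int n)"
    have "p \<in> S K" if "K \<ge> ?K" for K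
    proof -
      have mono: "?I \<times> ?T L \<subseteq> ?I \<times> ?T K" if "L \<le> K" for L using that by auto
      have "?g p \<in> ?I \<times> ?T K" by (rule subsetD[OF mono[OF that] conjunct2[OF fg[OF p]]])
      then have "?f (?g p) \<in> S K" unfolding S_def by (rule imageI)
      then show ?thesis unfolding conjunct1[OF fg[OF p]] .
    qed
    then show "\<forall>\<^sub>F K in sequentially. p \<in> S K" by (auto simp: eventually_sequentially)
  qed
  let ?v = "\<lambda>(a, b). Q n 0 b - Q n 0 (a - 1)" and ?d = "Q n 0 (int n)"
  have Qf: "Q n 0 t - Q n 0 s = ?v (a, b) + of_nat (Suc m) * ?d"
    if "(s, t) = ?f ((a, b), m, r)" for s t a b m r
  proof -
    have "s = a - 1 + int n * (- (int r + 1))" "t = b + int n * (int m - int r)"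
      using that by (simp_all add: algebra_simps)
    then show ?thesis by (simp only: Q_period[OF n]) (simp add: algebra_simps)
  qed
  have prod: "(\<Prod>(s, t)\<in>S K. geo (Q n 0 t - Q n 0 s)) = (\<Prod>p\<in>?I. \<Prod>m\<le>K. geo (?v p + of_nat (Suc m) * ?d) ^ Suc m)" for K
  proof -
    have "(\<Prod>(s, t)\<in>S K. geo (Q n 0 t - Q n 0 s)) = (\<Prod>x\<in>?I \<times> ?T K. case ?f x of (s, t) \<Rightarrow> geo (Q n 0 t - Q n 0 s))"
      unfolding S_def by (subst prod.reindex[OF inj]) simp
    also have "\<dots> = (\<Prod>(p, m, r)\<in>?I \<times> ?T K. geo (?v p + of_nat (Suc m) * ?d))"
    proof (rule prod.cong)
      fix x :: "(int \<times> int) \<times> nat \<times> nat"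
      obtain a b m r where x: "x = ((a, b), m, r)" by (metis surj_pair)
      obtain s t where "?f ((a, b), m, r) = (s, t)" by (rule prod.exhaust)
      then have st: "(s, t) = ?f ((a, b), m, r)" by (rule sym)
      show "(case ?f x of (s, t) \<Rightarrow> geo (Q n 0 t - Q n 0 s)) = (case x of (p, m, r) \<Rightarrow> geo (?v p + of_nat (Suc m) * ?d))"
        unfolding x st[symmetric] using Qf[OF st] by simp
    qed simp
    also have "\<dots> = (\<Prod>p\<in>?I. \<Prod>(m, r)\<in>?T K. geo (?v p + of_nat (Suc m) * ?d))"
      by (rule prod.cartesian_product[symmetric])
    also have "\<dots> = (\<Prod>p\<in>?I. \<Prod>m\<le>K. geo (?v p + of_nat (Suc m) * ?d) ^ Suc m)"
      by (simp add: prod.Sigma[symmetric])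
    finally show ?thesis .
  qed
  have "bconv n (\<lambda>K. \<Prod>p\<in>?I. \<Prod>m\<le>K. geo (?v p + of_nat (Suc m) * ?d) ^ Suc m)
      (\<Prod>p\<in>?I. MacMahon (mono_of (?v p)) (mono_of ?d))"
  proof (intro bconv_prod MacMahon_limit)
    fix p m assume p: "p \<in> ?I"
    obtain a b where ab: "p = (a, b)" "1 \<le> a" "a \<le> int n" "0 \<le> b" "b < int n" using p by auto
    obtain s t where "?f ((a, b), m, 0) = (s, t)" by (rule prod.exhaust)
    then have st: "(s, t) = ?f ((a, b), m, 0)" by (rule sym)
    have st': "s = a - 1 - int n" "t = int n * int m + b" using st by simp_all
    have "1 * int m \<le> int n * int m" using n by (intro mult_right_mono) auto
    then have less: "int m + 1 \<le> t - s" using st' ab by linarith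
    show "bounded_expo n 0 (?v p + of_nat (Suc m) * ?d)"
      using bounded_Q_diff[OF n, of s t 0] less unfolding ab(1) Qf[OF st] by simp
    show "int m + 1 \<le> deg (?v p + of_nat (Suc m) * ?d)"
      using less unfolding ab(1) Qf[OF st, symmetric] by (simp add: deg_diff deg_Q)
  qed
  moreover have "bconv n (\<lambda>K. \<Prod>(s, t)\<in>S K. geo (Q n 0 t - Q n 0 s)) (vertex n {} {} {} (qv n))"
    using bconv_vertex_empty[OF n S] by simp
  ultimately have "vertex n {} {} {} (qv n) = (\<Prod>p\<in>?I. MacMahon (mono_of (?v p)) (mono_of ?d))"
    unfolding prod using bconv_unique by blast
  then show ?thesis by (simp add: case_prod_beta)
qed

lemma vertex_empty_MacMahon:
  assumes n: "n \<ge> 1"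
  shows "vertex n {} {} {} (qv n) =
      (let q = (\<Prod>k = 0..<int n. qv n k) in
       MacMahon 1 q ^ n
       * (\<Prod>(a, b) | 0 < a \<and> a \<le> b \<and> b < int n.
            MacMahon (\<Prod>k = a..b. qv n k) q * MacMahon (\<Prod>k = a..b. inverse (qv n k)) q))"
proof -
  define q where "q = mono_of (Q n 0 (int n))"
  have qv: "qv n k = mono_of (ev n 0 k)" for k using qv_eq_mono_of[of n 0 k] by simp
  have q: "(\<Prod>k = 0..<int n. qv n k) = q"
  proof -
    have "(\<Sum>k = 0..<int n. ev n 0 k) = Q n 0 (int n - 1) - Q n 0 (- 1)"
      using Q_diff[of "- 1" "int n - 1" n 0] n by (simp add: atLeastLessThan_def atLeastAtMost_def lessThan_def atMost_def)
    also have "\<dots> = Q n 0 (int n)"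
      using Q_period[OF n, of 0 "- 1" 1] by (simp add: algebra_simps)
    finally show ?thesis by (simp add: qv q_def flip: mono_of_sum)
  qed
  let ?P = "{(a, b). 0 < a \<and> a \<le> b \<and> b < int n}" and ?D = "(\<lambda>b. (b + 1, b)) ` {0..<int n}"
  let ?s = "\<lambda>(a, b). (b + 1, a - 1)"
  let ?M = "\<lambda>(a, b). MacMahon (mono_of (Q n 0 b - Q n 0 (a - 1))) q"
  have fin: "finite ?P" by (rule finite_subset[of _ "{0..int n} \<times> {0..int n}"]) auto
  \<comment> \<open>For a = b + 1 the label difference is 0, which gives n factors
    \<open>MacMahon 1 q\<close>. For a at most b it is the product of the variables from a to b, and
    beyond b + 1 the swap turns it into the inverse of such a product.\<close>
  have un: "{1..int n} \<times> {0..<int n} = ?D \<union> (?P \<union> ?s ` ?P)"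
  proof (intro set_eqI iffI)
    fix p assume p: "p \<in> {1..int n} \<times> {0..<int n}"
    obtain a b where ab: "p = (a, b)" by fastforce
    consider "a = b + 1" | "a \<le> b" | "b + 1 < a" by linarith
    then show "p \<in> ?D \<union> (?P \<union> ?s ` ?P)"
    proof cases
      case 3
      then have "p = ?s (b + 1, a - 1)" "(b + 1, a - 1) \<in> ?P" using p by (auto simp: ab)
      then show ?thesis by blast
    qed (use p in \<open>auto simp: ab\<close>)
  qed auto
  have "vertex n {} {} {} (qv n) = prod ?M (?D \<union> (?P \<union> ?s ` ?P))"
    unfolding un[symmetric] q_def by (rule vertex_empty_eq_prod[OF n])
  also have "\<dots> = prod ?M ?D * (prod ?M ?P * prod ?M (?s ` ?P))"
    using fin by (subst prod.union_disjoint, simp, simp, fastforce, subst prod.union_disjoint) auto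
  also have "prod ?M ?D = MacMahon 1 q ^ n"
    by (subst prod.reindex) (auto simp: inj_on_def)
  also have "prod ?M (?s ` ?P) = (\<Prod>(a, b)\<in>?P. MacMahon (\<Prod>k = a..b. inverse (qv n k)) q)"
  proof (subst prod.reindex)
    show "inj_on ?s ?P" by (auto simp: inj_on_def)
    show "prod (?M \<circ> ?s) ?P = (\<Prod>(a, b)\<in>?P. MacMahon (\<Prod>k = a..b. inverse (qv n k)) q)"
    proof (rule prod.cong, simp, clarsimp)
      fix a b :: int assume "0 < a" "a \<le> b"
      then have "Q n 0 (a - 1) - Q n 0 b = (\<Sum>k = a..b. - ev n 0 k)"
        using Q_diff[of "a - 1" b n 0] by (simp add: sum_negf algebra_simps)
      then show "MacMahon (mono_of (Q n 0 (a - 1) - Q n 0 b)) q = MacMahon (\<Prod>k = a..b. inverse (qv n k)) q"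
        by (simp add: qv inverse_mono_of mono_of_sum)
    qed
  qed
  also have "prod ?M ?P = (\<Prod>(a, b)\<in>?P. MacMahon (\<Prod>k = a..b. qv n k) q)"
    by (rule prod.cong) (auto simp: qv Q_diff mono_of_sum)
  also have "(\<Prod>(a, b)\<in>?P. MacMahon (\<Prod>k = a..b. qv n k) q) * (\<Prod>(a, b)\<in>?P. MacMahon (\<Prod>k = a..b. inverse (qv n k)) q) =
      (\<Prod>(a, b)\<in>?P. MacMahon (\<Prod>k = a..b. qv n k) q * MacMahon (\<Prod>k = a..b. inverse (qv n k)) q)"
    unfolding prod.distrib[symmetric] by (rule prod.cong) auto
  finally show ?thesis unfolding q Let_def .
qed

theorem theorem12:
  fixes n :: nat and lam \<mu> \<nu> :: diagram
  assumes "n \<ge> 1" and "is_partition lam" and "is_partition \<mu>" and "is_partition \<nu>"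
  shows "vertex n lam \<mu> \<nu> (qv n) =
      vertex n {} {} {} (qv n) * q_A n lam (qv n) * q_A n (conjugate \<mu>) (bar (qv n))
      * H_factor n \<nu> (qv n) * O_factor n \<nu> (qv n)
      * (\<Sum>\<^sub>\<infinity>\<eta> | is_partition \<eta>.
           qv n 0 powi (- int (card \<eta>))
           * skew_schur (conjugate lam) \<eta> (qfrak_seq (bar (qv n)) \<nu>)
           * skew_schur \<mu> \<eta> (qfrak_seq (qv n) (conjugate \<nu>)))
    \<and> vertex n {} {} {} (qv n) =
      (let q = (\<Prod>k = 0..<int n. qv n k) in
       MacMahon 1 q ^ n
       * (\<Prod>(a, b) | 0 < a \<and> a \<le> b \<and> b < int n.
            MacMahon (\<Prod>k = a..b. qv n k) q * MacMahon (\<Prod>k = a..b. inverse (qv n k)) q))"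
proof
  interpret vertex_data \<nu> lam \<mu>
    using assms by (intro vertex_data.intro boundary.intro vertex_data_axioms.intro)
  let ?P = "{\<eta>. is_partition \<eta> \<and> \<eta> \<subseteq> \<mu>}"
  let ?S = "\<lambda>\<eta>. skew_schur (conjugate lam) \<eta> (qfrak_seq (bar (qv n)) \<nu>)"
  let ?T = "\<lambda>\<eta>. skew_schur \<mu> \<eta> (qfrak_seq (qv n) (conjugate \<nu>))"
  have qv: "qv n k = mono_of (ev n 0 k)" for k using qv_eq_mono_of[of n 0 k] by simp
  have finP: "finite ?P" using mu by (auto simp: is_partition_def intro: finite_subset[of _ "Pow \<mu>"])
  have qA: "q_A n lam (qv n) = mono_of (- (\<Sum>k<n. of_nat (A_stat lam k n) * ev n 0 (int k)))"
    "q_A n (conjugate \<mu>) (bar (qv n)) = mono_of (- (\<Sum>k<n. of_nat (A_stat (conjugate \<mu>) k n) * ev n 0 (- int k)))"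
    by (simp_all add: q_A_def bar_def qv mono_of_powi mono_of_sum flip: sum_negf)
  \<comment> \<open>The step weight is q_0 to the power |\<lambda>| - |\<eta>|, and the diagonal-0
    term of \<open>prefactor\<close> takes away |\<lambda>|.\<close>
  have summand: "?T \<eta> * (mono_of (step_wt (ev n 0 0) lam_end (part \<eta>)) * ?S \<eta>) * mono_of (- prefactor n 0) =
      q_A n lam (qv n) * q_A n (conjugate \<mu>) (bar (qv n)) * (qv n 0 powi (- int (card \<eta>)) * ?S \<eta> * ?T \<eta>)"
    if "\<eta> \<in> ?P" for \<eta>
  proof -
    have "card \<eta> = psize (part \<eta>)" using that card_partition by blast
    then have eq: "mono_of (step_wt (ev n 0 0) lam_end (part \<eta>)) * mono_of (- prefactor n 0) =
        q_A n lam (qv n) * q_A n (conjugate \<mu>) (bar (qv n)) * qv n 0 powi (- int (card \<eta>))"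
      unfolding qA qv mono_of_powi mono_of_add[symmetric]
      by (simp add: step_wt_def prefactor_def algebra_simps)
    have "?T \<eta> * (mono_of (step_wt (ev n 0 0) lam_end (part \<eta>)) * ?S \<eta>) * mono_of (- prefactor n 0) =
        (mono_of (step_wt (ev n 0 0) lam_end (part \<eta>)) * mono_of (- prefactor n 0)) * (?S \<eta> * ?T \<eta>)"
      by (simp only: ac_simps)
    then show ?thesis unfolding eq by (simp only: ac_simps)
  qed
  have "(\<Sum>\<^sub>\<infinity>\<eta> | is_partition \<eta>. qv n 0 powi (- int (card \<eta>)) * ?S \<eta> * ?T \<eta>) =
      (\<Sum>\<^sub>\<infinity>\<eta>\<in>?P. qv n 0 powi (- int (card \<eta>)) * ?S \<eta> * ?T \<eta>)"
    \<comment> \<open>\<open>skew_schur \<mu> \<eta>\<close> is 0 unless \<eta> is contained in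
      \<mu>, so the infinite sum is a finite one.\<close>
    by (rule infsum_cong_neutral) (auto simp: skew_schur_def)
  then have sum: "(\<Sum>\<^sub>\<infinity>\<eta> | is_partition \<eta>. qv n 0 powi (- int (card \<eta>)) * ?S \<eta> * ?T \<eta>) =
      (\<Sum>\<eta>\<in>?P. qv n 0 powi (- int (card \<eta>)) * ?S \<eta> * ?T \<eta>)" using finP by simp
  have "vertex n lam \<mu> \<nu> (qv n) = pair_prod n 0 *
      (\<Sum>\<eta>\<in>?P. ?T \<eta> * (mono_of (step_wt (ev n 0 0) lam_end (part \<eta>)) * ?S \<eta>)) * mono_of (- prefactor n 0)"
    using vertex_eq[OF assms(1), of 0] skew_mu_eq[of _ n 0] skew_lam_eq[of _ n 0] by simp
  also have "\<dots> = pair_prod n 0 *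
      (\<Sum>\<eta>\<in>?P. q_A n lam (qv n) * q_A n (conjugate \<mu>) (bar (qv n)) * (qv n 0 powi (- int (card \<eta>)) * ?S \<eta> * ?T \<eta>))"
    unfolding mult.assoc[of "pair_prod n 0"] sum_distrib_right using summand by (intro arg_cong[of _ _ "(*) _"] sum.cong) auto
  also have "\<dots> = vertex n {} {} {} (qv n) * q_A n lam (qv n) * q_A n (conjugate \<mu>) (bar (qv n))
      * H_factor n \<nu> (qv n) * O_factor n \<nu> (qv n) * (\<Sum>\<eta>\<in>?P. qv n 0 powi (- int (card \<eta>)) * ?S \<eta> * ?T \<eta>)"
    unfolding pair_prod_eq[OF assms(1)] H_factor_eq[OF assms(1)] sum_distrib_left[symmetric]
    by (simp only: ac_simps)
  finally show "vertex n lam \<mu> \<nu> (qv n) =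
      vertex n {} {} {} (qv n) * q_A n lam (qv n) * q_A n (conjugate \<mu>) (bar (qv n))
      * H_factor n \<nu> (qv n) * O_factor n \<nu> (qv n)
      * (\<Sum>\<^sub>\<infinity>\<eta> | is_partition \<eta>. qv n 0 powi (- int (card \<eta>)) * ?S \<eta> * ?T \<eta>)"
    unfolding sum .
qed (rule vertex_empty_MacMahon[OF assms(1)])

end
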